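(* Let $G=(V,m,E,a)$ be a finite weighted directed graph with a collection of directed clusters with total edge set $\tilde E\subseteq E$. For $\beta>0$ let $L^-_\beta=L^-_{E\setminus\tilde E}+\beta L^-_{\tilde E}$, and let $\underline L^-$ be the in-degree Laplacian of the reduced graph $\underline G^-$. Then for every $t>0$, $$\big\|e^{-tL^-_\beta}-J^-_\uparrow e^{-t\underline L^-}J^-_\downarrow\big\|\longrightarrow0\qquad\text{as }\beta\to\infty .$$
   Context: Graphs: a finite weighted directed graph $G=(V,m,E,a)$ has a finite vertex set $V$, node masses $m:V\to(0,\infty)$, an edge set $E\subseteq V\times V$, and weights $a:V\times V\to[0,\infty)$ with $a(v,w)>0$ iff $(v,w)\in E$. The edge $(i,j)$ originates at $j$ and terminates at $i$. $\ell^2(G)$ is the space of functions $f:V\to\mathbb C$ with $\langle f,g\rangle_{\ell^2(G)}=\sum_x\overline{f(x)}g(x)m(x)$. $\chi_S$ is the indicator function of $S\subseteq V$. In-degree Laplacian: $[L^-f](x)=\frac1{m(x)}\big(d^-(x)f(x)-\sum_ya(x,y)f(y)\big)$, $d^-(v)=\sum_ia(v,i)$. For $F\subseteq E$, $L^-_F$ is the in-degree Laplacian of $(V,m,F,a\chi_F)$. Reaches of a directed graph: the reachable set of a node $i$ is the set of all nodes $j$ (including $i$) for which there is a directed path starting at $i$ and ending at $j$. A reach $R$ is a maximal reachable set. The exclusive part $H(R)$ is the set of vertices of $R$ lying in no other reach; the common part is $C(R)=R\setminus H(R)$. Collection of directed clusters: a finite family of finite edge sets $\tilde E_i\subseteq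 E$ with union $\tilde E$, such that each $\tilde E_i$ determines a single reach of $(V,\tilde E)$. (Any finite $\tilde E\subseteq E$ decomposes in this way; reaches may share nodes. Each vertex not incident to an edge of $\tilde E$ forms a singleton reach of $(V,\tilde E)$.) Kernel vectors: let $R$ be a reach of $(V,\tilde E)$. $\vec\gamma^-_R$ is the unique element of $\ker L^-_{\tilde E}$ that equals $1$ on $H(R)$ and vanishes outside $R$ (its values on $C(R)$ lie in $(0,1)$). The weight vector of $R$ is $\omega_R(i)=\sum_\tau\prod_{(x,y)\in\tau}a(x,y)$, summed over all directed spanning trees $\tau\subseteq\tilde E$ of $R$ rooted at $i$ (all edges directed away from the root $i$; an empty product is $1$), and $\omega_R(i)=0$ if there are none. Set $\overleftarrow\gamma^-_R=\omega_R/\sum_j\omega_R(j)m(j)$. $P^-$ is the Riesz projection of $L^-_{\tilde E}$ at $0$: $P^-=\frac1{2\pi i}\oint_{|\zeta|=\epsilon}(\zeta-L^-_{\tilde E})^{-1}d\zeta$, with $\epsilon>0$ so small that $0$ is the only point of $\sigma(L^-_{\tilde E})$ in the closed disc of radius $\epsilon$. Reduced graph $\underline G^-=(\underline V^-,\underline m^-,\underline E^-,\underline a^-)$: $\underline V^-$ is the set of reaches of $(V,\tilde E)$; $\underline m^-(R)=\langle\chi_R,P^-\chi_R\rangle_{\ell^2(G)}$; $\underline a^-(R,S)=\underline m^-(R)\sum_{r\in R,\,s\in S}\overleftarrow\gamma^-_R(r)\,a(r,s)\,\vec\gamma^-_S(s)$; $\underline E^-=\{(R,S):\underline a^-(R,S)>0\}$.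 $\underline L^-$ is its in-degree Laplacian on $\ell^2(\underline G^-)$. $J^-_\downarrow:\ell^2(G)\to\ell^2(\underline G^-)$, $[J^-_\downarrow f](R)=\langle\overleftarrow\gamma^-_R,f\rangle_{\ell^2(G)}$; $J^-_\uparrow:\ell^2(\underline G^-)\to\ell^2(G)$, $J^-_\uparrow\underline f=\sum_R\underline f(R)\vec\gamma^-_R$. *)

theory Defs
  imports "HOL-Complex_Analysis.Complex_Analysis"
begin

section \<open>Finite weighted directed graphs\<close>

text \<open>
  The pair \<open>(x, y)\<close> is the edge that originates at \<open>y\<close> and terminates at \<open>x\<close>. The reduced graph
  below has sets of nodes as its nodes, so vertex sets are explicit carriers and not types.
\<close>

record 'a wdigraph =
  verts :: "'a set"
  mass :: "'a \<Rightarrow> real"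
  edges :: "('a \<times> 'a) set"
  weight :: "'a \<Rightarrow> 'a \<Rightarrow> real"

locale finite_wdigraph =
  fixes G :: "'a wdigraph"
  assumes finite_verts: "finite (verts G)"
    and mass_pos: "x \<in> verts G \<Longrightarrow> mass G x > 0"
    and edges_subset: "edges G \<subseteq> verts G \<times> verts G"
    and weight_nonneg: "\<lbrakk>x \<in> verts G; y \<in> verts G\<rbrakk> \<Longrightarrow> weight G x y \<ge> 0"
    and weight_pos_iff:
      "\<lbrakk>x \<in> verts G; y \<in> verts G\<rbrakk> \<Longrightarrow> weight G x y > 0 \<longleftrightarrow> (x, y) \<in> edges G"

definition edge_restrict :: "'a wdigraph \<Rightarrow> ('a \<times> 'a) set \<Rightarrow> 'a wdigraph" where
  "edge_restrict G F =
     G\<lparr>edges := F, weight := (\<lambda>x y. if (x, y) \<in> F then weight G x y else 0)\<rparr>"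


section \<open>The space \<open>\<ell>\<^sup>2(G)\<close> and linear operators on it\<close>

text \<open>
  A function on the node set is represented by its extension by zero to the whole type, and an
  operator by a map on such functions; its values outside \<open>ell2 G\<close> are irrelevant.
\<close>

definition ell2 :: "'a wdigraph \<Rightarrow> ('a \<Rightarrow> complex) set" where
  "ell2 G = {f. \<forall>x. x \<notin> verts G \<longrightarrow> f x = 0}"

definition ell2_inner :: "'a wdigraph \<Rightarrow> ('a \<Rightarrow> complex) \<Rightarrow> ('a \<Rightarrow> complex) \<Rightarrow> complex" where
  "ell2_inner G f g = (\<Sum>x\<in>verts G. cnj (f x) * g x * of_real (mass G x))"

definition ell2_norm :: "'a wdigraph \<Rightarrow> ('a \<Rightarrow> complex) \<Rightarrow> real" where
  "ell2_norm G f = sqrt (Re (ell2_inner G f f))"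

definition op_norm :: "'a wdigraph \<Rightarrow> (('a \<Rightarrow> complex) \<Rightarrow> 'a \<Rightarrow> complex) \<Rightarrow> real" where
  "op_norm G T = (SUP f\<in>{f \<in> ell2 G. ell2_norm G f \<le> 1}. ell2_norm G (T f))"

text \<open>
  The exponential \<open>exp (s T)\<close> as its power series. It is evaluated pointwise, which on a
  finite-dimensional space is the same as convergence in operator norm.
\<close>

definition op_exp ::
    "real \<Rightarrow> (('a \<Rightarrow> complex) \<Rightarrow> 'a \<Rightarrow> complex) \<Rightarrow> ('a \<Rightarrow> complex) \<Rightarrow> 'a \<Rightarrow> complex" where
  "op_exp s T f x = (\<Sum>n. of_real (s ^ n / fact n) * (T ^^ n) f x)"

definition op_spectrum :: "'a wdigraph \<Rightarrow> (('a \<Rightarrow> complex) \<Rightarrow> 'a \<Rightarrow> complex) \<Rightarrow> complex set" where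
  "op_spectrum G T = {\<zeta>. \<not> bij_betw (\<lambda>f x. \<zeta> * f x - T f x) (ell2 G) (ell2 G)}"

definition resolvent ::
    "'a wdigraph \<Rightarrow> (('a \<Rightarrow> complex) \<Rightarrow> 'a \<Rightarrow> complex) \<Rightarrow> complex \<Rightarrow>
     ('a \<Rightarrow> complex) \<Rightarrow> 'a \<Rightarrow> complex" where
  "resolvent G T \<zeta> = inv_into (ell2 G) (\<lambda>f x. \<zeta> * f x - T f x)"

text \<open>
  A radius for the Riesz projection at \<open>0\<close>. The inclusion, rather than an equality with \<open>{0}\<close>,
  covers operators that do not have \<open>0\<close> in their spectrum; the in-degree Laplacian of a nonempty
  graph does. The projection does not depend on which such radius is selected.
\<close>

definition riesz_radius :: "'a wdigraph \<Rightarrow> (('a \<Rightarrow> complex) \<Rightarrow> 'a \<Rightarrow> complex) \<Rightarrow> real" where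
  "riesz_radius G T = (SOME \<epsilon>. \<epsilon> > 0 \<and> op_spectrum G T \<inter> cball 0 \<epsilon> \<subseteq> {0})"

definition riesz_projection ::
    "'a wdigraph \<Rightarrow> (('a \<Rightarrow> complex) \<Rightarrow> 'a \<Rightarrow> complex) \<Rightarrow> ('a \<Rightarrow> complex) \<Rightarrow> 'a \<Rightarrow> complex" where
  "riesz_projection G T f x =
     1 / (2 * of_real pi * \<i>) *
     contour_integral (circlepath 0 (riesz_radius G T)) (\<lambda>\<zeta>. resolvent G T \<zeta> f x)"


section \<open>In-degree Laplacians\<close>

definition in_degree :: "'a wdigraph \<Rightarrow> 'a \<Rightarrow> real" where
  "in_degree G x = (\<Sum>y\<in>verts G. weight G x y)"

definition laplacian :: "'a wdigraph \<Rightarrow> ('a \<Rightarrow> complex) \<Rightarrow> 'a \<Rightarrow> complex" where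
  "laplacian G f x =
     (if x \<in> verts G
      then 1 / of_real (mass G x) *
           (of_real (in_degree G x) * f x - (\<Sum>y\<in>verts G. of_real (weight G x y) * f y))
      else 0)"

definition scaled_laplacian ::
    "'a wdigraph \<Rightarrow> ('a \<times> 'a) set \<Rightarrow> real \<Rightarrow> ('a \<Rightarrow> complex) \<Rightarrow> 'a \<Rightarrow> complex" where
  "scaled_laplacian G F \<beta> f x =
     laplacian (edge_restrict G (edges G - F)) f x
     + of_real \<beta> * laplacian (edge_restrict G F) f x"


section \<open>Reaches and directed clusters\<close>

text \<open>
  By the orientation convention, \<open>(j, i) \<in> F\<^sup>*\<close> says that a directed path leads from \<open>i\<close> to \<open>j\<close>.
\<close>

definition reachable_set :: "'a set \<Rightarrow> ('a \<times> 'a) set \<Rightarrow> 'a \<Rightarrow> 'a set" where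
  "reachable_set V F i = {j \<in> V. (j, i) \<in> F\<^sup>*}"

definition reaches :: "'a set \<Rightarrow> ('a \<times> 'a) set \<Rightarrow> 'a set set" where
  "reaches V F =
     {R \<in> reachable_set V F ` V. \<forall>S \<in> reachable_set V F ` V. R \<subseteq> S \<longrightarrow> R = S}"

definition exclusive_part :: "'a set \<Rightarrow> ('a \<times> 'a) set \<Rightarrow> 'a set \<Rightarrow> 'a set" where
  "exclusive_part V F R = {x \<in> R. \<forall>S \<in> reaches V F. x \<in> S \<longrightarrow> S = R}"

text \<open>
  An edge set determines the set \<open>Field F\<close> of nodes incident to it, which has to be a reach
  of the graph formed by all clusters together.
\<close>

definition directed_clusters :: "'a wdigraph \<Rightarrow> ('a \<times> 'a) set set \<Rightarrow> bool" where
  "directed_clusters G \<C> \<longleftrightarrow>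
     finite \<C> \<and> (\<forall>F\<in>\<C>. finite F \<and> F \<subseteq> edges G \<and> Field F \<in> reaches (verts G) (\<Union>\<C>))"


section \<open>Kernel vectors\<close>

definition kernel_vector ::
    "'a wdigraph \<Rightarrow> ('a \<times> 'a) set \<Rightarrow> 'a set \<Rightarrow> 'a \<Rightarrow> complex" where
  "kernel_vector G F R =
     (THE f. f \<in> ell2 G \<and> laplacian (edge_restrict G F) f = (\<lambda>_. 0) \<and>
             (\<forall>x \<in> exclusive_part (verts G) F R. f x = 1) \<and> (\<forall>x. x \<notin> R \<longrightarrow> f x = 0))"

text \<open>
  A directed spanning tree of \<open>R\<close> rooted at \<open>i\<close>, given by its edge set: no edge enters the root,
  exactly one edge enters any other node, and all nodes are reached from the root.
\<close>

definition spanning_trees ::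
    "('a \<times> 'a) set \<Rightarrow> 'a set \<Rightarrow> 'a \<Rightarrow> ('a \<times> 'a) set set" where
  "spanning_trees F R i =
     {\<tau>. \<tau> \<subseteq> F \<and> \<tau> \<subseteq> R \<times> R \<and> i \<in> R \<and> (\<forall>y. (i, y) \<notin> \<tau>) \<and>
         (\<forall>x \<in> R - {i}. \<exists>!y. (x, y) \<in> \<tau>) \<and> (\<forall>x \<in> R. (x, i) \<in> \<tau>\<^sup>*)}"

definition tree_weight :: "'a wdigraph \<Rightarrow> ('a \<times> 'a) set \<Rightarrow> 'a set \<Rightarrow> 'a \<Rightarrow> real" where
  "tree_weight G F R i = (\<Sum>\<tau>\<in>spanning_trees F R i. \<Prod>(x, y)\<in>\<tau>. weight G x y)"

definition left_kernel_vector :: "'a wdigraph \<Rightarrow> ('a \<times> 'a) set \<Rightarrow> 'a set \<Rightarrow> 'a \<Rightarrow> real" where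
  "left_kernel_vector G F R i =
     tree_weight G F R i / (\<Sum>j\<in>verts G. tree_weight G F R j * mass G j)"


section \<open>The reduced graph\<close>

text \<open>
  The inner product \<open>\<langle>\<chi>\<^sub>R, P \<chi>\<^sub>R\<rangle>\<close> and the values of the kernel vectors are real for a reach \<open>R\<close>;
  \<open>Re\<close> only converts them to type real.
\<close>

definition reduced_mass :: "'a wdigraph \<Rightarrow> ('a \<times> 'a) set \<Rightarrow> 'a set \<Rightarrow> real" where
  "reduced_mass G F R =
     Re (ell2_inner G (indicator R)
           (riesz_projection G (laplacian (edge_restrict G F)) (indicator R)))"

definition reduced_weight :: "'a wdigraph \<Rightarrow> ('a \<times> 'a) set \<Rightarrow> 'a set \<Rightarrow> 'a set \<Rightarrow> real" where
  "reduced_weight G F R S =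
     reduced_mass G F R *
     (\<Sum>r\<in>R. \<Sum>s\<in>S. left_kernel_vector G F R r * weight G r s * Re (kernel_vector G F S s))"

definition reduced_graph :: "'a wdigraph \<Rightarrow> ('a \<times> 'a) set \<Rightarrow> 'a set wdigraph" where
  "reduced_graph G F =
     \<lparr>verts = reaches (verts G) F,
      mass = reduced_mass G F,
      edges = {(R, S). R \<in> reaches (verts G) F \<and> S \<in> reaches (verts G) F \<and>
                       reduced_weight G F R S > 0},
      weight = reduced_weight G F\<rparr>"

definition J_down ::
    "'a wdigraph \<Rightarrow> ('a \<times> 'a) set \<Rightarrow> ('a \<Rightarrow> complex) \<Rightarrow> 'a set \<Rightarrow> complex" where
  "J_down G F f R =
     (if R \<in> reaches (verts G) F
      then ell2_inner G (\<lambda>x. of_real (left_kernel_vector G F R x)) f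
      else 0)"

definition J_up ::
    "'a wdigraph \<Rightarrow> ('a \<times> 'a) set \<Rightarrow> ('a set \<Rightarrow> complex) \<Rightarrow> 'a \<Rightarrow> complex" where
  "J_up G F f x = (\<Sum>R\<in>reaches (verts G) F. f R * kernel_vector G F R x)"

end

theory Submission
  imports Defs "HOL-Library.Function_Algebras" "HOL-Real_Asymp.Real_Asymp"
begin

text \<open>
  Write \<open>A\<close> and \<open>B\<close> for the Laplacians of the cluster edges and of the remaining edges, and \<open>P\<close> for
  the projection onto the kernel of \<open>A\<close> along its range. By the Markov chain tree theorem the vectors of
  spanning tree weights span the left kernel of \<open>A\<close>; with the maximum principle this gives
  \<open>P = J_up J_down\<close>, and the reduced Laplacian is \<open>J_down B J_up\<close>.

  The semigroup \<open>S(t)\<close> generated by \<open>- L\<^sub>\<beta>\<close>, where \<open>L\<^sub>\<beta> = B + \<beta> A\<close>, contracts the maximum norm,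
  because it is a Poisson mixture of powers of a stochastic matrix. Total variation estimates for
  Poisson weights give \<open>S(t) L\<^sub>\<beta> = O(sqrt \<beta>)\<close>, so that \<open>S(t) A h = (S(t) L\<^sub>\<beta> h - S(t) B h) / \<beta>\<close>
  tends to \<open>0\<close>. On the kernel of \<open>A\<close>, the lift of the reduced evolution, corrected by a term of order
  \<open>1 / \<beta>\<close>, solves the full evolution equation up to \<open>O(1 / \<beta>)\<close>, and contractivity bounds the
  resulting error.
\<close>

section \<open>Linear operators on functions over a finite set\<close>

text \<open>\<open>A\<close> is in general neither symmetric nor diagonalizable, and the norm of
  \<open>L \<beta>\<close> may grow like \<open>\<beta>\<close>, so everything rests on semigroup
  bounds that control this growth. They come from the maximum norm alone; no information on the
  nonzero eigenvalues of \<open>A\<close> enters the limit. The square root comes from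
  uniformization: all jump rates are at most \<open>c = rate * (1 + \<beta>)\<close>, and the
  differences of consecutive Poisson weights with mean \<open>r = c * t\<close> have total variation
  of order \<open>1 / sqrt r\<close>, so a generator of size \<open>c\<close> is damped to
  \<open>sqrt (c / t)\<close>. Division by \<open>\<beta>\<close> leaves the order of
  \<open>1 / sqrt \<beta>\<close>, which suffices. The argument needs \<open>t > 0\<close>: at
  \<open>t = 0\<close> the two sides differ by \<open>1 - P\<close>, which does not depend on
  \<open>\<beta>\<close>. The range of \<open>A\<close> is the kernel of \<open>P\<close>, so
  \<open>f = P f + A h\<close> splits the claim into a fast and a slow part. The identification of
  the Riesz projection with \<open>P\<close> makes the reduced masses positive, so that they cancel
  in the reduced Laplacian.\<close>

definition matop :: "'a set \<Rightarrow> ('a \<Rightarrow> 'a \<Rightarrow> complex) \<Rightarrow> ('a \<Rightarrow> complex) \<Rightarrow> 'a \<Rightarrow> complex" where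
  "matop V M f x = (if x \<in> V then \<Sum>y\<in>V. M x y * f y else 0)"

definition fvec :: "'a set \<Rightarrow> ('a \<Rightarrow> complex) set" where
  "fvec V = {f. \<forall>x. x \<notin> V \<longrightarrow> f x = 0}"

definition unit_vec :: "'a \<Rightarrow> 'a \<Rightarrow> complex" where
  "unit_vec y = (\<lambda>x. if x = y then 1 else 0)"

lemma unit_vec_in_fvec [simp]: "y \<in> V \<Longrightarrow> unit_vec y \<in> fvec V"
  by (auto simp: unit_vec_def fvec_def)

lemma matop_in_fvec [simp]: "matop V M f \<in> fvec V"
  by (auto simp: matop_def fvec_def)

lemma matop_cong: "(\<And>y. y \<in> V \<Longrightarrow> f y = g y) \<Longrightarrow> matop V M f = matop V M g"
  by (auto simp: matop_def fun_eq_iff intro!: sum.cong)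

lemma matop_sum: "matop V M (\<lambda>x. \<Sum>i\<in>I. c i * f i x) x = (\<Sum>i\<in>I. c i * matop V M (f i) x)"
  by (auto simp: matop_def sum_distrib_left mult_ac intro: sum.swap)

lemma matop_add: "matop V M (\<lambda>x. f x + g x) x = matop V M f x + matop V M g x"
  by (simp add: matop_def algebra_simps sum.distrib)

lemma matop_diff: "matop V M (\<lambda>x. f x - g x) x = matop V M f x - matop V M g x"
  by (simp add: matop_def algebra_simps sum_subtractf)

lemma matop_cmult: "matop V M (\<lambda>x. c * f x) x = c * matop V M f x"
  by (simp add: matop_def sum_distrib_left mult_ac)

lemma matop_unit_vec: "finite V \<Longrightarrow> x \<in> V \<Longrightarrow> y \<in> V \<Longrightarrow> matop V M (unit_vec y) x = M x y"
  by (simp add: matop_def unit_vec_def if_distrib sum.delta cong: if_cong)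

lemma unit_vec_commute: "unit_vec x y = unit_vec y x"
  by (simp add: unit_vec_def)

lemma unit_vec_sum:
  assumes "finite V" "x \<in> V"
  shows "(\<Sum>y\<in>V. f y * unit_vec y x) = f x"
  using assms by (simp add: unit_vec_def if_distrib sum.delta' cong: if_cong)

lemma matop_bound:
  assumes "finite V"
  obtains K where "K > 0"
    "\<And>f C x. (\<And>y. y \<in> V \<Longrightarrow> norm (f y) \<le> C) \<Longrightarrow> C \<ge> 0 \<Longrightarrow> norm (matop V M f x) \<le> K * C"
proof
  \<comment> \<open>\<open>K\<close> dominates every row sum of absolute values; the summand 1 keeps
    it positive when \<open>M\<close> vanishes.\<close>
  define K where "K = 1 + (\<Sum>x\<in>V. \<Sum>y\<in>V. norm (M x y))"
  have nn: "(\<Sum>x\<in>V. \<Sum>y\<in>V. norm (M x y)) \<ge> 0"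
    by (intro sum_nonneg) auto
  show "K > 0"
    using nn by (simp add: K_def)
  fix f :: "'a \<Rightarrow> complex" and C x
  assume f: "\<And>y. y \<in> V \<Longrightarrow> norm (f y) \<le> C" and C: "C \<ge> (0::real)"
  show "norm (matop V M f x) \<le> K * C"
  proof (cases "x \<in> V")
    case True
    have "norm (matop V M f x) \<le> (\<Sum>y\<in>V. norm (M x y) * C)"
      using True f by (auto simp: matop_def norm_mult intro!: sum_norm_le mult_left_mono)
    also have "\<dots> = (\<Sum>y\<in>V. norm (M x y)) * C"
      by (simp add: sum_distrib_right)
    also have "(\<Sum>y\<in>V. norm (M x y)) \<le> (\<Sum>x\<in>V. \<Sum>y\<in>V. norm (M x y))"
      using assms True by (intro member_le_sum) (auto intro: sum_nonneg)
    also have "\<dots> \<le> K"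
      by (simp add: K_def)
    finally show ?thesis
      using C by (simp add: mult_right_mono)
  next
    case False
    then show ?thesis
      using \<open>K > 0\<close> C by (simp add: matop_def)
  qed
qed

text \<open>A dimension count: by injectivity the images of the unit vectors are independent and as
  many as the nodes, so adjoining a \<open>g\<close> outside their span would give too many
  independent vectors in the span of the unit vectors.\<close>

lemma matop_surj:
  assumes fin: "finite V"
    and inj: "\<And>f. f \<in> fvec V \<Longrightarrow> (\<And>x. x \<in> V \<Longrightarrow> matop V M f x = 0) \<Longrightarrow> \<forall>x. f x = 0"
    and g: "g \<in> fvec V"
  shows "\<exists>f\<in>fvec V. matop V M f = g"
proof -
  interpret vector_space "\<lambda>(c::complex) (f::'a \<Rightarrow> complex) x. c * f x"
    by unfold_locales (auto simp: fun_eq_iff algebra_simps)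
  have sum_fun: "(\<Sum>i\<in>I. h i) x = (\<Sum>i\<in>I. h i x)" for I :: "'b set" and h :: "'b \<Rightarrow> 'a \<Rightarrow> complex" and x
    by (induction I rule: infinite_finite_induct) auto
  let ?T = "\<lambda>y. matop V M (unit_vec y)"
  define s where "s = ?T ` V"
  define t where "t = (unit_vec ` V :: ('a \<Rightarrow> complex) set)"
  have comb: "matop V M (\<lambda>x. \<Sum>y\<in>V. c y * unit_vec y x) x = (\<Sum>y\<in>V. c y * ?T y x)" for c x
    by (rule matop_sum)
  have zero: "c y = 0" if "\<And>x. x \<in> V \<Longrightarrow> (\<Sum>y\<in>V. c y * ?T y x) = 0" "y \<in> V" for c y
  proof -
    have "(\<lambda>x. \<Sum>y\<in>V. c y * unit_vec y x) \<in> fvec V"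
      by (auto simp: fvec_def unit_vec_def intro!: sum.neutral)
    then have "(\<Sum>y'\<in>V. c y' * unit_vec y' y) = 0"
      using inj[of "\<lambda>x. \<Sum>y\<in>V. c y * unit_vec y x"] that by (simp add: comb)
    then show ?thesis
      using unit_vec_sum[OF fin \<open>y \<in> V\<close>, of c] by simp
  qed
  \<comment> \<open>Independence is stated for the set of images, so sums over \<open>V\<close> can
    be reindexed only if distinct nodes have distinct images. The coefficient vector that refutes a
    collision is \<open>unit_vec y - unit_vec z\<close>.\<close>
  have injT: "inj_on ?T V"
  proof (rule inj_onI, rule ccontr)
    fix y z assume yz: "y \<in> V" "z \<in> V" "?T y = ?T z" "y \<noteq> z"
    have "(\<Sum>w\<in>V. (unit_vec y w - unit_vec z w) * ?T w x) = 0" for x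
    proof -
      have "(\<Sum>w\<in>V. (unit_vec y w - unit_vec z w) * ?T w x) = ?T y x - ?T z x"
        using yz fin unit_vec_sum[of V y "\<lambda>w. ?T w x"] unit_vec_sum[of V z "\<lambda>w. ?T w x"]
        by (simp add: left_diff_distrib sum_subtractf unit_vec_commute[of _ y] unit_vec_commute[of _ z]
              mult.commute[of "matop V M (unit_vec _) x"])
      then show ?thesis
        using yz by simp
    qed
    then have "unit_vec y y - unit_vec z y = 0"
      by (rule zero) (use yz in auto)
    then show False
      using yz by (simp add: unit_vec_def)
  qed
  have ind: "independent s"
  proof (rule independent_if_scalars_zero)
    show "finite s" using fin by (simp add: s_def)
    fix c w assume c: "(\<Sum>w\<in>s. (\<lambda>x. c w * w x)) = 0" and w: "w \<in> s"
    from w obtain y where y: "y \<in> V" "w = ?T y" by (auto simp: s_def)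
    have "(\<Sum>y\<in>V. c (?T y) * ?T y x) = 0" for x
      using arg_cong[OF c, of "\<lambda>h. h x"] injT by (simp add: sum_fun s_def sum.reindex)
    from zero[of "\<lambda>y. c (?T y)", OF this y(1)] show "c w = 0"
      using y by simp
  qed
  have in_t: "h \<in> span t" if "h \<in> fvec V" for h
  proof -
    have "h = (\<Sum>y\<in>V. (\<lambda>x. h y * unit_vec y x))"
    proof
      fix x show "h x = (\<Sum>y\<in>V. (\<lambda>x. h y * unit_vec y x)) x"
      proof (cases "x \<in> V")
        case True
        then show ?thesis
          using unit_vec_sum[OF fin True, of h] by (simp add: sum_fun)
      next
        case False
        then show ?thesis
          using that by (auto simp: sum_fun fvec_def unit_vec_def intro!: sum.neutral)
      qed
    qed
    also have "\<dots> \<in> span t"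
      by (intro span_sum span_scale) (auto simp: t_def intro: span_base)
    finally show ?thesis .
  qed
  have "card t \<le> card V"
    using fin by (simp add: t_def card_image_le)
  moreover have "card s = card V"
    using injT by (simp add: s_def card_image)
  ultimately have card_ts: "card t \<le> card s" by simp
  have "g \<in> span s"
  proof (rule ccontr)
    assume g': "g \<notin> span s"
    have "independent (insert g s)"
      by (rule independent_insertI[OF g' ind])
    moreover have "insert g s \<subseteq> span t"
      using in_t g by (auto simp: s_def)
    ultimately have "card (insert g s) \<le> card t"
      using independent_span_bound[of t "insert g s"] fin by (auto simp: t_def)
    moreover have "g \<notin> s"
      using g' span_base by blast
    ultimately show False
      using card_ts fin by (simp add: s_def)
  qed
  then obtain c where "g = (\<Sum>w\<in>s. (\<lambda>x. c w * w x))"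
    using fin span_finite[of s] by (auto simp: s_def)
  then have "g x = (\<Sum>y\<in>V. c (?T y) * ?T y x)" for x
    using injT by (simp add: sum_fun s_def sum.reindex)
  then have "matop V M (\<lambda>x. \<Sum>y\<in>V. c (?T y) * unit_vec y x) = g"
    by (simp add: fun_eq_iff comb)
  moreover have "(\<lambda>x. \<Sum>y\<in>V. c (?T y) * unit_vec y x) \<in> fvec V"
    by (auto simp: fvec_def unit_vec_def intro!: sum.neutral)
  ultimately show ?thesis by blast
qed

text \<open>The columns of \<open>N\<close> are preimages of the unit vectors. This right inverse is
  also a left inverse, because \<open>M\<close> annihilates \<open>N M f - f\<close> and is
  injective.\<close>

lemma matop_inverse:
  assumes fin: "finite V"
    and inj: "\<And>f. f \<in> fvec V \<Longrightarrow> (\<And>x. x \<in> V \<Longrightarrow> matop V M f x = 0) \<Longrightarrow> \<forall>x. f x = 0"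
  obtains N where "\<And>f. f \<in> fvec V \<Longrightarrow> matop V M (matop V N f) = f"
    "\<And>f. f \<in> fvec V \<Longrightarrow> matop V N (matop V M f) = f"
proof -
  have "\<exists>h\<in>fvec V. matop V M h = unit_vec y" if "y \<in> V" for y
    by (rule matop_surj[OF fin inj]) (use that in auto)
  then obtain h where h: "\<And>y. y \<in> V \<Longrightarrow> h y \<in> fvec V \<and> matop V M (h y) = unit_vec y"
    by metis
  define N where "N x y = h y x" for x y
  have right: "matop V M (matop V N f) = f" if f: "f \<in> fvec V" for f
  proof
    fix x
    have "matop V M (matop V N f) x = matop V M (\<lambda>x. \<Sum>y\<in>V. f y * h y x) x"
      by (rule fun_cong[OF matop_cong]) (simp add: matop_def N_def mult_ac)
    also have "\<dots> = (\<Sum>y\<in>V. f y * unit_vec y x)"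
      unfolding matop_sum using h by simp
    also have "\<dots> = f x"
      using f unit_vec_sum[OF fin, of x f]
      by (cases "x \<in> V") (auto simp: fvec_def unit_vec_def intro!: sum.neutral)
    finally show "matop V M (matop V N f) x = f x" .
  qed
  show thesis
  proof
    fix f assume f: "f \<in> fvec V"
    show "matop V M (matop V N f) = f" by (rule right[OF f])
    have "\<forall>x. matop V N (matop V M f) x - f x = 0"
    proof (rule inj)
      show "(\<lambda>x. matop V N (matop V M f) x - f x) \<in> fvec V"
        using f by (simp add: fvec_def matop_def)
      show "matop V M (\<lambda>x. matop V N (matop V M f) x - f x) x = 0" for x
        by (simp add: matop_diff right)
    qed
    then show "matop V N (matop V M f) = f" by (simp add: fun_eq_iff)
  qed
qed

section \<open>Exponentials\<close>

text \<open>Unlike in \<open>matop_bound\<close>, the point \<open>x\<close> is restricted to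
  \<open>V\<close>: for exponent 0 the function \<open>f\<close> itself appears, which is
  uncontrolled elsewhere.\<close>

lemma matop_power_bound:
  assumes "finite V"
  obtains K where "K > 0"
    "\<And>f C n x. (\<And>y. y \<in> V \<Longrightarrow> norm (f y) \<le> C) \<Longrightarrow> C \<ge> 0 \<Longrightarrow> x \<in> V \<Longrightarrow>
       norm ((matop V M ^^ n) f x) \<le> K ^ n * C"
proof -
  obtain K where K: "K > 0"
    "\<And>f C x. (\<And>y. y \<in> V \<Longrightarrow> norm (f y) \<le> C) \<Longrightarrow> C \<ge> 0 \<Longrightarrow> norm (matop V M f x) \<le> K * C"
    using matop_bound[OF assms] by metis
  have "norm ((matop V M ^^ n) f x) \<le> K ^ n * C"
    if "\<And>y. y \<in> V \<Longrightarrow> norm (f y) \<le> C" "C \<ge> 0" "x \<in> V" for f C n x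
    using that(3)
  proof (induction n arbitrary: x)
    case (Suc n)
    have "norm (matop V M ((matop V M ^^ n) f) x) \<le> K * (K ^ n * C)"
      by (rule K(2)) (use Suc K(1) that in auto)
    then show ?case by (simp add: mult_ac)
  qed (use that in auto)
  with K(1) show thesis using that by blast
qed

lemma finite_imp_bound:
  fixes f :: "'a \<Rightarrow> complex"
  assumes "finite V"
  obtains C where "C \<ge> 0" "\<And>y. y \<in> V \<Longrightarrow> norm (f y) \<le> C"
proof
  show "(\<Sum>y\<in>V. norm (f y)) \<ge> 0" by (simp add: sum_nonneg)
  show "norm (f y) \<le> (\<Sum>y\<in>V. norm (f y))" if "y \<in> V" for y
    using assms that by (intro member_le_sum) auto
qed

lemma matop_power_series_summable:
  assumes "finite V" "x \<in> V"
  shows "summable (\<lambda>n. (matop V M ^^ n) f x / fact n * z ^ n)"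
proof -
  obtain K where K: "K > 0"
    "\<And>f C n x. (\<And>y. y \<in> V \<Longrightarrow> norm (f y) \<le> C) \<Longrightarrow> C \<ge> 0 \<Longrightarrow> x \<in> V \<Longrightarrow>
       norm ((matop V M ^^ n) f x) \<le> K ^ n * C"
    using matop_power_bound[OF assms(1)] by metis
  obtain C where C: "C \<ge> 0" "\<And>y. y \<in> V \<Longrightarrow> norm (f y) \<le> C"
    using finite_imp_bound[OF assms(1)] by metis
  show ?thesis
  proof (rule summable_comparison_test')
    show "summable (\<lambda>n. C * (inverse (fact n) * (K * norm z) ^ n))"
      by (intro summable_mult summable_exp)
    show "norm ((matop V M ^^ n) f x / fact n * z ^ n) \<le> C * (inverse (fact n) * (K * norm z) ^ n)" for n
    proof -
      have "norm ((matop V M ^^ n) f x) * (norm z ^ n / fact n) \<le> K ^ n * C * (norm z ^ n / fact n)"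
        using K(2)[OF C(2) C(1) assms(2), where n = n] by (intro mult_right_mono) auto
      then show ?thesis
        by (simp add: norm_mult norm_divide norm_power field_simps)
    qed
  qed
qed

lemma op_exp_altdef: "op_exp s T f x = (\<Sum>n. (T ^^ n) f x / fact n * of_real s ^ n)"
  unfolding op_exp_def by (simp add: field_simps)

lemma op_exp_sums:
  assumes "finite V" "x \<in> V"
  shows "(\<lambda>n. (matop V M ^^ n) f x / fact n * of_real s ^ n) sums op_exp s (matop V M) f x"
  unfolding op_exp_altdef using matop_power_series_summable[OF assms] by (rule summable_sums)

lemma op_exp_0 [simp]: "op_exp 0 T f x = f x"
  unfolding op_exp_altdef using powser_zero[of "\<lambda>n. (T ^^ n) f x / fact n"] by simp

lemma op_exp_has_vector_derivative:
  assumes "finite V" "x \<in> V"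
  shows "((\<lambda>s. op_exp s (matop V M) f x) has_vector_derivative
           op_exp s (matop V M) (matop V M f) x) (at s within S)"
proof -
  let ?T = "matop V M"
  define c where "c n = (?T ^^ n) f x / fact n" for n
  \<comment> \<open>Formal differentiation shifts the coefficients by one, and the surplus
    application of the operator is moved onto \<open>f\<close>.\<close>
  have diffs: "diffs c = (\<lambda>n. (?T ^^ n) (?T f) x / fact n)"
  proof
    fix n show "diffs c n = (?T ^^ n) (?T f) x / fact n"
      by (simp add: diffs_def c_def funpow_swap1 del: of_nat_Suc)
  qed
  have "((\<lambda>z. \<Sum>n. c n * z ^ n) has_field_derivative (\<Sum>n. diffs c n * of_real s ^ n)) (at (of_real s))"
    by (rule termdiffs_strong_converges_everywhere)
       (use matop_power_series_summable[OF assms] in \<open>auto simp: c_def\<close>)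
  then have "((\<lambda>s. \<Sum>n. c n * of_real s ^ n) has_vector_derivative
               (\<Sum>n. diffs c n * of_real s ^ n)) (at s within S)"
    using has_vector_derivative_real_field has_vector_derivative_at_within by blast
  then show ?thesis
    unfolding op_exp_altdef diffs by (simp add: c_def)
qed

lemma matop_power_cong:
  assumes "\<And>y. y \<in> V \<Longrightarrow> f y = g y" "x \<in> V"
  shows "(matop V M ^^ n) f x = (matop V M ^^ n) g x"
proof (cases n)
  case (Suc m)
  then show ?thesis
    using matop_cong[of V f g M] assms by (simp add: funpow_swap1)
qed (use assms in auto)

lemma op_exp_cong:
  assumes "\<And>y. y \<in> V \<Longrightarrow> f y = g y" "x \<in> V"
  shows "op_exp s (matop V M) f x = op_exp s (matop V M) g x"
  unfolding op_exp_def using matop_power_cong[of V f g, OF assms] by simp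

lemma matop_power_sum:
  "(matop V M ^^ n) (\<lambda>x. \<Sum>i\<in>I. c i * f i x) x = (\<Sum>i\<in>I. c i * (matop V M ^^ n) (f i) x)"
proof (induction n arbitrary: x)
  case (Suc n)
  have "(matop V M ^^ n) (\<lambda>x. \<Sum>i\<in>I. c i * f i x) = (\<lambda>x. \<Sum>i\<in>I. c i * (matop V M ^^ n) (f i) x)"
    using Suc by (simp add: fun_eq_iff)
  then show ?case by (simp add: matop_sum)
qed auto

lemma op_exp_sum:
  assumes "finite V" "x \<in> V"
  shows "op_exp s (matop V M) (\<lambda>x. \<Sum>i\<in>I. c i * f i x) x = (\<Sum>i\<in>I. c i * op_exp s (matop V M) (f i) x)"
proof -
  have "(\<lambda>n. \<Sum>i\<in>I. c i * ((matop V M ^^ n) (f i) x / fact n * of_real s ^ n)) sums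
          (\<Sum>i\<in>I. c i * op_exp s (matop V M) (f i) x)"
    by (intro sums_sum sums_mult op_exp_sums assms)
  then have "(\<lambda>n. (matop V M ^^ n) (\<lambda>x. \<Sum>i\<in>I. c i * f i x) x / fact n * of_real s ^ n) sums
          (\<Sum>i\<in>I. c i * op_exp s (matop V M) (f i) x)"
    by (simp add: matop_power_sum sum_divide_distrib sum_distrib_left mult_ac)
  then show ?thesis
    using op_exp_sums[OF assms] sums_unique2 by blast
qed

lemma op_exp_diff:
  assumes "finite V" "x \<in> V"
  shows "op_exp s (matop V M) (\<lambda>x. f x - g x) x =
           op_exp s (matop V M) f x - op_exp s (matop V M) g x"
  \<comment> \<open>Linearity in two terms is the finite sum lemma with the type \<open>bool\<close>
    as index set.\<close>
  using op_exp_sum[OF assms, of s M "\<lambda>b. if b then 1 else -1" "\<lambda>b. if b then f else g" UNIV]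
  by (simp add: UNIV_bool)

lemma op_exp_add:
  assumes "finite V" "x \<in> V"
  shows "op_exp s (matop V M) (\<lambda>x. f x + g x) x =
           op_exp s (matop V M) f x + op_exp s (matop V M) g x"
  using op_exp_sum[OF assms, of s M "\<lambda>b. 1" "\<lambda>b. if b then f else g" UNIV]
  by (simp add: UNIV_bool add_ac)

lemma op_exp_cmult:
  assumes "finite V" "x \<in> V"
  shows "op_exp s (matop V M) (\<lambda>x. c * f x) x = c * op_exp s (matop V M) f x"
  using op_exp_sum[OF assms, of s M "\<lambda>b. c" "\<lambda>b. f" "{()}"] by simp

lemma op_exp_expand:
  assumes "finite V" "x \<in> V"
  shows "op_exp s (matop V M) f x = (\<Sum>y\<in>V. f y * op_exp s (matop V M) (unit_vec y) x)"
proof -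
  have "op_exp s (matop V M) f x = op_exp s (matop V M) (\<lambda>x. \<Sum>y\<in>V. f y * unit_vec y x) x"
    by (rule op_exp_cong) (use assms in \<open>simp_all add: unit_vec_sum\<close>)
  then show ?thesis using op_exp_sum[OF assms] by simp
qed

lemma matop_op_exp:
  assumes "finite V" "x \<in> V"
  shows "matop V M (op_exp s (matop V M) f) x = op_exp s (matop V M) (matop V M f) x"
proof -
  have "(\<lambda>n. \<Sum>y\<in>V. M x y * ((matop V M ^^ n) f y / fact n * of_real s ^ n)) sums
          (\<Sum>y\<in>V. M x y * op_exp s (matop V M) f y)"
    by (intro sums_sum sums_mult op_exp_sums assms)
  moreover have "(\<Sum>y\<in>V. M x y * ((matop V M ^^ n) f y / fact n * of_real s ^ n)) =
     (matop V M ^^ n) (matop V M f) x / fact n * of_real s ^ n" for n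
  proof -
    have "(matop V M ^^ n) (matop V M f) x = matop V M ((matop V M ^^ n) f) x"
      by (simp add: funpow_swap1)
    then show ?thesis
      using assms by (simp add: matop_def sum_divide_distrib sum_distrib_left mult_ac)
  qed
  ultimately have "(\<Sum>y\<in>V. M x y * op_exp s (matop V M) f y) = op_exp s (matop V M) (matop V M f) x"
    using op_exp_sums[OF assms, of M "matop V M f" s] by (simp add: sums_iff)
  then show ?thesis
    using assms by (simp add: matop_def)
qed

lemma op_exp_bounded_on_interval:
  assumes "finite V" "x \<in> V"
  obtains C where "C \<ge> 0" "\<And>s. s \<in> {0..t} \<Longrightarrow> norm (op_exp (- s) (matop V M) f x) \<le> C"
proof -
  have "continuous_on {- t..0} (\<lambda>s. op_exp s (matop V M) f x)"
    unfolding continuous_on_eq_continuous_within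
    by (blast intro: has_vector_derivative_continuous op_exp_has_vector_derivative[OF assms])
  then have "bounded ((\<lambda>s. op_exp s (matop V M) f x) ` {- t..0})"
    by (intro compact_imp_bounded compact_continuous_image) auto
  then obtain C where C: "C > 0" "\<forall>z\<in>(\<lambda>s. op_exp s (matop V M) f x) ` {- t..0}. norm z \<le> C"
    by (auto simp: bounded_pos)
  show thesis
    by (rule that[of C]) (use C in auto)
qed

text \<open>A mean value inequality; it takes the place of the integral in Duhamel's
  formula.\<close>

lemma vector_derivative_bound:
  fixes \<phi> :: "real \<Rightarrow> 'b::real_normed_vector"
  assumes "0 \<le> t" and "\<And>s. s \<in> {0..t} \<Longrightarrow> (\<phi> has_vector_derivative \<phi>' s) (at s)"
    and "\<And>s. s \<in> {0..t} \<Longrightarrow> norm (\<phi>' s) \<le> K"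
  shows "norm (\<phi> t - \<phi> 0) \<le> K * t"
proof -
  have "norm (\<phi> t - \<phi> 0) \<le> K * norm (t - 0)"
  proof (rule differentiable_bound[of "{0..t}" \<phi> "\<lambda>s h. h *\<^sub>R \<phi>' s"])
    show "(\<phi> has_derivative (\<lambda>h. h *\<^sub>R \<phi>' s)) (at s within {0..t})" if "s \<in> {0..t}" for s
      using assms(2)[OF that] by (simp add: has_vector_derivative_def has_derivative_at_withinI)
    show "onorm (\<lambda>h. h *\<^sub>R \<phi>' s) \<le> K" if "s \<in> {0..t}" for s
    proof (rule onorm_le)
      fix h :: real
      show "norm (h *\<^sub>R \<phi>' s) \<le> K * norm h"
        using mult_right_mono[OF assms(3)[OF that], of "norm h"] by (simp add: mult.commute)
    qed
  qed (use assms(1) in auto)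
  then show ?thesis using assms(1) by simp
qed

text \<open>The derivative is the propagated residual of \<open>k\<close> in the equation
  \<open>k' = - M k\<close>. The curve runs from the evolution of \<open>k 0\<close> at
  \<open>s = 0\<close> to \<open>k t\<close> at \<open>s = t\<close>. Expanding in unit vectors
  reduces the claim to the product rule for scalar curves.\<close>

lemma op_exp_duhamel:
  assumes "finite V" "x \<in> V"
    and "\<And>y. y \<in> V \<Longrightarrow> ((\<lambda>s. k s y) has_vector_derivative k' y) (at s)"
  shows "((\<lambda>s. op_exp (s - t) (matop V M) (k s) x) has_vector_derivative
           op_exp (s - t) (matop V M) (\<lambda>y. matop V M (k s) y + k' y) x) (at s)"
proof -
  let ?T = "matop V M"
  let ?e = "\<lambda>s y. op_exp (s - t) ?T (unit_vec y) x"
  have shift: "((\<lambda>s. ?e s y) has_vector_derivative op_exp (s - t) ?T (?T (unit_vec y)) x) (at s)" for y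
  proof -
    have "((\<lambda>s. s - t) has_vector_derivative 1) (at s)"
      by (auto intro!: derivative_eq_intros)
    from vector_diff_chain_at[OF this op_exp_has_vector_derivative[OF assms(1,2)]]
    show ?thesis by (simp add: o_def)
  qed
  have "((\<lambda>s. \<Sum>y\<in>V. k s y * ?e s y) has_vector_derivative
          (\<Sum>y\<in>V. k s y * op_exp (s - t) ?T (?T (unit_vec y)) x + k' y * ?e s y)) (at s)"
    by (intro has_vector_derivative_sum has_vector_derivative_mult shift assms)
  moreover have "(\<Sum>y\<in>V. k s y * op_exp (s - t) ?T (?T (unit_vec y)) x + k' y * ?e s y) =
      op_exp (s - t) ?T (\<lambda>y. ?T (k s) y + k' y) x"
  proof -
    have "op_exp (s - t) ?T (?T (k s)) x = op_exp (s - t) ?T (\<lambda>z. \<Sum>y\<in>V. k s y * ?T (unit_vec y) z) x"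
      using assms by (intro op_exp_cong) (auto simp: matop_unit_vec, simp add: matop_def mult_ac)
    then show ?thesis
      unfolding op_exp_add[OF assms(1,2)] op_exp_expand[OF assms(1,2), of _ _ k']
      by (simp add: op_exp_sum[OF assms(1,2)] sum.distrib)
  qed
  ultimately show ?thesis
    using op_exp_expand[OF assms(1,2), of _ M "k _"] by simp
qed

section \<open>Semigroups of Markov type\<close>

definition sup_bounded :: "'a set \<Rightarrow> ('a \<Rightarrow> complex) \<Rightarrow> real \<Rightarrow> bool" where
  "sup_bounded V f C \<longleftrightarrow> C \<ge> 0 \<and> (\<forall>y\<in>V. norm (f y) \<le> C)"

text \<open>An index shift lowers the power of \<open>n\<close> by one, since
  \<open>n r^n / n!\<close> is \<open>r\<close> times the preceding weight and vanishes at
  \<open>n = 0\<close>. The second moment is thus obtained from the two lower ones.\<close>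

lemma poisson_moment_sums:
  fixes r :: real
  shows "(\<lambda>n. r ^ n / fact n) sums exp r"
    and "(\<lambda>n. r ^ n / fact n * real n) sums (r * exp r)"
    and "(\<lambda>n. r ^ n / fact n * (real n)\<^sup>2) sums ((r\<^sup>2 + r) * exp r)"
proof -
  show 0: "(\<lambda>n. r ^ n / fact n) sums exp r"
    using exp_converges[of r] by (simp add: field_simps scaleR_conv_of_real)
  have 1: "r ^ Suc n / fact (Suc n) * real (Suc n) = r * (r ^ n / fact n)" for n
    by (simp add: field_simps del: of_nat_Suc)
  show m1: "(\<lambda>n. r ^ n / fact n * real n) sums (r * exp r)"
    using sums_mult[OF 0, of r] sums_Suc_iff[of "\<lambda>n. r ^ n / fact n * real n" "r * exp r"]
    by (simp only: 1) simp
  have 2: "r ^ Suc n / fact (Suc n) * (real (Suc n))\<^sup>2 = r * (r ^ n / fact n * real n) + r * (r ^ n / fact n)" for n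
  proof -
    have "r ^ Suc n / fact (Suc n) * (real (Suc n))\<^sup>2 = (r ^ Suc n / fact (Suc n) * real (Suc n)) * real (Suc n)"
      by (simp only: power2_eq_square mult.assoc)
    also have "\<dots> = r * (r ^ n / fact n) * (real n + 1)"
      by (simp only: 1) (simp only: of_nat_Suc add.commute)
    finally show ?thesis by (simp only: distrib_left mult.assoc mult_1_right)
  qed
  show "(\<lambda>n. r ^ n / fact n * (real n)\<^sup>2) sums ((r\<^sup>2 + r) * exp r)"
    using sums_add[OF sums_mult[OF m1, of r] sums_mult[OF 0, of r]]
      sums_Suc_iff[of "\<lambda>n. r ^ n / fact n * (real n)\<^sup>2" "(r\<^sup>2 + r) * exp r"]
    by (simp only: 2) (simp add: power2_eq_square algebra_simps)
qed

text \<open>The variance of the Poisson distribution with parameter \<open>r\<close>, scaled by \<open>1 / r\<^sup>2\<close>.\<close>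

lemma poisson_variance_sums:
  fixes r :: real
  assumes "r > 0"
  shows "(\<lambda>n. r ^ n / fact n * (1 - real n / r)\<^sup>2) sums (exp r / r)"
proof -
  have "(\<lambda>n. r ^ n / fact n + (-2 / r) * (r ^ n / fact n * real n) + (1 / r\<^sup>2) * (r ^ n / fact n * (real n)\<^sup>2))
          sums (exp r + (-2 / r) * (r * exp r) + (1 / r\<^sup>2) * ((r\<^sup>2 + r) * exp r))"
    by (intro sums_add sums_mult poisson_moment_sums)
  moreover have "exp r + (-2 / r) * (r * exp r) + (1 / r\<^sup>2) * ((r\<^sup>2 + r) * exp r) = exp r / r"
    using assms by (simp add: field_simps power2_eq_square)
  moreover have "r ^ n / fact n + (-2 / r) * (r ^ n / fact n * real n) + (1 / r\<^sup>2) * (r ^ n / fact n * (real n)\<^sup>2)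
     = r ^ n / fact n * (1 - real n / r)\<^sup>2" for n
  proof -
    have "p + (-2 / r) * (p * m) + (1 / r\<^sup>2) * (p * m\<^sup>2) = p * (1 - m / r)\<^sup>2" for p m :: real
      using assms by (simp add: field_simps power2_eq_square)
    then show ?thesis by blast
  qed
  ultimately show ?thesis by simp
qed

text \<open>The assumption \<open>contract\<close> says that \<open>Q = 1 - M / c\<close> does not
  increase the maximum norm. For a Laplacian with all jump rates at most \<open>c\<close>,
  \<open>Q\<close> is the stochastic matrix of the uniformized chain.\<close>

locale markov_op =
  fixes V :: "'a set" and M :: "'a \<Rightarrow> 'a \<Rightarrow> complex" and c :: real
  assumes finV: "finite V" and c_pos: "c > 0"
    and contract: "\<And>f C x. sup_bounded V f C \<Longrightarrow> x \<in> V \<Longrightarrow>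
      norm (of_real c * f x - matop V M f x) \<le> c * C"
begin

definition Q where "Q x y = unit_vec x y - M x y / of_real c"

lemma Q_apply:
  assumes "x \<in> V" shows "matop V Q f x = f x - matop V M f x / of_real c"
proof -
  have "(\<Sum>y\<in>V. unit_vec x y * f y) = f x"
    using unit_vec_sum[OF finV assms, of f] by (simp add: mult.commute unit_vec_commute)
  then show ?thesis
    using assms by (simp add: matop_def Q_def algebra_simps sum_subtractf sum_divide_distrib)
qed

lemma Q_power_bound:
  assumes "sup_bounded V f C" "x \<in> V"
  shows "norm ((matop V Q ^^ n) f x) \<le> C"
  using assms(2)
proof (induction n arbitrary: x)
  case 0
  then show ?case using assms by (simp add: sup_bounded_def)
next
  case (Suc n)
  let ?g = "(matop V Q ^^ n) f"
  have "sup_bounded V ?g C"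
    using Suc.IH assms(1) by (auto simp: sup_bounded_def)
  then have *: "norm (of_real c * ?g x - matop V M ?g x) \<le> c * C"
    using Suc.prems by (rule contract)
  have "matop V Q ?g x = (of_real c * ?g x - matop V M ?g x) / of_real c"
    using Suc.prems c_pos by (simp add: Q_apply field_simps)
  then have "norm (matop V Q ?g x) = norm (of_real c * ?g x - matop V M ?g x) / c"
    using c_pos by (simp add: norm_divide)
  also have "\<dots> \<le> C"
    using * c_pos by (simp add: field_simps)
  finally show ?case by simp
qed

text \<open>Uniqueness for a linear differential equation proves this: as
  \<open>M = c (1 - Q)\<close>, the right-hand side \<open>k\<close> solves
  \<open>k' = - M k\<close>, so the Duhamel curve is constant, and its values at
  \<open>s = 0\<close> and \<open>s = t\<close> are the two sides.\<close>

lemma op_exp_eq_poisson: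
  assumes "x \<in> V"
  shows "op_exp (- t) (matop V M) f x = exp (- (c * t)) * op_exp (c * t) (matop V Q) f x"
proof -
  define k where "k s y = of_real (exp (- (c * s))) * op_exp (c * s) (matop V Q) f y" for s y
  have k': "((\<lambda>s. k s y) has_vector_derivative - matop V M (k s) y) (at s)" if y: "y \<in> V" for s y
  proof -
    have 1: "((\<lambda>s. op_exp (c * s) (matop V Q) f y) has_vector_derivative
               c *\<^sub>R op_exp (c * s) (matop V Q) (matop V Q f) y) (at s)"
    proof -
      have "((\<lambda>s. c * s) has_vector_derivative c) (at s)"
        by (auto intro!: derivative_eq_intros)
      from vector_diff_chain_at[OF this op_exp_has_vector_derivative[OF finV y]]
      show ?thesis by (simp add: o_def)
    qed
    have 2: "((\<lambda>s. complex_of_real (exp (- (c * s)))) has_vector_derivative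
               of_real (- c * exp (- (c * s)))) (at s)"
      unfolding has_real_derivative_iff_has_vector_derivative[symmetric]
      by (intro has_vector_derivative_of_real[unfolded has_real_derivative_iff_has_vector_derivative[symmetric]])
         (auto intro!: derivative_eq_intros)
    have 3: "((\<lambda>s. k s y) has_vector_derivative
            of_real (exp (- (c * s))) * (c *\<^sub>R op_exp (c * s) (matop V Q) (matop V Q f) y) +
            of_real (- c * exp (- (c * s))) * op_exp (c * s) (matop V Q) f y) (at s)"
      unfolding k_def by (rule has_vector_derivative_mult[OF 2 1])
    have "matop V M (k s) y = of_real (exp (- (c * s))) * matop V M (op_exp (c * s) (matop V Q) f) y"
      unfolding k_def by (rule matop_cmult)
    also have "matop V M (op_exp (c * s) (matop V Q) f) y =
        of_real c * (op_exp (c * s) (matop V Q) f y - matop V Q (op_exp (c * s) (matop V Q) f) y)"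
      using Q_apply[OF y] c_pos by simp
    also have "matop V Q (op_exp (c * s) (matop V Q) f) y = op_exp (c * s) (matop V Q) (matop V Q f) y"
      by (rule matop_op_exp[OF finV y])
    finally have "- matop V M (k s) y =
            of_real (exp (- (c * s))) * (c *\<^sub>R op_exp (c * s) (matop V Q) (matop V Q f) y) +
            of_real (- c * exp (- (c * s))) * op_exp (c * s) (matop V Q) f y"
      by (simp add: scaleR_conv_of_real algebra_simps)
    then show ?thesis
      using 3 by simp
  qed
  have "((\<lambda>s. op_exp (s - t) (matop V M) (k s) x) has_vector_derivative 0) (at s)" for s
  proof -
    have "op_exp (s - t) (matop V M) (\<lambda>y. matop V M (k s) y + - matop V M (k s) y) x = 0"
      by (simp add: op_exp_expand[OF finV assms, of _ _ "\<lambda>x. 0"])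
    moreover have "((\<lambda>s. op_exp (s - t) (matop V M) (k s) x) has_vector_derivative
        op_exp (s - t) (matop V M) (\<lambda>y. matop V M (k s) y + - matop V M (k s) y) x) (at s)"
      by (rule op_exp_duhamel[OF finV assms k'])
    ultimately show ?thesis by (simp only:)
  qed
  then obtain z where "\<And>s. op_exp (s - t) (matop V M) (k s) x = z"
    using has_vector_derivative_zero_constant[of UNIV "\<lambda>s. op_exp (s - t) (matop V M) (k s) x"] by auto
  from this[of 0] this[of t] have "op_exp (- t) (matop V M) (k 0) x = k t x"
    by simp
  moreover have "k 0 = f"
    by (simp add: k_def fun_eq_iff)
  ultimately show ?thesis
    by (simp add: k_def)
qed

lemma op_exp_contraction:
  assumes "sup_bounded V f C" "x \<in> V" "t \<ge> 0"
  shows "norm (op_exp (- t) (matop V M) f x) \<le> C"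
proof -
  let ?r = "c * t"
  have r: "?r \<ge> 0" using c_pos assms by simp
  have s: "(\<lambda>n. (matop V Q ^^ n) f x / fact n * of_real ?r ^ n) sums op_exp ?r (matop V Q) f x"
    by (rule op_exp_sums[OF finV assms(2)])
  have "norm (op_exp ?r (matop V Q) f x) \<le> (\<Sum>n. ?r ^ n / fact n * C)"
  proof -
    have "norm ((matop V Q ^^ n) f x / fact n * of_real ?r ^ n) \<le> ?r ^ n / fact n * C" for n
    proof -
      have "norm ((matop V Q ^^ n) f x / fact n * of_real ?r ^ n) = ?r ^ n / fact n * norm ((matop V Q ^^ n) f x)"
        using c_pos assms(3) by (simp add: norm_mult norm_divide norm_power)
      also have "\<dots> \<le> ?r ^ n / fact n * C"
        using r by (intro mult_left_mono Q_power_bound[OF assms(1,2)]) auto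
      finally show ?thesis .
    qed
    then have "norm (\<Sum>n. (matop V Q ^^ n) f x / fact n * of_real ?r ^ n) \<le> (\<Sum>n. ?r ^ n / fact n * C)"
      by (intro norm_suminf_le sums_summable[OF sums_mult2[OF poisson_moment_sums(1)]])
    then show ?thesis using s by (simp add: sums_iff)
  qed
  also have "\<dots> = exp ?r * C"
    using sums_mult2[OF poisson_moment_sums(1)] by (simp add: sums_iff)
  finally have "norm (op_exp ?r (matop V Q) f x) \<le> exp ?r * C" .
  then have "exp (- ?r) * norm (op_exp ?r (matop V Q) f x) \<le> exp (- ?r) * (exp ?r * C)"
    by (intro mult_left_mono) auto
  then show ?thesis
    by (simp add: op_exp_eq_poisson[OF assms(2)] norm_mult mult.assoc[symmetric] flip: exp_add)
qed

text \<open>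
  Abel summation turns \<open>exp (- t T) T f\<close> into an average of \<open>Q\<^sup>n f\<close> against the differences of
  consecutive Poisson weights, whose total variation is controlled by the variance.
\<close>

lemma op_exp_smoothing:
  assumes "sup_bounded V f C" "x \<in> V" "t > 0"
  shows "norm (op_exp (- t) (matop V M) (matop V M f) x) \<le> C * sqrt (c / t)"
proof -
  define r where "r = c * t"
  have r: "r > 0" using c_pos assms by (simp add: r_def)
  let ?q = "\<lambda>n. (matop V Q ^^ n) f x"
  have s0: "(\<lambda>n. ?q n / fact n * of_real r ^ n) sums op_exp r (matop V Q) f x"
    by (rule op_exp_sums[OF finV assms(2)])
  have "(\<lambda>n. (matop V Q ^^ n) (matop V Q f) x / fact n * of_real r ^ n) sums
          op_exp r (matop V Q) (matop V Q f) x"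
    by (rule op_exp_sums[OF finV assms(2)])
  \<comment> \<open>Index shift: the power \<open>n + 1\<close> of \<open>Q\<close> occurs with the
    Poisson weight of \<open>n + 1\<close> times \<open>(n + 1) / r\<close>. The term then added at
    index 0 carries the factor 0.\<close>
  moreover have "(matop V Q ^^ n) (matop V Q f) x / fact n * of_real r ^ n =
     ?q (Suc n) / fact (Suc n) * of_real r ^ Suc n * of_real (real (Suc n) / r)" for n
  proof -
    have "?q (Suc n) = (matop V Q ^^ n) (matop V Q f) x"
      by (simp add: funpow_swap1)
    moreover have "complex_of_real r \<noteq> 0" using r by simp
    ultimately show ?thesis by (simp add: field_simps del: of_nat_Suc funpow.simps)
  qed
  ultimately have s1: "(\<lambda>n. ?q n / fact n * of_real r ^ n * of_real (real n / r)) sums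
        op_exp r (matop V Q) (matop V Q f) x"
    using sums_Suc_iff[of "\<lambda>n. ?q n / fact n * of_real r ^ n * of_real (real n / r)"] by simp
  have Mf: "op_exp (- t) (matop V M) (matop V M f) x =
     of_real (c * exp (- r)) * (op_exp r (matop V Q) f x - op_exp r (matop V Q) (matop V Q f) x)"
  proof -
    have "op_exp r (matop V Q) (matop V M f) x =
        op_exp r (matop V Q) (\<lambda>x. of_real c * (f x - matop V Q f x)) x"
      by (rule op_exp_cong) (use assms c_pos in \<open>simp_all add: Q_apply\<close>)
    then show ?thesis
      by (simp add: op_exp_eq_poisson[OF assms(2)] op_exp_cmult[OF finV assms(2)]
          op_exp_diff[OF finV assms(2)] r_def)
  qed
  have C: "C \<ge> 0" using assms by (simp add: sup_bounded_def)
  \<comment> \<open>A majorant for \<open>C\<close> times the Poisson weight times the absolute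
    value of \<open>1 - n / r\<close>. The inequality of arithmetic and geometric means trades the
    absolute value for the square; as the variance is \<open>1 / r\<close>, the scale
    \<open>sqrt r\<close> balances the two halves.\<close>
  define w where "w n = C / 2 * (r ^ n / fact n / sqrt r + sqrt r * (r ^ n / fact n * (1 - real n / r)\<^sup>2))" for n
  have ws: "w sums (C / 2 * (exp r / sqrt r + sqrt r * (exp r / r)))"
    unfolding w_def by (intro sums_mult sums_add sums_divide poisson_moment_sums poisson_variance_sums r)
  have "C / 2 * (exp r / sqrt r + sqrt r * (exp r / r)) = C * exp r / sqrt r"
    using r by (simp add: field_simps flip: real_sqrt_mult)
  with ws have ws: "w sums (C * exp r / sqrt r)" by simp
  have "(\<lambda>n. ?q n / fact n * of_real r ^ n * of_real (1 - real n / r)) sums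
        (op_exp r (matop V Q) f x - op_exp r (matop V Q) (matop V Q f) x)"
    using sums_diff[OF s0 s1] by (simp only: right_diff_distrib of_real_diff of_real_1 mult_1_right)
  moreover have "norm (?q n / fact n * of_real r ^ n * of_real (1 - real n / r)) \<le> w n" for n
  proof -
    define p where "p = r ^ n / fact n"
    define z where "z = 1 - real n / r"
    have p: "p \<ge> 0" using r by (simp add: p_def)
    have "norm (?q n / fact n * of_real r ^ n * of_real z) = norm (?q n) * (p * \<bar>z\<bar>)"
      using r by (simp add: norm_mult norm_divide norm_power p_def)
    also have "\<dots> \<le> C * (p * \<bar>z\<bar>)"
      using Q_power_bound[OF assms(1,2)] p by (intro mult_right_mono) auto
    also have "\<bar>z\<bar> \<le> (1 / sqrt r + sqrt r * z\<^sup>2) / 2"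
    proof -
      have "0 \<le> (1 - sqrt r * \<bar>z\<bar>)\<^sup>2 / sqrt r" using r by simp
      also have "\<dots> = 1 / sqrt r - 2 * \<bar>z\<bar> + sqrt r * z\<^sup>2"
      proof -
        define u where "u = sqrt r"
        have "u > 0" using r by (simp add: u_def)
        then have "(1 - u * \<bar>z\<bar>)\<^sup>2 / u = 1 / u - 2 * \<bar>z\<bar> + u * \<bar>z\<bar>\<^sup>2"
          by (simp add: field_simps power2_eq_square)
        then show ?thesis by (simp add: u_def)
      qed
      finally show ?thesis by simp
    qed
    also have "C * (p * ((1 / sqrt r + sqrt r * z\<^sup>2) / 2)) = w n"
      by (simp add: w_def p_def z_def algebra_simps)
    finally show ?thesis
      using C p by (simp add: z_def mult_left_mono)
  qed
  ultimately have "norm (op_exp r (matop V Q) f x - op_exp r (matop V Q) (matop V Q f) x) \<le> C * exp r / sqrt r"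
    using norm_suminf_le[of "\<lambda>n. ?q n / fact n * of_real r ^ n * of_real (1 - real n / r)" w] ws
    by (simp add: sums_iff)
  then have "c * exp (- r) * norm (op_exp r (matop V Q) f x - op_exp r (matop V Q) (matop V Q f) x)
      \<le> c * exp (- r) * (C * exp r / sqrt r)"
    using c_pos by (intro mult_left_mono) auto
  also have "\<dots> = C * (c / sqrt r)"
    by (simp add: exp_minus field_simps)
  also have "c / sqrt r = sqrt (c / t)"
  proof -
    have "c / sqrt r = (sqrt c * sqrt c) / (sqrt c * sqrt t)"
      using c_pos by (simp add: r_def real_sqrt_mult)
    also have "\<dots> = sqrt (c / t)"
      unfolding real_sqrt_divide using c_pos by (intro mult_divide_mult_cancel_left) simp
    finally show ?thesis .
  qed
  finally show ?thesis
    using c_pos by (simp add: Mf norm_mult)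
qed

end

section \<open>Reaches and kernel vectors\<close>

definition lap_matrix :: "'a wdigraph \<Rightarrow> 'a \<Rightarrow> 'a \<Rightarrow> complex" where
  "lap_matrix H x y = (of_real (in_degree H x) * unit_vec x y - of_real (weight H x y)) / of_real (mass H x)"

lemma laplacian_eq_matop:
  assumes "finite (verts H)"
  shows "laplacian H = matop (verts H) (lap_matrix H)"
proof (intro ext)
  fix f x
  show "laplacian H f x = matop (verts H) (lap_matrix H) f x"
  proof (cases "x \<in> verts H")
    case True
    have "(\<Sum>y\<in>verts H. of_real (in_degree H x) * (f y * unit_vec y x)) = of_real (in_degree H x) * f x"
      using unit_vec_sum[OF assms True, of f] by (simp flip: sum_distrib_left)
    then show ?thesis
      using True by (simp add: laplacian_def matop_def lap_matrix_def sum_subtractf right_diff_distrib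
          diff_divide_distrib mult_ac unit_vec_commute[of x] flip: sum_divide_distrib)
  qed (simp add: laplacian_def matop_def)
qed

locale clustered_digraph = finite_wdigraph G for G :: "'a wdigraph" +
  fixes F :: "('a \<times> 'a) set"
  assumes F_subset: "F \<subseteq> edges G"
begin

abbreviation "V \<equiv> verts G"
abbreviation "m \<equiv> mass G"
abbreviation "a \<equiv> weight G"
abbreviation "A \<equiv> laplacian (edge_restrict G F)"
abbreviation "aF \<equiv> weight (edge_restrict G F)"
abbreviation "reach \<equiv> reachable_set V F"

lemma finV [simp]: "finite V" by (rule finite_verts)

lemma F_V: "F \<subseteq> V \<times> V"
  using F_subset edges_subset by blast

lemma aF_nonneg: "x \<in> V \<Longrightarrow> y \<in> V \<Longrightarrow> aF x y \<ge> 0"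
  by (simp add: edge_restrict_def weight_nonneg)

lemma aF_pos_iff: "aF x y > 0 \<longleftrightarrow> (x, y) \<in> F"
  using F_subset F_V weight_pos_iff by (auto simp: edge_restrict_def)

lemma aF_not_edge: "(x, y) \<notin> F \<Longrightarrow> aF x y = 0"
  by (simp add: edge_restrict_def)

lemma A_eq: "A = matop V (lap_matrix (edge_restrict G F))"
  using laplacian_eq_matop[of "edge_restrict G F"] by (simp add: edge_restrict_def)

lemma A_apply: "x \<in> V \<Longrightarrow> A f x = (\<Sum>y\<in>V. of_real (aF x y) * (f x - f y)) / of_real (m x)"
  by (simp add: laplacian_def in_degree_def edge_restrict_def right_diff_distrib sum_subtractf
      sum_distrib_right diff_divide_distrib)

text \<open>The mean value property at \<open>x\<close>, multiplied out so that nodes without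
  incoming cluster edges are covered.\<close>

lemma A_eq_0_iff:
  assumes "x \<in> V"
  shows "A f x = 0 \<longleftrightarrow> of_real (\<Sum>y\<in>V. aF x y) * f x = (\<Sum>y\<in>V. of_real (aF x y) * f y)"
  using assms mass_pos[OF assms]
  by (simp add: A_apply right_diff_distrib sum_subtractf sum_distrib_right)

lemma A_eq_0_const:
  assumes "x \<in> V" "\<And>y. (x, y) \<in> F \<Longrightarrow> f y = f x"
  shows "A f x = 0"
proof -
  have "of_real (aF x y) * (f x - f y) = 0" for y
    using assms(2)[of y] aF_not_edge[of x y] by (cases "(x, y) \<in> F") auto
  then have "(\<Sum>y\<in>V. of_real (aF x y) * (f x - f y)) = 0" by (intro sum.neutral ballI)
  then show ?thesis using assms(1) by (simp add: A_apply)
qed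

text \<open>On such a set the equations \<open>A f x = 0\<close> involve only values inside the set,
  so it can serve as a domain of its own.\<close>

definition pred_closed :: "'a set \<Rightarrow> bool" where
  "pred_closed W \<longleftrightarrow> (\<forall>x\<in>W. \<forall>y. (x, y) \<in> F \<longrightarrow> y \<in> W)"

text \<open>\<open>B\<close> is the boundary. A positive maximum over \<open>W\<close> passes from a
  node outside \<open>B\<close> to each of its predecessors, hence along a path to a boundary node,
  which lies in \<open>W\<close> by closedness and where \<open>u\<close> is not positive.\<close>

lemma maximum_principle:
  fixes u :: "'a \<Rightarrow> real"
  assumes W: "pred_closed W" "W \<subseteq> V"
    and conn: "\<And>x. x \<in> W \<Longrightarrow> \<exists>b\<in>B. (x, b) \<in> F\<^sup>*"
    and sub: "\<And>x. x \<in> W \<Longrightarrow> x \<notin> B \<Longrightarrow> (\<Sum>y\<in>V. aF x y) * u x \<le> (\<Sum>y\<in>V. aF x y * u y)"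
    and bd: "\<And>b. b \<in> W \<Longrightarrow> b \<in> B \<Longrightarrow> u b \<le> 0"
    and x: "x \<in> W"
  shows "u x \<le> 0"
proof -
  have finW: "finite W" using W(2) finite_subset finV by blast
  define \<mu> where "\<mu> = Max (u ` W)"
  have le: "u y \<le> \<mu>" if "y \<in> W" for y
    using finW that by (simp add: \<mu>_def)
  have "\<mu> \<in> u ` W"
    unfolding \<mu>_def using finW x by (intro Max_in) auto
  then obtain z where z: "z \<in> W" "u z = \<mu>" by auto
  have "\<mu> \<le> 0"
  proof (rule ccontr)
    assume mu: "\<not> \<mu> \<le> 0"
    obtain b where b: "b \<in> B" "(z, b) \<in> F\<^sup>*" using conn z by blast
    have "y \<in> W \<and> u y = \<mu>" if "(z, y) \<in> F\<^sup>*" for y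
      using that
    proof (induction rule: rtrancl_induct)
      case base
      then show ?case using z by simp
    next
      case (step y w)
      then have y: "y \<in> W" "u y = \<mu>" "y \<in> V" using W by auto
      have w: "w \<in> W" using W(1) y step.hyps by (auto simp: pred_closed_def)
      have "y \<notin> B" using bd y mu by force
      \<comment> \<open>All terms are nonnegative because \<open>\<mu>\<close> is the maximum, so
        each one vanishes, in particular the one for the predecessor \<open>w\<close>.\<close>
      then have "(\<Sum>v\<in>V. aF y v * (\<mu> - u v)) \<le> 0"
        using sub[OF y(1)] y by (simp add: right_diff_distrib sum_subtractf sum_distrib_right)
      moreover have nn: "aF y v * (\<mu> - u v) \<ge> 0" if "v \<in> V" for v
      proof (cases "(y, v) \<in> F")
        case True
        then have "v \<in> W" using W(1) y by (auto simp: pred_closed_def)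
        then show ?thesis using le[of v] aF_nonneg[OF y(3) that] by simp
      next
        case False
        then show ?thesis using aF_not_edge by simp
      qed
      ultimately have "(\<Sum>v\<in>V. aF y v * (\<mu> - u v)) = 0"
        using sum_nonneg[of V "\<lambda>v. aF y v * (\<mu> - u v)"] by simp
      then have "aF y w * (\<mu> - u w) = 0"
        using sum_nonneg_eq_0_iff[of V "\<lambda>v. aF y v * (\<mu> - u v)"] nn w W(2) by auto
      moreover have "aF y w > 0" using aF_pos_iff step.hyps by blast
      ultimately show ?case using w by simp
    qed
    from this[OF b(2)] bd[of b] b mu show False by simp
  qed
  then show ?thesis using le[OF x] by simp
qed

text \<open>By the triangle inequality the modulus of a harmonic function is subharmonic, which
  makes the real maximum principle available for complex values.\<close>

lemma harmonic_zero:
  assumes W: "pred_closed W" "W \<subseteq> V"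
    and conn: "\<And>x. x \<in> W \<Longrightarrow> \<exists>b\<in>B. (x, b) \<in> F\<^sup>*"
    and harm: "\<And>x. x \<in> W \<Longrightarrow> x \<notin> B \<Longrightarrow> A f x = 0"
    and bd: "\<And>b. b \<in> W \<Longrightarrow> b \<in> B \<Longrightarrow> f b = 0"
    and x: "x \<in> W"
  shows "f x = 0"
proof -
  have "norm (f x) \<le> 0"
  proof (rule maximum_principle[OF W conn _ _ x, where u = "\<lambda>x. norm (f x)"])
    fix z assume z: "z \<in> W" "z \<notin> B"
    then have zV: "z \<in> V" using W by auto
    have "(\<Sum>y\<in>V. aF z y) * norm (f z) = norm (of_real (\<Sum>y\<in>V. aF z y) * f z)"
      using zV by (simp add: norm_mult sum_nonneg aF_nonneg del: of_real_sum)
    also have "\<dots> = norm (\<Sum>y\<in>V. of_real (aF z y) * f y)"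
      using harm[OF z] zV A_eq_0_iff by simp
    also have "\<dots> \<le> (\<Sum>y\<in>V. aF z y * norm (f y))"
      using zV by (intro sum_norm_le) (simp add: norm_mult aF_nonneg)
    finally show "(\<Sum>y\<in>V. aF z y) * norm (f z) \<le> (\<Sum>y\<in>V. aF z y * norm (f y))" .
  qed (use bd in auto)
  then show ?thesis by simp
qed

section \<open>Reaches, their roots and their exclusive parts\<close>

abbreviation "Rs \<equiv> reaches V F"

lemma finite_reaches [simp]: "finite Rs"
  by (simp add: reaches_def)

lemma reach_self: "x \<in> V \<Longrightarrow> x \<in> reach x"
  by (simp add: reachable_set_def)

lemma reach_mono: "y \<in> reach x \<Longrightarrow> reach y \<subseteq> reach x"
  by (auto simp: reachable_set_def)

text \<open>A reach may have several generating nodes, all reachable from each other; one of them is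
  fixed to carry a boundary value.\<close>

definition root :: "'a set \<Rightarrow> 'a" where
  "root R = (SOME i. i \<in> V \<and> reach i = R)"

lemma root:
  assumes "R \<in> Rs"
  shows "root R \<in> V" "reach (root R) = R"
proof -
  have "\<exists>i. i \<in> V \<and> reach i = R"
    using assms by (auto simp: reaches_def)
  from someI_ex[OF this] show "root R \<in> V" "reach (root R) = R"
    by (auto simp: root_def)
qed

lemma reaches_maximal: "R \<in> Rs \<Longrightarrow> i \<in> V \<Longrightarrow> R \<subseteq> reach i \<Longrightarrow> R = reach i"
  by (auto simp: reaches_def)

lemma reach_subset: "R \<in> Rs \<Longrightarrow> R \<subseteq> V"
  using root(2)[of R] by (auto simp: reachable_set_def)

lemma reach_root_path: "R \<in> Rs \<Longrightarrow> x \<in> R \<Longrightarrow> (x, root R) \<in> F\<^sup>*"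
  using root(2)[of R] by (auto simp: reachable_set_def)

text \<open>Any reach that contains \<open>i\<close> contains everything reachable from
  \<open>i\<close>, hence all of \<open>R\<close>, and equals \<open>R\<close> by
  maximality.\<close>

lemma in_exclusive_part:
  assumes "R \<in> Rs" "i \<in> V" "reach i = R"
  shows "i \<in> exclusive_part V F R"
proof -
  have "S = R" if S: "S \<in> Rs" "i \<in> S" for S
  proof -
    have "i \<in> reach (root S)" using S by (simp only: root)
    from reach_mono[OF this] have "R \<subseteq> reach (root S)" by (simp only: assms(3))
    from reaches_maximal[OF assms(1) root(1)[OF S(1)] this] show ?thesis using S by (simp only: root)
  qed
  then show ?thesis using reach_self[OF assms(2)] assms(3) by (simp add: exclusive_part_def)
qed

lemma root_exclusive: "R \<in> Rs \<Longrightarrow> root R \<in> exclusive_part V F R"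
  by (rule in_exclusive_part) (simp_all only: root)

lemma root_in: "R \<in> Rs \<Longrightarrow> root R \<in> R"
  using root_exclusive by (auto simp: exclusive_part_def)

text \<open>A maximal element among the reachable sets that contain \<open>x\<close> is maximal
  among all of them, since a larger set contains \<open>x\<close> too.\<close>

lemma exists_reach:
  assumes "x \<in> V"
  shows "\<exists>R\<in>Rs. x \<in> R"
proof -
  define \<S> where "\<S> = {S \<in> reach ` V. x \<in> S}"
  have "finite \<S>" "\<S> \<noteq> {}" using assms reach_self by (auto simp: \<S>_def)
  from finite_has_maximal[OF this] obtain R
    where R: "R \<in> \<S>" "\<And>S. S \<in> \<S> \<Longrightarrow> R \<subseteq> S \<Longrightarrow> R = S" by auto
  have "R \<in> Rs" unfolding reaches_def
  proof (intro CollectI conjI ballI impI)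
    show "R \<in> reach ` V" using R(1) by (simp add: \<S>_def)
    fix S assume "S \<in> reach ` V" "R \<subseteq> S"
    moreover have "x \<in> R" using R(1) by (simp add: \<S>_def)
    ultimately show "R = S" using R(2)[of S] by (auto simp: \<S>_def)
  qed
  moreover have "x \<in> R" using R(1) by (simp add: \<S>_def)
  ultimately show ?thesis by blast
qed

lemma pred_in_V: "(x, y) \<in> F \<Longrightarrow> y \<in> V"
  using F_V by blast

lemma succ_closed_reach:
  assumes "R \<in> Rs" "y \<in> R" "(x, y) \<in> F"
  shows "x \<in> R"
proof -
  have "(x, root R) \<in> F\<^sup>*"
    using reach_root_path[OF assms(1,2)] assms(3) by (rule converse_rtrancl_into_rtrancl[rotated])
  then have "x \<in> reach (root R)"
    using assms F_V by (auto simp: reachable_set_def)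
  then show ?thesis using root assms by simp
qed

lemma pred_closed_V: "pred_closed V"
  using F_V by (auto simp: pred_closed_def)

lemma pred_closed_outside: "R \<in> Rs \<Longrightarrow> pred_closed (V - R)"
  using F_V succ_closed_reach by (auto simp: pred_closed_def)

text \<open>Reaches are closed under successors, so a reach that contains a predecessor of
  \<open>x\<close> contains \<open>x\<close> and must be \<open>R\<close>.\<close>

lemma pred_closed_exclusive:
  assumes "R \<in> Rs"
  shows "pred_closed (exclusive_part V F R)"
  unfolding pred_closed_def
proof (intro ballI allI impI)
  fix x y assume x: "x \<in> exclusive_part V F R" and xy: "(x, y) \<in> F"
  obtain S where S: "S \<in> Rs" "y \<in> S" using exists_reach pred_in_V[OF xy] by blast
  have *: "T = R" if "T \<in> Rs" "y \<in> T" for T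
    using succ_closed_reach[OF that xy] x that by (auto simp: exclusive_part_def)
  with S show "y \<in> exclusive_part V F R" by (auto simp: exclusive_part_def)
qed

lemma exclusive_subset: "exclusive_part V F R \<subseteq> R"
  by (auto simp: exclusive_part_def)

text \<open>The Dirichlet boundary for the equation \<open>A f = 0\<close>: one node for each reach,
  and each node of \<open>V\<close> is reachable from one of them.\<close>

definition roots :: "'a set" where "roots = root ` Rs"

lemma conn_roots: "x \<in> V \<Longrightarrow> \<exists>b\<in>roots. (x, b) \<in> F\<^sup>*"
proof -
  assume "x \<in> V"
  from exists_reach[OF this] obtain R where "R \<in> Rs" "x \<in> R" by blast
  with reach_root_path[OF this] show ?thesis by (auto simp: roots_def)
qed

lemma root_inj: "R \<in> Rs \<Longrightarrow> S \<in> Rs \<Longrightarrow> root R = root S \<longleftrightarrow> R = S"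
  using root(2) by metis

text \<open>Subtract the value at the root, which is the only boundary node here. The root is exempt
  from the equation because \<open>kernel_exists\<close> uses the lemma for a function not yet known
  to satisfy it there.\<close>

lemma harmonic_const_exclusive:
  assumes R: "R \<in> Rs"
    and harm: "\<And>x. x \<in> exclusive_part V F R \<Longrightarrow> x \<noteq> root R \<Longrightarrow> A f x = 0"
    and x: "x \<in> exclusive_part V F R"
  shows "f x = f (root R)"
proof -
  have sub: "exclusive_part V F R \<subseteq> V" using exclusive_subset reach_subset[OF R] by blast
  have "f x - f (root R) = 0"
  proof (rule harmonic_zero[OF pred_closed_exclusive[OF R] sub, where B = "{root R}" and x = x and f = "\<lambda>x. f x - f (root R)"])
    show "\<exists>b\<in>{root R}. (z, b) \<in> F\<^sup>*" if "z \<in> exclusive_part V F R" for z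
      using that reach_root_path[OF R, of z] exclusive_subset[of R] by auto
    show "A (\<lambda>x. f x - f (root R)) z = 0" if "z \<in> exclusive_part V F R" "z \<notin> {root R}" for z
    proof -
      have "z \<in> V" using that sub by auto
      then show ?thesis using harm[of z] that by (simp add: A_apply)
    qed
  qed (use x in auto)
  then show ?thesis by simp
qed

text \<open>Values at the roots determine a kernel vector, so the kernel has at most as many
  dimensions as there are reaches.\<close>

lemma kernel_unique:
  assumes f: "f \<in> fvec V" and Af: "\<And>x. x \<in> V \<Longrightarrow> A f x = 0"
    and roots: "\<And>R. R \<in> Rs \<Longrightarrow> f (root R) = 0"
  shows "f x = 0"
proof (cases "x \<in> V")
  case True
  show ?thesis
    by (rule harmonic_zero[OF pred_closed_V order_refl conn_roots _ _ True, where f = f])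
       (use Af roots in \<open>auto simp: roots_def\<close>)
next
  case False
  then show ?thesis using f by (simp add: fvec_def)
qed

text \<open>A Dirichlet problem with value 1 at the root of \<open>R\<close> and 0 at the other
  roots is solvable, as its homogeneous version has only the zero solution. The solution is constant
  on every exclusive part, and it vanishes on \<open>V - R\<close>, a domain of its own with zero
  boundary values.\<close>

lemma kernel_exists:
  assumes R: "R \<in> Rs"
  shows "\<exists>f\<in>fvec V. A f = (\<lambda>_. 0) \<and> (\<forall>x\<in>exclusive_part V F R. f x = 1) \<and>
           (\<forall>S\<in>Rs. S \<noteq> R \<longrightarrow> (\<forall>x\<in>exclusive_part V F S. f x = 0)) \<and> (\<forall>x. x \<notin> R \<longrightarrow> f x = 0)"
proof -
  \<comment> \<open>The rows of \<open>A\<close> at the roots are replaced by rows of the identity,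
    so \<open>D\<close> imposes boundary values there and the equation elsewhere.\<close>
  define D where "D x y = (if x \<in> roots then unit_vec x y else lap_matrix (edge_restrict G F) x y)" for x y
  have D: "matop V D f x = (if x \<in> roots then f x else A f x)" if "x \<in> V" for f x
  proof -
    have "(\<Sum>y\<in>V. unit_vec x y * f y) = f x"
      using unit_vec_sum[OF finV that, of f] by (simp add: mult.commute unit_vec_commute)
    then show ?thesis
      using that unfolding A_eq by (simp add: matop_def D_def)
  qed
  have "\<exists>f\<in>fvec V. matop V D f = unit_vec (root R)"
  proof (rule matop_surj[OF finV])
    fix f assume f: "f \<in> fvec V" "\<And>x. x \<in> V \<Longrightarrow> matop V D f x = 0"
    have "f x = 0" if "x \<in> V" for x
    proof (rule harmonic_zero[OF pred_closed_V order_refl conn_roots _ _ that, where f = f])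
      show "A f x = 0" if "x \<in> V" "x \<notin> roots" for x using f(2)[of x] that by (simp add: D)
      show "f x = 0" if "x \<in> V" "x \<in> roots" for x using f(2)[of x] that by (simp add: D)
    qed
    then show "\<forall>x. f x = 0" using f by (auto simp: fvec_def)
  qed (use root R in auto)
  then obtain f where f: "f \<in> fvec V" "matop V D f = unit_vec (root R)" by blast
  have f_root: "f (root S) = (if S = R then 1 else 0)" if "S \<in> Rs" for S
    using fun_cong[OF f(2), of "root S"] D[of "root S" f] root that R
    by (auto simp: roots_def unit_vec_def root_inj)
  have harm: "A f x = 0" if "x \<in> V" "x \<notin> roots" for x
    using fun_cong[OF f(2), of x] D[of x f] that R by (auto simp: roots_def unit_vec_def)
  have const: "f x = f (root S)" if S: "S \<in> Rs" and x: "x \<in> exclusive_part V F S" for S x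
  proof (rule harmonic_const_exclusive[OF S _ x])
    fix z assume z: "z \<in> exclusive_part V F S" "z \<noteq> root S"
    have "z \<notin> roots"
    proof
      assume "z \<in> roots"
      then obtain T where T: "T \<in> Rs" "z = root T" by (auto simp: roots_def)
      then have "T = S" using z root_in by (auto simp: exclusive_part_def)
      with T z show False by simp
    qed
    then show "A f z = 0" using harm z exclusive_subset reach_subset[OF S] by blast
  qed
  \<comment> \<open>The equation at a root was not imposed; it holds because all predecessors of the
    root lie in its exclusive part, where \<open>f\<close> is constant.\<close>
  have "A f x = 0" for x
  proof (cases "x \<in> roots")
    case True
    then obtain S where S: "S \<in> Rs" "x = root S" by (auto simp: roots_def)
    show ?thesis
    proof (rule A_eq_0_const)
      show "x \<in> V" using S root by simp
      fix y assume "(x, y) \<in> F"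
      then have "y \<in> exclusive_part V F S"
        using pred_closed_exclusive[OF S(1)] root_exclusive[OF S(1)] S by (auto simp: pred_closed_def)
      then show "f y = f x" using const S by simp
    qed
  next
    case False
    then show ?thesis using harm by (cases "x \<in> V") (auto simp: laplacian_def edge_restrict_def)
  qed
  moreover have "f x = 0" if "x \<notin> R" for x
  proof (cases "x \<in> V")
    case True
    show ?thesis
    proof (rule harmonic_zero[OF pred_closed_outside[OF R], where B = roots and f = f])
      show "\<exists>b\<in>roots. (z, b) \<in> F\<^sup>*" if "z \<in> V - R" for z using that conn_roots by auto
      show "f b = 0" if "b \<in> V - R" "b \<in> roots" for b
        using that f_root root_in R by (auto simp: roots_def)
    qed (use harm True that in auto)
  next
    case False
    then show ?thesis using f by (simp add: fvec_def)
  qed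
  moreover have "f x = 1" if "x \<in> exclusive_part V F R" for x
    using const[OF R that] f_root[OF R] by simp
  moreover have "f x = 0" if "x \<in> exclusive_part V F S" "S \<in> Rs" "S \<noteq> R" for S x
    using const[OF that(2,1)] f_root[OF that(2)] that by simp
  ultimately show ?thesis using f(1) by (intro bexI[of _ f]) (auto simp: fun_eq_iff)
qed

section \<open>Kernel vectors: duality with the roots, partition of unity, positivity\<close>

abbreviation "\<gamma> \<equiv> kernel_vector G F"

lemma kernel_vector:
  assumes R: "R \<in> Rs"
  shows "\<gamma> R \<in> fvec V" "A (\<gamma> R) x = 0" "x \<notin> R \<Longrightarrow> \<gamma> R x = 0"
    "S \<in> Rs \<Longrightarrow> x \<in> exclusive_part V F S \<Longrightarrow> \<gamma> R x = (if S = R then 1 else 0)"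
proof -
  obtain f where f: "f \<in> fvec V" "A f = (\<lambda>_. 0)" "\<forall>x\<in>exclusive_part V F R. f x = 1"
    "\<forall>S\<in>Rs. S \<noteq> R \<longrightarrow> (\<forall>x\<in>exclusive_part V F S. f x = 0)" "\<forall>x. x \<notin> R \<longrightarrow> f x = 0"
    using kernel_exists[OF R] by blast
  have "\<gamma> R = f"
    unfolding kernel_vector_def
  proof (rule the_equality)
    fix g assume g: "g \<in> ell2 G \<and> A g = (\<lambda>_. 0) \<and> (\<forall>x\<in>exclusive_part V F R. g x = 1) \<and> (\<forall>x. x \<notin> R \<longrightarrow> g x = 0)"
    have "g x - f x = 0" for x
    proof (rule kernel_unique[where f = "\<lambda>x. g x - f x"])
      show "(\<lambda>x. g x - f x) \<in> fvec V" using f g by (auto simp: fvec_def ell2_def)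
      show "A (\<lambda>x. g x - f x) z = 0" for z
        using f g unfolding A_eq by (simp add: matop_diff)
      fix S assume S: "S \<in> Rs"
      show "g (root S) - f (root S) = 0"
      proof (cases "S = R")
        case True
        then show ?thesis using f g root_exclusive[OF R] by simp
      next
        case False
        then have "root S \<notin> R"
          using root_exclusive[OF S] R by (auto simp: exclusive_part_def)
        then show ?thesis using f g by simp
      qed
    qed
    then show "g = f" by (simp add: fun_eq_iff)
  qed (use f in \<open>auto simp: ell2_def fvec_def\<close>)
  then show "\<gamma> R \<in> fvec V" "A (\<gamma> R) x = 0" "x \<notin> R \<Longrightarrow> \<gamma> R x = 0"
    "S \<in> Rs \<Longrightarrow> x \<in> exclusive_part V F S \<Longrightarrow> \<gamma> R x = (if S = R then 1 else 0)"
    using f by auto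
qed

lemma kernel_vector_root: "R \<in> Rs \<Longrightarrow> S \<in> Rs \<Longrightarrow> \<gamma> R (root S) = (if S = R then 1 else 0)"
  using kernel_vector(4) root_exclusive by blast

text \<open>The kernel vectors are the basis of the kernel dual to evaluation at the roots.\<close>

lemma kernel_expand:
  assumes f: "f \<in> fvec V" "\<And>x. x \<in> V \<Longrightarrow> A f x = 0"
  shows "f x = (\<Sum>R\<in>Rs. f (root R) * \<gamma> R x)"
proof -
  have "f x - (\<Sum>R\<in>Rs. f (root R) * \<gamma> R x) = 0"
  proof (rule kernel_unique[where f = "\<lambda>x. f x - (\<Sum>R\<in>Rs. f (root R) * \<gamma> R x)"])
    show "(\<lambda>x. f x - (\<Sum>R\<in>Rs. f (root R) * \<gamma> R x)) \<in> fvec V"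
      using f kernel_vector(1) by (auto simp: fvec_def intro!: sum.neutral)
    show "A (\<lambda>x. f x - (\<Sum>R\<in>Rs. f (root R) * \<gamma> R x)) z = 0" if "z \<in> V" for z
      using f(2)[OF that] kernel_vector(2) unfolding A_eq by (simp add: matop_diff matop_sum)
    fix S assume S: "S \<in> Rs"
    have "(\<Sum>R\<in>Rs. f (root R) * \<gamma> R (root S)) = (\<Sum>R\<in>Rs. if R = S then f (root S) else 0)"
      using S by (intro sum.cong) (auto simp: kernel_vector_root)
    then show "f (root S) - (\<Sum>R\<in>Rs. f (root R) * \<gamma> R (root S)) = 0"
      using S by simp
  qed
  then show ?thesis by simp
qed

text \<open>The constant function lies in the kernel and has the value 1 at every root. It is cut
  off outside \<open>V\<close>, which does not disturb the equation since predecessors stay in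
  \<open>V\<close>.\<close>

lemma kernel_vector_sum:
  assumes "x \<in> V"
  shows "(\<Sum>R\<in>Rs. \<gamma> R x) = 1"
proof -
  define one where "one x = (if x \<in> V then 1 else 0 :: complex)" for x
  have "one x = (\<Sum>R\<in>Rs. one (root R) * \<gamma> R x)"
  proof (rule kernel_expand[of one])
    show "A one z = 0" if "z \<in> V" for z
      by (rule A_eq_0_const) (use that pred_in_V in \<open>auto simp: one_def\<close>)
  qed (auto simp: one_def fvec_def)
  then show ?thesis using assms root by (simp add: one_def)
qed

text \<open>\<open>A\<close> has real coefficients, so the conjugate is again a kernel vector, with
  the same values at the roots.\<close>

lemma kernel_vector_real:
  assumes R: "R \<in> Rs"
  shows "cnj (\<gamma> R x) = \<gamma> R x"
proof -
  have "cnj (\<gamma> R x) = (\<Sum>S\<in>Rs. cnj (\<gamma> R (root S)) * \<gamma> S x)"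
  proof (rule kernel_expand[where f = "\<lambda>x. cnj (\<gamma> R x)"])
    show "A (\<lambda>x. cnj (\<gamma> R x)) z = 0" if "z \<in> V" for z
    proof -
      have "A (\<lambda>x. cnj (\<gamma> R x)) z = cnj (A (\<gamma> R) z)"
        using that by (simp add: A_apply)
      then show ?thesis using kernel_vector(2)[OF R] by simp
    qed
  qed (use kernel_vector(1)[OF R] in \<open>auto simp: fvec_def\<close>)
  also have "\<dots> = (\<Sum>S\<in>Rs. \<gamma> R (root S) * \<gamma> S x)"
    using R by (intro sum.cong) (auto simp: kernel_vector_root)
  also have "\<dots> = \<gamma> R x"
    by (rule kernel_expand[of "\<gamma> R", symmetric]) (use kernel_vector[OF R] in auto)
  finally show ?thesis .
qed

lemma of_real_Re_kernel_vector: "R \<in> Rs \<Longrightarrow> complex_of_real (Re (\<gamma> R x)) = \<gamma> R x"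
  using kernel_vector_real[of R x] by (simp add: complex_eq_iff)

text \<open>The negated real part is harmonic with values 0 or -1 at the roots, so the maximum
  principle applies.\<close>

lemma kernel_vector_nonneg:
  assumes R: "R \<in> Rs"
  shows "Re (\<gamma> R x) \<ge> 0"
proof (cases "x \<in> V")
  case True
  have "- Re (\<gamma> R x) \<le> 0"
  proof (rule maximum_principle[OF pred_closed_V order_refl conn_roots _ _ True, where u = "\<lambda>x. - Re (\<gamma> R x)"])
    fix z assume z: "z \<in> V"
    have "of_real (\<Sum>y\<in>V. aF z y) * \<gamma> R z = (\<Sum>y\<in>V. of_real (aF z y) * \<gamma> R y)"
      using kernel_vector(2)[OF R, of z] A_eq_0_iff[OF z] by simp
    from arg_cong[OF this, of Re]
    have "(\<Sum>y\<in>V. aF z y) * Re (\<gamma> R z) = (\<Sum>y\<in>V. aF z y * Re (\<gamma> R y))"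
      by (simp flip: of_real_sum)
    then show "(\<Sum>y\<in>V. aF z y) * - Re (\<gamma> R z) \<le> (\<Sum>y\<in>V. aF z y * - Re (\<gamma> R y))"
      by (simp add: sum_negf)
  qed (use R in \<open>auto simp: roots_def kernel_vector_root\<close>)
  then show ?thesis by simp
qed (use kernel_vector(1)[OF R] in \<open>simp add: fvec_def\<close>)

end

section \<open>The Markov chain tree theorem\<close>

text \<open>With at most one successor per node, a walk that starts on a cycle cannot leave it, so
  it can be continued back to \<open>y\<close>.\<close>

lemma single_valued_cycle:
  assumes sv: "single_valued \<tau>" and cyc: "(y, y) \<in> \<tau>\<^sup>+" and path: "(y, x) \<in> \<tau>\<^sup>*"
  shows "(x, y) \<in> \<tau>\<^sup>+"
  using path
proof (induction rule: rtrancl_induct)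
  case (step u v)
  from step.IH obtain w where w: "(u, w) \<in> \<tau>" "(w, y) \<in> \<tau>\<^sup>*"
    by (meson tranclD)
  then have "w = v" using sv step.hyps by (auto simp: single_valued_def)
  with w(2) cyc show ?case by (auto simp: rtrancl_eq_or_trancl)
qed (use cyc in simp)

text \<open>The walk is cut at its first arrival at \<open>y\<close>; the pairs before the final one
  then avoid \<open>y\<close> as second component.\<close>

lemma last_before_return:
  assumes "(w, y) \<in> U\<^sup>+"
  shows "\<exists>x. (w, x) \<in> {(u, v) \<in> U. v \<noteq> y}\<^sup>* \<and> (x, y) \<in> U"
  using assms
proof (induction rule: converse_trancl_induct)
  case (step w w')
  then obtain x where x: "(w', x) \<in> {(u, v) \<in> U. v \<noteq> y}\<^sup>*" "(x, y) \<in> U" by blast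
  show ?case
  proof (cases "w' = y")
    case True
    then show ?thesis using step.hyps by blast
  next
    case False
    then have "(w, x) \<in> {(u, v) \<in> U. v \<noteq> y}\<^sup>*"
      using step.hyps x by (intro converse_rtrancl_into_rtrancl[OF _ x(1)]) auto
    then show ?thesis using x by blast
  qed
qed blast

text \<open>
  The graphs in which exactly one edge enters each node of \<open>R\<close> and whose unique cycle passes
  through \<open>y\<close>. Deleting the cycle edge that enters \<open>y\<close>, or the one that leaves \<open>y\<close>, yields a
  spanning tree; comparing the two decompositions proves the tree theorem.
\<close>

definition unicyclic :: "('a \<times> 'a) set \<Rightarrow> 'a set \<Rightarrow> 'a \<Rightarrow> ('a \<times> 'a) set set" where
  "unicyclic F R y = {U. U \<subseteq> F \<and> U \<subseteq> R \<times> R \<and> (\<forall>x\<in>R. \<exists>!z. (x, z) \<in> U) \<and> (\<forall>x\<in>R. (x, y) \<in> U\<^sup>*)}"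

lemma spanning_treesD:
  assumes "\<tau> \<in> spanning_trees F R i"
  shows "\<tau> \<subseteq> F" "\<tau> \<subseteq> R \<times> R" "i \<in> R" "(i, y) \<notin> \<tau>" "x \<in> R \<Longrightarrow> x \<noteq> i \<Longrightarrow> \<exists>!y. (x, y) \<in> \<tau>"
    "x \<in> R \<Longrightarrow> (x, i) \<in> \<tau>\<^sup>*"
  using assms by (auto simp: spanning_trees_def)

lemma spanning_treesI:
  assumes "\<tau> \<subseteq> F" "\<tau> \<subseteq> R \<times> R" "i \<in> R" "\<And>y. (i, y) \<notin> \<tau>"
    "\<And>x. x \<in> R \<Longrightarrow> x \<noteq> i \<Longrightarrow> \<exists>!y. (x, y) \<in> \<tau>" "\<And>x. x \<in> R \<Longrightarrow> (x, i) \<in> \<tau>\<^sup>*"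
  shows "\<tau> \<in> spanning_trees F R i"
  using assms by (simp add: spanning_trees_def)

lemma spanning_trees_single_valued:
  assumes "\<tau> \<in> spanning_trees F R i"
  shows "single_valued \<tau>"
  unfolding single_valued_def
proof (intro allI impI)
  fix x y z assume "(x, y) \<in> \<tau>" "(x, z) \<in> \<tau>"
  moreover from this have "x \<in> R" "x \<noteq> i" using spanning_treesD(2,4)[OF assms] by auto
  ultimately show "y = z" using spanning_treesD(5)[OF assms] by blast
qed

text \<open>Every node leads to the root \<open>i\<close>, so a cycle through \<open>y\<close> could
  be continued from \<open>i\<close> back to \<open>y\<close>; but no pair of the tree starts with
  \<open>i\<close>.\<close>

lemma spanning_trees_acyclic:
  assumes "\<tau> \<in> spanning_trees F R i"
  shows "(y, y) \<notin> \<tau>\<^sup>+"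
proof
  assume cyc: "(y, y) \<in> \<tau>\<^sup>+"
  then obtain w where "(y, w) \<in> \<tau>" by (meson tranclD)
  then have "y \<in> R" using spanning_treesD(2)[OF assms] by auto
  then have "(i, y) \<in> \<tau>\<^sup>+"
    using single_valued_cycle[OF spanning_trees_single_valued[OF assms] cyc] spanning_treesD(6)[OF assms] by blast
  then obtain z where "(i, z) \<in> \<tau>" by (meson tranclD)
  then show False using spanning_treesD(4)[OF assms] by blast
qed

lemma insert_root_edge_unicyclic:
  assumes \<tau>: "\<tau> \<in> spanning_trees F R x" and xz: "(x, z) \<in> F" "z \<in> R"
    and y: "\<And>u. u \<in> R \<Longrightarrow> (u, y) \<in> (insert (x, z) \<tau>)\<^sup>*"
  shows "insert (x, z) \<tau> \<in> unicyclic F R y"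
proof -
  have "\<exists>!v. (u, v) \<in> insert (x, z) \<tau>" if "u \<in> R" for u
  proof (cases "u = x")
    case True
    then show ?thesis using spanning_treesD(4)[OF \<tau>] by auto
  next
    case False
    then show ?thesis using spanning_treesD(5)[OF \<tau> that] by auto
  qed
  then show ?thesis
    using y xz spanning_treesD(1-3)[OF \<tau>] by (auto simp: unicyclic_def)
qed

text \<open>The inverse deletes the one pair \<open>(y, z)\<close>, the edge entering
  \<open>y\<close>. Walks towards \<open>y\<close> survive, because they can be stopped at their
  first arrival, before that pair is used.\<close>

lemma bij_betw_unicyclic_out:
  assumes y: "y \<in> R"
  shows "bij_betw (\<lambda>(z, \<tau>). insert (y, z) \<tau>) ({z \<in> R. (y, z) \<in> F} \<times> spanning_trees F R y)
           (unicyclic F R y)"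
  unfolding bij_betw_def
proof (intro conjI inj_onI subset_antisym)
  fix p q
  assume p: "p \<in> {z \<in> R. (y, z) \<in> F} \<times> spanning_trees F R y"
    and q: "q \<in> {z \<in> R. (y, z) \<in> F} \<times> spanning_trees F R y"
    and eq: "(case p of (z, \<tau>) \<Rightarrow> insert (y, z) \<tau>) = (case q of (z, \<tau>) \<Rightarrow> insert (y, z) \<tau>)"
  obtain z \<tau> where p': "p = (z, \<tau>)" by (cases p)
  obtain z' \<tau>' where q': "q = (z', \<tau>')" by (cases q)
  have \<tau>: "\<tau> \<in> spanning_trees F R y" "\<tau>' \<in> spanning_trees F R y" using p q p' q' by auto
  have eq': "insert (y, z) \<tau> = insert (y, z') \<tau>'" using eq p' q' by simp
  have "(y, z) \<in> insert (y, z') \<tau>'" by (simp flip: eq')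
  then have zz: "z = z'" using spanning_treesD(4)[OF \<tau>(2), of z] by simp
  from insert_ident[OF spanning_treesD(4)[OF \<tau>(1)] spanning_treesD(4)[OF \<tau>(2)], of z']
  have "\<tau> = \<tau>'" using eq' by (simp only: zz)
  with zz p' q' show "p = q" by simp
next
  show "(\<lambda>(z, \<tau>). insert (y, z) \<tau>) ` ({z \<in> R. (y, z) \<in> F} \<times> spanning_trees F R y) \<subseteq> unicyclic F R y"
  proof clarify
    fix z \<tau> assume z: "z \<in> R" "(y, z) \<in> F" and \<tau>: "\<tau> \<in> spanning_trees F R y"
    show "insert (y, z) \<tau> \<in> unicyclic F R y"
    proof (rule insert_root_edge_unicyclic[OF \<tau> z(2,1)])
      show "(u, y) \<in> (insert (y, z) \<tau>)\<^sup>*" if "u \<in> R" for u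
        by (rule subsetD[OF rtrancl_mono[OF subset_insertI] spanning_treesD(6)[OF \<tau> that]])
    qed
  qed
next
  show "unicyclic F R y \<subseteq> (\<lambda>(z, \<tau>). insert (y, z) \<tau>) ` ({z \<in> R. (y, z) \<in> F} \<times> spanning_trees F R y)"
  proof
    fix U assume "U \<in> unicyclic F R y"
    then have U: "U \<subseteq> F" "U \<subseteq> R \<times> R" "\<And>x. x \<in> R \<Longrightarrow> \<exists>!z. (x, z) \<in> U" "\<And>x. x \<in> R \<Longrightarrow> (x, y) \<in> U\<^sup>*"
      by (auto simp: unicyclic_def)
    obtain z where z: "(y, z) \<in> U" "\<And>v. (y, v) \<in> U \<Longrightarrow> v = z" using U(3)[OF y] by blast
    define \<tau> where "\<tau> = U - {(y, z)}"
    have "(x, y) \<in> \<tau>\<^sup>*" if "(x, y) \<in> U\<^sup>*" for x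
      using that
    proof (induction rule: converse_rtrancl_induct)
      case (step u v)
      show ?case
      proof (cases "u = y")
        case False
        then have "(u, v) \<in> \<tau>" using step by (auto simp: \<tau>_def)
        then show ?thesis using step by simp
      qed simp
    qed simp
    note conn = this
    have uniq: "\<exists>!v. (x, v) \<in> \<tau>" if "x \<in> R" "x \<noteq> y" for x
    proof -
      have "(x, v) \<in> \<tau> \<longleftrightarrow> (x, v) \<in> U" for v using that(2) by (simp add: \<tau>_def)
      then show ?thesis using U(3)[OF that(1)] by simp
    qed
    have "\<tau> \<in> spanning_trees F R y"
    proof (rule spanning_treesI)
      show "\<tau> \<subseteq> F" "\<tau> \<subseteq> R \<times> R" using U(1,2) by (auto simp: \<tau>_def)
      show "(y, v) \<notin> \<tau>" for v using z(2)[of v] by (auto simp: \<tau>_def)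
      show "\<exists>!v. (x, v) \<in> \<tau>" if "x \<in> R" "x \<noteq> y" for x by (rule uniq[OF that])
      show "(x, y) \<in> \<tau>\<^sup>*" if "x \<in> R" for x by (rule conn[OF U(4)[OF that]])
    qed (rule y)
    moreover have "U = insert (y, z) \<tau>" using z(1) by (auto simp: \<tau>_def)
    ultimately show "U \<in> (\<lambda>(z, \<tau>). insert (y, z) \<tau>) ` ({z \<in> R. (y, z) \<in> F} \<times> spanning_trees F R y)"
      using U(1,2) z(1) by (intro image_eqI[of _ _ "(z, \<tau>)"]) auto
  qed
qed

text \<open>The walk from \<open>y\<close> to \<open>x\<close> in \<open>\<tau>\<close>, stopped at
  the first of \<open>x\<close> and \<open>x'\<close>, lies in both trees. If it ends in
  \<open>x\<close>, the pair \<open>(x, y)\<close> closes a cycle in \<open>\<tau>'\<close>; if it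
  ends in \<open>x'\<close>, the pair \<open>(x', y)\<close> closes one in
  \<open>\<tau>\<close>.\<close>

lemma spanning_trees_exchange_unique:
  assumes \<tau>: "\<tau> \<in> spanning_trees F R x" and \<tau>': "\<tau>' \<in> spanning_trees F R x'"
    and y: "y \<in> R" and eq: "insert (x, y) \<tau> = insert (x', y) \<tau>'"
  shows "x = x'"
proof (rule ccontr)
  assume ne: "x \<noteq> x'"
  define \<sigma> where "\<sigma> = \<tau> \<inter> \<tau>'"
  have "(x', y) \<in> \<tau>" "(x, y) \<in> \<tau>'" using eq ne by auto
  have *: "(z, x) \<in> \<sigma>\<^sup>* \<or> (z, x') \<in> \<sigma>\<^sup>*" if "(z, x) \<in> \<tau>\<^sup>*" for z
    using that
  proof (induction rule: converse_rtrancl_induct)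
    case (step u v)
    show ?case
    proof (cases "u = x'")
      case False
      then have "(u, v) \<in> \<tau>'"
        using step.hyps eq spanning_treesD(4)[OF \<tau>] by auto
      then have "(u, v) \<in> \<sigma>" using step.hyps by (simp add: \<sigma>_def)
      then show ?thesis using step.IH by (meson converse_rtrancl_into_rtrancl)
    qed simp
  qed simp
  have sub: "\<sigma>\<^sup>* \<subseteq> \<tau>\<^sup>*" "\<sigma>\<^sup>* \<subseteq> \<tau>'\<^sup>*" by (auto simp: \<sigma>_def intro!: rtrancl_mono)
  from *[OF spanning_treesD(6)[OF \<tau> y]] show False
  proof
    assume "(y, x) \<in> \<sigma>\<^sup>*"
    then have "(y, y) \<in> \<tau>'\<^sup>+" using sub \<open>(x, y) \<in> \<tau>'\<close> by (meson rtrancl_into_trancl1 subsetD)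
    then show False using spanning_trees_acyclic[OF \<tau>'] by blast
  next
    assume "(y, x') \<in> \<sigma>\<^sup>*"
    then have "(y, y) \<in> \<tau>\<^sup>+" using sub \<open>(x', y) \<in> \<tau>\<close> by (meson rtrancl_into_trancl1 subsetD)
    then show False using spanning_trees_acyclic[OF \<tau>] by blast
  qed
qed

text \<open>The inverse deletes the pair \<open>(x, y)\<close> of the cycle, the cycle edge leaving
  \<open>y\<close>, and \<open>x\<close> becomes the root. Several pairs may end in
  \<open>y\<close>, so injectivity requires that only one of them gives a tree.\<close>

lemma bij_betw_unicyclic_in:
  assumes y: "y \<in> R"
  shows "bij_betw (\<lambda>(x, \<tau>). insert (x, y) \<tau>) (SIGMA x:{x \<in> R. (x, y) \<in> F}. spanning_trees F R x)
           (unicyclic F R y)"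
  unfolding bij_betw_def
proof (intro conjI inj_onI subset_antisym)
  fix p q
  assume p: "p \<in> (SIGMA x:{x \<in> R. (x, y) \<in> F}. spanning_trees F R x)"
    and q: "q \<in> (SIGMA x:{x \<in> R. (x, y) \<in> F}. spanning_trees F R x)"
    and eq: "(case p of (x, \<tau>) \<Rightarrow> insert (x, y) \<tau>) = (case q of (x, \<tau>) \<Rightarrow> insert (x, y) \<tau>)"
  obtain x \<tau> where p': "p = (x, \<tau>)" by (cases p)
  obtain x' \<tau>' where q': "q = (x', \<tau>')" by (cases q)
  have \<tau>: "\<tau> \<in> spanning_trees F R x" "\<tau>' \<in> spanning_trees F R x'" using p q p' q' by auto
  have eq': "insert (x, y) \<tau> = insert (x', y) \<tau>'" using eq p' q' by simp
  have xx: "x = x'" by (rule spanning_trees_exchange_unique[OF \<tau> y eq'])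
  have "(x, y) \<notin> \<tau>" "(x, y) \<notin> \<tau>'"
    using spanning_treesD(4)[OF \<tau>(1)] spanning_treesD(4)[OF \<tau>(2)] xx by simp_all
  from insert_ident[OF this] have "\<tau> = \<tau>'" using eq' xx by simp
  with xx p' q' show "p = q" by simp
next
  show "(\<lambda>(x, \<tau>). insert (x, y) \<tau>) ` (SIGMA x:{x \<in> R. (x, y) \<in> F}. spanning_trees F R x) \<subseteq> unicyclic F R y"
  proof clarify
    fix x \<tau> assume x: "x \<in> R" "(x, y) \<in> F" and \<tau>: "\<tau> \<in> spanning_trees F R x"
    show "insert (x, y) \<tau> \<in> unicyclic F R y"
    proof (rule insert_root_edge_unicyclic[OF \<tau> x(2) y])
      fix u assume "u \<in> R"
      have "(u, x) \<in> (insert (x, y) \<tau>)\<^sup>*"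
        by (rule subsetD[OF rtrancl_mono[OF subset_insertI] spanning_treesD(6)[OF \<tau> \<open>u \<in> R\<close>]])
      then show "(u, y) \<in> (insert (x, y) \<tau>)\<^sup>*" by (rule rtrancl_into_rtrancl) simp
    qed
  qed
next
  show "unicyclic F R y \<subseteq> (\<lambda>(x, \<tau>). insert (x, y) \<tau>) ` (SIGMA x:{x \<in> R. (x, y) \<in> F}. spanning_trees F R x)"
  proof
    fix U assume "U \<in> unicyclic F R y"
    then have U: "U \<subseteq> F" "U \<subseteq> R \<times> R" "\<And>x. x \<in> R \<Longrightarrow> \<exists>!z. (x, z) \<in> U" "\<And>x. x \<in> R \<Longrightarrow> (x, y) \<in> U\<^sup>*"
      by (auto simp: unicyclic_def)
    obtain z where z: "(y, z) \<in> U" using U(3)[OF y] by blast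
    moreover have "z \<in> R" using U(2) z by auto
    ultimately have "(y, y) \<in> U\<^sup>+" using U(4)[of z] by (intro rtrancl_into_trancl2)
    from last_before_return[OF this] obtain x where x: "(y, x) \<in> {(u, v) \<in> U. v \<noteq> y}\<^sup>*" "(x, y) \<in> U"
      by blast
    define \<tau> where "\<tau> = U - {(x, y)}"
    \<comment> \<open>This part of the cycle has no pair ending in \<open>y\<close>, so it survives
      the deletion and leads all nodes on from \<open>y\<close> to \<open>x\<close>.\<close>
    have yx: "(y, x) \<in> \<tau>\<^sup>*"
      by (rule subsetD[OF rtrancl_mono x(1)]) (auto simp: \<tau>_def)
    have "(u, x) \<in> \<tau>\<^sup>*" if "(u, y) \<in> U\<^sup>*" for u
      using that
    proof (induction rule: converse_rtrancl_induct)
      case base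
      then show ?case by (rule yx)
    next
      case (step u v)
      show ?case
      proof (cases "(u, v) = (x, y)")
        case False
        then have "(u, v) \<in> \<tau>" using step by (auto simp: \<tau>_def)
        then show ?thesis using step by simp
      qed simp
    qed
    note conn = this
    have uniq: "\<exists>!v. (u, v) \<in> \<tau>" if "u \<in> R" "u \<noteq> x" for u
    proof -
      have "(u, v) \<in> \<tau> \<longleftrightarrow> (u, v) \<in> U" for v using that(2) by (simp add: \<tau>_def)
      then show ?thesis using U(3)[OF that(1)] by simp
    qed
    have xR: "x \<in> R" using U(2) x(2) by auto
    have "\<tau> \<in> spanning_trees F R x"
    proof (rule spanning_treesI)
      show "\<tau> \<subseteq> F" "\<tau> \<subseteq> R \<times> R" using U(1,2) by (auto simp: \<tau>_def)
      show "(x, v) \<notin> \<tau>" for v using U(3)[OF xR] x(2) by (auto simp: \<tau>_def)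
      show "\<exists>!v. (u, v) \<in> \<tau>" if "u \<in> R" "u \<noteq> x" for u by (rule uniq[OF that])
      show "(u, x) \<in> \<tau>\<^sup>*" if "u \<in> R" for u by (rule conn[OF U(4)[OF that]])
    qed (rule xR)
    moreover have "U = insert (x, y) \<tau>" using x(2) by (auto simp: \<tau>_def)
    ultimately show "U \<in> (\<lambda>(x, \<tau>). insert (x, y) \<tau>) ` (SIGMA x:{x \<in> R. (x, y) \<in> F}. spanning_trees F R x)"
      using U(1) x(2) xR by (intro image_eqI[of _ _ "(x, \<tau>)"]) auto
  qed
qed

lemma finite_spanning_trees:
  assumes "finite R"
  shows "finite (spanning_trees F R i)"
  by (rule finite_subset[of _ "Pow (R \<times> R)"]) (use assms in \<open>auto simp: spanning_trees_def\<close>)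

lemma markov_chain_tree_theorem:
  assumes fin: "finite R" and y: "y \<in> R"
  shows "tree_weight G F R y * (\<Sum>z | z \<in> R \<and> (y, z) \<in> F. weight G y z) =
           (\<Sum>x | x \<in> R \<and> (x, y) \<in> F. tree_weight G F R x * weight G x y)"
proof -
  let ?w = "\<lambda>U. \<Prod>(x, y)\<in>U. weight G x y"
  have ins: "?w (insert (x, z) \<tau>) = weight G x z * ?w \<tau>" if \<tau>: "\<tau> \<in> spanning_trees F R x" for x z \<tau>
  proof -
    have "finite \<tau>" using spanning_treesD(2)[OF \<tau>] fin by (meson finite_SigmaI finite_subset)
    moreover have "(x, z) \<notin> \<tau>" using spanning_treesD(4)[OF \<tau>] .
    ultimately show ?thesis by simp
  qed
  note ft = finite_spanning_trees[OF fin]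
  have "(\<Sum>U\<in>unicyclic F R y. ?w U) =
      (\<Sum>(z, \<tau>)\<in>{z \<in> R. (y, z) \<in> F} \<times> spanning_trees F R y. ?w (insert (y, z) \<tau>))"
    by (subst sum.reindex_bij_betw[OF bij_betw_unicyclic_out[OF y], symmetric]) (simp add: case_prod_unfold)
  also have "\<dots> = (\<Sum>(z, \<tau>)\<in>{z \<in> R. (y, z) \<in> F} \<times> spanning_trees F R y. weight G y z * ?w \<tau>)"
    by (intro sum.cong) (auto simp: ins)
  also have "\<dots> = tree_weight G F R y * (\<Sum>z | z \<in> R \<and> (y, z) \<in> F. weight G y z)"
    unfolding tree_weight_def sum_product
    by (subst sum.swap) (simp add: sum.cartesian_product mult.commute)
  finally have 1: "(\<Sum>U\<in>unicyclic F R y. ?w U) = tree_weight G F R y * (\<Sum>z | z \<in> R \<and> (y, z) \<in> F. weight G y z)" .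
  have "(\<Sum>U\<in>unicyclic F R y. ?w U) =
      (\<Sum>(x, \<tau>)\<in>(SIGMA x:{x \<in> R. (x, y) \<in> F}. spanning_trees F R x). ?w (insert (x, y) \<tau>))"
    by (subst sum.reindex_bij_betw[OF bij_betw_unicyclic_in[OF y], symmetric]) (simp add: case_prod_unfold)
  also have "\<dots> = (\<Sum>(x, \<tau>)\<in>(SIGMA x:{x \<in> R. (x, y) \<in> F}. spanning_trees F R x). weight G x y * ?w \<tau>)"
    by (intro sum.cong) (auto simp: ins)
  also have "\<dots> = (\<Sum>x | x \<in> R \<and> (x, y) \<in> F. \<Sum>\<tau>\<in>spanning_trees F R x. weight G x y * ?w \<tau>)"
    using fin ft by (subst sum.Sigma) auto
  also have "\<dots> = (\<Sum>x | x \<in> R \<and> (x, y) \<in> F. tree_weight G F R x * weight G x y)"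
    unfolding tree_weight_def sum_distrib_right by (simp add: mult.commute)
  finally show ?thesis using 1 by simp
qed

text \<open>A breadth-first tree: every node chooses a predecessor that is closer to the root.\<close>

lemma spanning_trees_nonempty:
  assumes i: "i \<in> R" and R: "\<And>x. x \<in> R \<Longrightarrow> (x, i) \<in> F\<^sup>*"
    and closed: "\<And>x y. x \<in> R \<Longrightarrow> (x, y) \<in> F \<Longrightarrow> (y, i) \<in> F\<^sup>* \<Longrightarrow> y \<in> R"
  shows "spanning_trees F R i \<noteq> {}"
proof -
  define d where "d x = (LEAST n. (x, i) \<in> F ^^ n)" for x
  have d: "(x, i) \<in> F ^^ d x" if "(x, i) \<in> F\<^sup>*" for x
    unfolding d_def using rtrancl_imp_relpow[OF that] by (metis LeastI)
  have "\<exists>y. (x, y) \<in> F \<and> y \<in> R \<and> d y < d x" if x: "x \<in> R" "x \<noteq> i" for x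
  proof -
    have dx: "(x, i) \<in> F ^^ d x" by (rule d[OF R[OF x(1)]])
    then obtain n where n: "d x = Suc n" using x(2) by (cases "d x") auto
    with dx obtain y where y: "(x, y) \<in> F" "(y, i) \<in> F ^^ n" by (metis relpow_Suc_D2)
    then have "d y \<le> n" by (simp add: d_def Least_le)
    moreover have "y \<in> R" using closed[OF x(1) y(1)] relpow_imp_rtrancl[OF y(2)] by blast
    ultimately show ?thesis using n y by auto
  qed
  then obtain p where p: "\<And>x. x \<in> R \<Longrightarrow> x \<noteq> i \<Longrightarrow> (x, p x) \<in> F \<and> p x \<in> R \<and> d (p x) < d x"
    by metis
  define \<tau> where "\<tau> = {(x, p x) |x. x \<in> R \<and> x \<noteq> i}"
  have "(x, i) \<in> \<tau>\<^sup>*" if "x \<in> R" for x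
    using that
  proof (induction "d x" arbitrary: x rule: less_induct)
    case less
    show ?case
    proof (cases "x = i")
      case False
      then have "(x, p x) \<in> \<tau>" using less.prems by (auto simp: \<tau>_def)
      then show ?thesis
        using less.hyps[of "p x"] p[OF less.prems False] by (meson converse_rtrancl_into_rtrancl)
    qed simp
  qed
  then have "\<tau> \<in> spanning_trees F R i"
    using i p by (auto simp: spanning_trees_def \<tau>_def)
  then show ?thesis by blast
qed

section \<open>Tree weights as left kernel vectors\<close>

context clustered_digraph
begin

lemma tree_weight_nonneg: "tree_weight G F R i \<ge> 0"
proof -
  have "(\<Prod>(x, y)\<in>\<tau>. a x y) \<ge> 0" if "\<tau> \<in> spanning_trees F R i" for \<tau>
    using spanning_treesD(1)[OF that] F_V weight_nonneg by (intro prod_nonneg) auto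
  then show ?thesis by (simp add: tree_weight_def sum_nonneg)
qed

text \<open>A tree that spans \<open>R\<close> makes all of \<open>R\<close> reachable from its root
  \<open>i\<close>, so \<open>reach i = R\<close> by maximality.\<close>

lemma tree_weight_neq_0:
  assumes "R \<in> Rs" "tree_weight G F R i \<noteq> 0"
  shows "i \<in> exclusive_part V F R"
proof -
  have "spanning_trees F R i \<noteq> {}"
    using assms(2) by (auto simp: tree_weight_def)
  then obtain \<tau> where \<tau>: "\<tau> \<in> spanning_trees F R i" by blast
  have i: "i \<in> V" using spanning_treesD(3)[OF \<tau>] reach_subset[OF assms(1)] by blast
  have "R \<subseteq> reach i"
    using spanning_treesD(6)[OF \<tau>] rtrancl_mono[OF spanning_treesD(1)[OF \<tau>]] reach_subset[OF assms(1)]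
    by (auto simp: reachable_set_def)
  then show ?thesis using in_exclusive_part reaches_maximal assms(1) i by metis
qed

lemma tree_weight_root_pos:
  assumes R: "R \<in> Rs"
  shows "tree_weight G F R (root R) > 0"
proof -
  have "spanning_trees F R (root R) \<noteq> {}"
  proof (rule spanning_trees_nonempty)
    fix x y assume "x \<in> R" "(x, y) \<in> F" "(y, root R) \<in> F\<^sup>*"
    then have "y \<in> reach (root R)" using pred_in_V[of x y] by (simp add: reachable_set_def)
    then show "y \<in> R" by (simp only: root(2)[OF R])
  qed (rule root_in[OF R] reach_root_path[OF R], assumption?)+
  moreover have "(\<Prod>(x, y)\<in>\<tau>. a x y) > 0" if "\<tau> \<in> spanning_trees F R (root R)" for \<tau>
  proof (rule prod_pos)
    fix e assume e: "e \<in> \<tau>"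
    obtain x y where xy: "e = (x, y)" by (cases e)
    have "(x, y) \<in> edges G" "x \<in> V" "y \<in> V"
      using e xy spanning_treesD(1)[OF that] F_subset F_V by blast+
    then show "(case e of (x, y) \<Rightarrow> a x y) > 0" using weight_pos_iff[of x y] xy by simp
  qed
  moreover have "finite R" using reach_subset[OF R] finV by (rule finite_subset)
  ultimately show ?thesis
    unfolding tree_weight_def by (intro sum_pos finite_spanning_trees)
qed

abbreviation "\<theta> \<equiv> left_kernel_vector G F"

lemma tree_weight_sum_pos:
  assumes R: "R \<in> Rs"
  shows "(\<Sum>j\<in>V. tree_weight G F R j * m j) > 0"
proof (rule sum_pos2[OF finV])
  show "root R \<in> V" using root R by blast
  then show "0 < tree_weight G F R (root R) * m (root R)"
    using tree_weight_root_pos[OF R] mass_pos by simp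
  show "0 \<le> tree_weight G F R i * m i" if "i \<in> V" for i
    using tree_weight_nonneg[of R i] mass_pos[OF that] by simp
qed

lemma left_kernel_neq_0: "R \<in> Rs \<Longrightarrow> \<theta> R x \<noteq> 0 \<Longrightarrow> x \<in> exclusive_part V F R"
  using tree_weight_neq_0 by (auto simp: left_kernel_vector_def)

lemma left_kernel_sum: "R \<in> Rs \<Longrightarrow> (\<Sum>j\<in>V. \<theta> R j * m j) = 1"
proof -
  assume R: "R \<in> Rs"
  define Z where "Z = (\<Sum>j\<in>V. tree_weight G F R j * m j)"
  have "\<theta> R j * m j = tree_weight G F R j * m j / Z" for j
    by (simp add: left_kernel_vector_def Z_def)
  then have "(\<Sum>j\<in>V. \<theta> R j * m j) = (\<Sum>j\<in>V. tree_weight G F R j * m j) / Z"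
    by (simp only: sum_divide_distrib)
  then show ?thesis using tree_weight_sum_pos[OF R] by (simp add: Z_def)
qed

text \<open>The tree theorem sums over \<open>R\<close> only. The extension to \<open>V\<close>
  works because the tree weights live on the exclusive part, which no cluster edge enters from
  outside.\<close>

lemma tree_weight_balance:
  assumes R: "R \<in> Rs" and y: "y \<in> V"
  shows "tree_weight G F R y * (\<Sum>z\<in>V. aF y z) = (\<Sum>x\<in>V. tree_weight G F R x * aF x y)"
proof (cases "y \<in> R")
  case True
  have sub: "R \<subseteq> V" by (rule reach_subset[OF R])
  have finR: "finite R" using sub finV by (rule finite_subset)
  have "tree_weight G F R y * (\<Sum>z\<in>V. aF y z) =
      tree_weight G F R y * (\<Sum>z | z \<in> R \<and> (y, z) \<in> F. a y z)"
  proof (cases "tree_weight G F R y = 0")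
    case False
    then have "y \<in> exclusive_part V F R" by (rule tree_weight_neq_0[OF R])
    then have "z \<in> R" if "(y, z) \<in> F" for z
      using pred_closed_exclusive[OF R] exclusive_subset that by (auto simp: pred_closed_def)
    then have "(\<Sum>z\<in>V. aF y z) = (\<Sum>z | z \<in> R \<and> (y, z) \<in> F. a y z)"
      using sub by (intro sum.mono_neutral_cong_right) (auto simp: edge_restrict_def)
    then show ?thesis by simp
  qed simp
  also have "\<dots> = (\<Sum>x | x \<in> R \<and> (x, y) \<in> F. tree_weight G F R x * a x y)"
    by (rule markov_chain_tree_theorem[OF finR True])
  also have "\<dots> = (\<Sum>x\<in>V. tree_weight G F R x * aF x y)"
    using sub tree_weight_neq_0[OF R] exclusive_subset
    by (intro sum.mono_neutral_cong_left) (auto simp: edge_restrict_def)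
  finally show ?thesis .
next
  case False
  have "tree_weight G F R x * aF x y = 0" for x
  proof (rule ccontr)
    assume "tree_weight G F R x * aF x y \<noteq> 0"
    then have "x \<in> exclusive_part V F R" "(x, y) \<in> F"
      using tree_weight_neq_0[OF R] aF_not_edge by auto
    then have "y \<in> R" using pred_closed_exclusive[OF R] exclusive_subset by (auto simp: pred_closed_def)
    then show False using False by simp
  qed
  moreover have "tree_weight G F R y = 0"
    using tree_weight_neq_0[OF R, of y] exclusive_subset False by blast
  ultimately show ?thesis by (simp only: sum.neutral_const mult_zero_left)
qed

text \<open>The mass in the pairing cancels the division by the mass in \<open>A\<close>; after an
  exchange of the sums, the balance of the tree weights remains.\<close>

lemma left_kernel_A:
  assumes R: "R \<in> Rs"
  shows "(\<Sum>x\<in>V. of_real (\<theta> R x) * A f x * of_real (m x)) = 0"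
proof -
  have bal: "\<theta> R y * (\<Sum>z\<in>V. aF y z) = (\<Sum>x\<in>V. \<theta> R x * aF x y)" if "y \<in> V" for y
  proof -
    define Z where "Z = (\<Sum>j\<in>V. tree_weight G F R j * m j)"
    have \<theta>: "\<theta> R x = tree_weight G F R x / Z" for x
      by (simp add: left_kernel_vector_def Z_def)
    have "\<theta> R y * (\<Sum>z\<in>V. aF y z) = (\<Sum>x\<in>V. tree_weight G F R x * aF x y) / Z"
      using tree_weight_balance[OF R that] by (simp add: \<theta>)
    then show ?thesis by (simp add: \<theta> sum_divide_distrib)
  qed
  have "(\<Sum>x\<in>V. of_real (\<theta> R x) * A f x * of_real (m x)) =
      (\<Sum>x\<in>V. of_real (\<theta> R x * (\<Sum>y\<in>V. aF x y)) * f x - (\<Sum>y\<in>V. of_real (\<theta> R x * aF x y) * f y))"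
  proof (rule sum.cong[OF refl])
    fix x assume x: "x \<in> V"
    have "A f x * of_real (m x) = (\<Sum>y\<in>V. of_real (aF x y) * (f x - f y))"
      using x mass_pos[OF x] by (simp add: A_apply)
    then show "of_real (\<theta> R x) * A f x * of_real (m x) =
        of_real (\<theta> R x * (\<Sum>y\<in>V. aF x y)) * f x - (\<Sum>y\<in>V. of_real (\<theta> R x * aF x y) * f y)"
      by (simp add: mult.assoc right_diff_distrib sum_subtractf sum_distrib_left sum_distrib_right)
  qed
  also have "\<dots> = (\<Sum>x\<in>V. of_real (\<theta> R x * (\<Sum>y\<in>V. aF x y)) * f x) -
      (\<Sum>x\<in>V. \<Sum>y\<in>V. of_real (\<theta> R x * aF x y) * f y)"
    by (rule sum_subtractf)
  also have "(\<Sum>x\<in>V. \<Sum>y\<in>V. of_real (\<theta> R x * aF x y) * f y) =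
      (\<Sum>y\<in>V. \<Sum>x\<in>V. of_real (\<theta> R x * aF x y) * f y)"
    by (rule sum.swap)
  also have "\<dots> = (\<Sum>y\<in>V. of_real (\<theta> R y * (\<Sum>z\<in>V. aF y z)) * f y)"
    by (rule sum.cong[OF refl]) (simp only: bal of_real_sum sum_distrib_right)
  finally show ?thesis by simp
qed

end

section \<open>The projection onto the kernel\<close>

context clustered_digraph
begin

text \<open>On a reach this is the value of \<open>J_down\<close>, and it is the coefficient of
  \<open>\<gamma> R\<close> in the projection.\<close>

definition coef :: "'a set \<Rightarrow> ('a \<Rightarrow> complex) \<Rightarrow> complex" where
  "coef R f = (\<Sum>x\<in>V. of_real (\<theta> R x) * f x * of_real (m x))"

definition proj :: "('a \<Rightarrow> complex) \<Rightarrow> 'a \<Rightarrow> complex" where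
  "proj f x = (\<Sum>R\<in>Rs. coef R f * \<gamma> R x)"

lemma coef_cong: "(\<And>x. x \<in> V \<Longrightarrow> f x = g x) \<Longrightarrow> coef R f = coef R g"
  unfolding coef_def by (intro sum.cong) auto

lemma coef_diff: "coef R (\<lambda>x. f x - g x) = coef R f - coef R g"
  by (simp add: coef_def algebra_simps sum_subtractf)

lemma coef_cmult: "coef R (\<lambda>x. c * f x) = c * coef R f"
  by (simp add: coef_def sum_distrib_left mult_ac)

lemma coef_sum: "coef R (\<lambda>x. \<Sum>i\<in>I. c i * f i x) = (\<Sum>i\<in>I. c i * coef R (f i))"
proof -
  have "coef R (\<lambda>x. \<Sum>i\<in>I. c i * f i x) =
      (\<Sum>x\<in>V. \<Sum>i\<in>I. c i * (of_real (\<theta> R x) * f i x * of_real (m x)))"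
    unfolding coef_def by (simp add: sum_distrib_left sum_distrib_right mult_ac)
  also have "\<dots> = (\<Sum>i\<in>I. \<Sum>x\<in>V. c i * (of_real (\<theta> R x) * f i x * of_real (m x)))"
    by (rule sum.swap)
  finally show ?thesis by (simp add: coef_def sum_distrib_left)
qed

lemma coef_A: "R \<in> Rs \<Longrightarrow> coef R (A f) = 0"
  unfolding coef_def by (rule left_kernel_A)

text \<open>The numbers \<open>\<theta> R x * m x\<close> sum to 1 and vanish off the exclusive
  part, so \<open>coef R\<close> is an average over that part. Biorthogonality with the kernel
  vectors follows.\<close>

lemma coef_locally_const:
  assumes R: "R \<in> Rs" and f: "\<And>x. x \<in> exclusive_part V F R \<Longrightarrow> f x = c"
  shows "coef R f = c"
proof -
  have "of_real (\<theta> R x) * f x * of_real (m x) = c * of_real (\<theta> R x * m x)" for x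
    using left_kernel_neq_0[OF R, of x] f[of x] by (cases "\<theta> R x = 0") auto
  then have "coef R f = c * of_real (\<Sum>x\<in>V. \<theta> R x * m x)"
    by (simp only: coef_def sum_distrib_left of_real_sum)
  then show ?thesis using left_kernel_sum[OF R] by simp
qed

lemma coef_kernel_vector:
  assumes "R \<in> Rs" "S \<in> Rs"
  shows "coef R (\<gamma> S) = (if R = S then 1 else 0)"
  using kernel_vector(4)[OF assms(2,1)] by (intro coef_locally_const[OF assms(1)]) auto

lemma proj_in_fvec [simp]: "proj f \<in> fvec V"
  using kernel_vector(1) by (auto simp: fvec_def proj_def intro!: sum.neutral)

lemma A_in_fvec [simp]: "A f \<in> fvec V"
  unfolding A_eq by simp

lemma coef_proj: "R \<in> Rs \<Longrightarrow> coef R (proj f) = coef R f"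
proof -
  assume R: "R \<in> Rs"
  have "coef R (proj f) = (\<Sum>S\<in>Rs. coef S f * coef R (\<gamma> S))"
    unfolding proj_def by (rule coef_sum)
  also have "\<dots> = (\<Sum>S\<in>Rs. if S = R then coef S f else 0)"
    using R by (intro sum.cong) (auto simp: coef_kernel_vector)
  also have "\<dots> = coef R f"
    using R by simp
  finally show ?thesis .
qed

lemma A_proj: "A (proj f) x = 0"
proof -
  have "A (proj f) x = (\<Sum>R\<in>Rs. coef R f * A (\<gamma> R) x)"
    unfolding proj_def A_eq by (rule matop_sum)
  then show ?thesis using kernel_vector(2) by simp
qed

lemma proj_eq_0: "(\<And>R. R \<in> Rs \<Longrightarrow> coef R f = 0) \<Longrightarrow> proj f x = 0"
  by (simp add: proj_def)

text \<open>On the kernel \<open>coef R\<close> is evaluation at the root of \<open>R\<close>.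
  Together with \<open>coef_A\<close> this shows that kernel and range of \<open>A\<close> meet only
  in 0, so a pole of the resolvent at 0 is simple.\<close>

lemma kernel_coef_0:
  assumes f: "f \<in> fvec V" "\<And>x. x \<in> V \<Longrightarrow> A f x = 0" "\<And>R. R \<in> Rs \<Longrightarrow> coef R f = 0"
  shows "f x = 0"
proof (rule kernel_unique[OF f(1,2)])
  fix R assume R: "R \<in> Rs"
  have "coef R f = coef R (\<lambda>x. \<Sum>S\<in>Rs. f (root S) * \<gamma> S x)"
    using kernel_expand[OF f(1,2)] by (intro coef_cong)
  also have "\<dots> = (\<Sum>S\<in>Rs. if S = R then f (root S) else 0)"
    unfolding coef_sum using R by (intro sum.cong) (auto simp: coef_kernel_vector)
  also have "\<dots> = f (root R)"
    using R by simp
  finally show "f (root R) = 0" using f(3)[OF R] by simp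
qed

text \<open>
  The operator \<open>\<zeta> - A - c P\<close> agrees with \<open>\<zeta> - A\<close> on the kernel of the projection \<open>P\<close>, and
  unlike \<open>\<zeta> - A\<close> it is invertible at \<open>\<zeta> = 0\<close>.
\<close>

definition shift_matrix :: "complex \<Rightarrow> complex \<Rightarrow> 'a \<Rightarrow> 'a \<Rightarrow> complex" where
  "shift_matrix \<zeta> c x y = \<zeta> * unit_vec x y - lap_matrix (edge_restrict G F) x y -
     c * (\<Sum>R\<in>Rs. of_real (\<theta> R y) * of_real (m y) * \<gamma> R x)"

abbreviation "shifted \<zeta> c \<equiv> matop V (shift_matrix \<zeta> c)"

lemma shifted_apply:
  assumes "x \<in> V"
  shows "shifted \<zeta> c f x = \<zeta> * f x - A f x - c * proj f x"
proof -
  have 1: "(\<Sum>y\<in>V. unit_vec x y * f y) = f x"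
    using unit_vec_sum[OF finV assms, of f] by (simp add: mult.commute unit_vec_commute)
  have 2: "proj f x = (\<Sum>y\<in>V. (\<Sum>R\<in>Rs. of_real (\<theta> R y) * of_real (m y) * \<gamma> R x) * f y)"
    unfolding proj_def coef_def sum_distrib_right by (subst sum.swap) (simp add: mult_ac)
  have 3: "A f x = (\<Sum>y\<in>V. lap_matrix (edge_restrict G F) x y * f y)"
    unfolding A_eq matop_def using assms by simp
  have "shifted \<zeta> c f x = (\<Sum>y\<in>V. \<zeta> * (unit_vec x y * f y) - lap_matrix (edge_restrict G F) x y * f y -
      c * ((\<Sum>R\<in>Rs. of_real (\<theta> R y) * of_real (m y) * \<gamma> R x) * f y))"
    using assms by (simp add: matop_def shift_matrix_def left_diff_distrib mult.assoc)
  then show ?thesis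
    by (simp only: sum_subtractf 1 2 3 flip: sum_distrib_left)
qed

text \<open>The left kernel vectors annihilate \<open>A\<close> and are fixed by the projection, so
  they are left eigenvectors of the shifted operator.\<close>

lemma coef_shifted: "R \<in> Rs \<Longrightarrow> coef R (shifted \<zeta> c f) = (\<zeta> - c) * coef R f"
proof -
  assume R: "R \<in> Rs"
  have "coef R (shifted \<zeta> c f) = coef R (\<lambda>x. \<zeta> * f x - A f x - c * proj f x)"
    by (intro coef_cong shifted_apply)
  then show ?thesis
    using R by (simp add: coef_diff coef_cmult coef_A coef_proj left_diff_distrib)
qed

text \<open>If \<open>\<zeta> \<noteq> c\<close>, a vector in the kernel of the shifted operator has
  vanishing coefficients, so the projection term drops out and only \<open>\<zeta> - A\<close> has
  to be injective on such vectors.\<close>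

lemma shifted_inverse:
  assumes "\<zeta> \<noteq> c"
    and inj: "\<And>f. f \<in> fvec V \<Longrightarrow> (\<And>x. x \<in> V \<Longrightarrow> \<zeta> * f x = A f x) \<Longrightarrow>
       (\<And>R. R \<in> Rs \<Longrightarrow> coef R f = 0) \<Longrightarrow> \<forall>x. f x = 0"
  obtains N where "\<And>f. f \<in> fvec V \<Longrightarrow> shifted \<zeta> c (matop V N f) = f"
    "\<And>f. f \<in> fvec V \<Longrightarrow> matop V N (shifted \<zeta> c f) = f"
proof (rule matop_inverse[of V "shift_matrix \<zeta> c"])
  fix f assume f: "f \<in> fvec V" "\<And>x. x \<in> V \<Longrightarrow> shifted \<zeta> c f x = 0"
  have coef: "coef R f = 0" if "R \<in> Rs" for R
  proof -
    have "coef R (shifted \<zeta> c f) = coef R (\<lambda>x. 0)"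
      by (rule coef_cong) (rule f(2))
    then show ?thesis using assms(1) coef_shifted[OF that] by (simp add: coef_def)
  qed
  show "\<forall>x. f x = 0"
  proof (rule inj[OF f(1) _ coef])
    show "\<zeta> * f x = A f x" if "x \<in> V" for x
      using f(2)[OF that] shifted_apply[OF that] proj_eq_0[OF coef] by simp
  qed
qed (use that in auto)

text \<open>The operator \<open>- A - P\<close> is invertible and respects the coefficients up to
  sign, so the solution \<open>h\<close> for the right-hand side \<open>f\<close> has
  \<open>P h = 0\<close>; the preimage under \<open>A\<close> is then \<open>- h\<close>.\<close>

lemma range_A:
  assumes f: "f \<in> fvec V" "\<And>R. R \<in> Rs \<Longrightarrow> coef R f = 0"
  obtains h where "h \<in> fvec V" "A h = f"
proof -
  obtain N where N: "\<And>f. f \<in> fvec V \<Longrightarrow> shifted 0 1 (matop V N f) = f"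
  proof (rule shifted_inverse[of 0 1])
    fix f assume "f \<in> fvec V" "\<And>x. x \<in> V \<Longrightarrow> 0 * f x = A f x" "\<And>R. R \<in> Rs \<Longrightarrow> coef R f = 0"
    then show "\<forall>x. f x = 0" using kernel_coef_0[of f] by auto
  qed auto
  define h where "h = matop V N f"
  have h: "shifted 0 1 h = f" using N[OF f(1)] by (simp add: h_def)
  have coef: "coef R h = 0" if "R \<in> Rs" for R
    using coef_shifted[OF that, of 0 1 h] f(2)[OF that] h by simp
  have hV: "h \<in> fvec V" by (simp add: h_def)
  have "A (\<lambda>x. - h x) x = f x" for x
  proof (cases "x \<in> V")
    case True
    have "A (\<lambda>x. (- 1) * h x) x = (- 1) * A h x"
      unfolding A_eq by (rule matop_cmult)
    moreover have "f x = - A h x"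
      using shifted_apply[OF True, of 0 1 h] proj_eq_0[OF coef] h by simp
    ultimately show ?thesis by simp
  next
    case False
    then show ?thesis using f(1) A_in_fvec by (simp add: fvec_def)
  qed
  moreover have "(\<lambda>x. - h x) \<in> fvec V" using hV by (simp add: fvec_def)
  ultimately show thesis using that by blast
qed

section \<open>The Riesz projection\<close>

lemma ell2_eq_fvec: "ell2 G = fvec V"
  by (simp add: ell2_def fvec_def)

lemma not_in_spectrum:
  assumes inj: "\<And>f. f \<in> fvec V \<Longrightarrow> (\<And>x. x \<in> V \<Longrightarrow> \<zeta> * f x = A f x) \<Longrightarrow> \<forall>x. f x = 0"
  shows "\<zeta> \<notin> op_spectrum G A"
proof -
  let ?T = "\<lambda>f x. \<zeta> * f x - A f x"
  have T: "?T f = shifted \<zeta> 0 f" if "f \<in> fvec V" for f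
  proof
    fix x show "?T f x = shifted \<zeta> 0 f x"
    proof (cases "x \<in> V")
      case True
      then show ?thesis by (simp add: shifted_apply)
    next
      case False
      then show ?thesis using that A_in_fvec[of f] by (simp add: fvec_def matop_def)
    qed
  qed
  obtain N where N: "\<And>f. f \<in> fvec V \<Longrightarrow> shifted \<zeta> 0 (matop V N f) = f"
    "\<And>f. f \<in> fvec V \<Longrightarrow> matop V N (shifted \<zeta> 0 f) = f"
  proof (rule matop_inverse[of V "shift_matrix \<zeta> 0"])
    fix f assume f: "f \<in> fvec V" "\<And>x. x \<in> V \<Longrightarrow> shifted \<zeta> 0 f x = 0"
    show "\<forall>x. f x = 0"
      by (rule inj[OF f(1)]) (use f(2) shifted_apply in simp)
  qed auto
  have "bij_betw ?T (fvec V) (fvec V)"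
  proof (rule bij_betw_byWitness[of _ "matop V N"])
    show "\<forall>f\<in>fvec V. matop V N (?T f) = f" using N(2) T by simp
    show "\<forall>f\<in>fvec V. ?T (matop V N f) = f" using N(1) T[OF matop_in_fvec] by simp
    show "?T ` fvec V \<subseteq> fvec V" using T by auto
  qed auto
  then show ?thesis by (simp add: op_spectrum_def ell2_eq_fvec)
qed

lemma fvec_eq_0_if_contracting:
  assumes f: "f \<in> fvec V" and k: "k < 1"
    and contr: "\<And>C x. C \<ge> 0 \<Longrightarrow> (\<And>y. y \<in> V \<Longrightarrow> norm (f y) \<le> C) \<Longrightarrow> x \<in> V \<Longrightarrow> norm (f x) \<le> k * C"
  shows "\<forall>x. f x = 0"
proof -
  have "f x = 0" if x: "x \<in> V" for x
  proof -
    define C where "C = Max ((\<lambda>y. norm (f y)) ` V)"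
    have le: "norm (f y) \<le> C" if "y \<in> V" for y
      using that by (simp add: C_def)
    then have "C \<ge> 0" using x norm_ge_zero order_trans by blast
    have "C \<in> (\<lambda>y. norm (f y)) ` V"
      unfolding C_def using x by (intro Max_in) auto
    then obtain z where z: "z \<in> V" "norm (f z) = C" by auto
    have "C \<le> k * C" using contr[OF \<open>C \<ge> 0\<close> le z(1)] z(2) by simp
    then have "C \<le> 0" using k \<open>C \<ge> 0\<close> mult_less_cancel_right1[of k C] by auto
    then have "norm (f x) \<le> 0" using le[OF x] by linarith
    then show ?thesis by simp
  qed
  then show ?thesis using f by (auto simp: fvec_def)
qed

text \<open>The selected radius is meaningful once 0 is isolated in the spectrum. An eigenfunction
  for \<open>\<zeta> \<noteq> 0\<close> has vanishing coefficients, so it equals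
  \<open>- \<zeta>\<close> times its image under the inverse \<open>N\<close> of
  \<open>- A - P\<close>.\<close>

lemma riesz_radius: "riesz_radius G A > 0" "op_spectrum G A \<inter> cball 0 (riesz_radius G A) \<subseteq> {0}"
proof -
  obtain N where N: "\<And>f. f \<in> fvec V \<Longrightarrow> matop V N (shifted 0 1 f) = f"
  proof (rule shifted_inverse[of 0 1])
    fix f assume "f \<in> fvec V" "\<And>x. x \<in> V \<Longrightarrow> 0 * f x = A f x" "\<And>R. R \<in> Rs \<Longrightarrow> coef R f = 0"
    then show "\<forall>x. f x = 0" using kernel_coef_0[of f] by auto
  qed auto
  obtain K where K: "K > 0"
    "\<And>f C x. (\<And>y. y \<in> V \<Longrightarrow> norm (f y) \<le> C) \<Longrightarrow> C \<ge> 0 \<Longrightarrow> norm (matop V N f x) \<le> K * C"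
    using matop_bound[OF finV] by metis
  \<comment> \<open>For eigenvalues of modulus at most \<open>\<epsilon>\<close> the eigenfunction
    is then bounded by half its own maximum.\<close>
  define \<epsilon> where "\<epsilon> = 1 / (2 * K)"
  have eps: "\<epsilon> > 0" using K by (simp add: \<epsilon>_def)
  have "\<zeta> \<notin> op_spectrum G A" if z: "\<zeta> \<noteq> 0" "norm \<zeta> \<le> \<epsilon>" for \<zeta>
  proof (rule not_in_spectrum)
    fix f assume f: "f \<in> fvec V" "\<And>x. x \<in> V \<Longrightarrow> \<zeta> * f x = A f x"
    have coef: "coef R f = 0" if "R \<in> Rs" for R
    proof -
      have "\<zeta> * coef R f = coef R (A f)"
        unfolding coef_cmult[symmetric] by (rule coef_cong) (rule f(2))
      then show ?thesis using z(1) coef_A[OF that] by simp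
    qed
    have f_eq: "f = matop V N (\<lambda>x. - \<zeta> * f x)"
    proof -
      have "f = matop V N (shifted 0 1 f)" using N[OF f(1)] by simp
      also have "\<dots> = matop V N (\<lambda>x. - \<zeta> * f x)"
        using f(2) proj_eq_0[OF coef] by (intro matop_cong) (simp add: shifted_apply)
      finally show ?thesis .
    qed
    show "\<forall>x. f x = 0"
    proof (rule fvec_eq_0_if_contracting[OF f(1), of "1 / 2"])
      fix C x assume C: "(C::real) \<ge> 0" "\<And>y. y \<in> V \<Longrightarrow> norm (f y) \<le> C" "x \<in> V"
      have "norm (matop V N (\<lambda>x. - \<zeta> * f x) x) \<le> K * (\<epsilon> * C)"
        using C z(2) eps by (intro K(2)) (auto simp: norm_mult intro!: mult_mono)
      also have "K * (\<epsilon> * C) = 1 / 2 * C" using K by (simp add: \<epsilon>_def)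
      finally show "norm (f x) \<le> 1 / 2 * C" using f_eq by metis
    qed auto
  qed
  note out = this
  have "op_spectrum G A \<inter> cball 0 \<epsilon> \<subseteq> {0}"
  proof
    fix \<zeta> assume "\<zeta> \<in> op_spectrum G A \<inter> cball 0 \<epsilon>"
    then show "\<zeta> \<in> {0}" using out[of \<zeta>] by (cases "\<zeta> = 0") simp_all
  qed
  then have "\<exists>\<epsilon>. \<epsilon> > 0 \<and> op_spectrum G A \<inter> cball 0 \<epsilon> \<subseteq> {0}" using eps by blast
  from someI_ex[OF this] show "riesz_radius G A > 0"
    "op_spectrum G A \<inter> cball 0 (riesz_radius G A) \<subseteq> {0}"
    by (auto simp: riesz_radius_def)
qed

text \<open>The resolvent of \<open>f\<close> is \<open>P f / \<zeta>\<close> plus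
  \<open>q \<zeta>\<close>, the inverse of \<open>\<zeta> - A - c P\<close> applied to
  \<open>f - P f\<close>, which is holomorphic on the whole disc.\<close>

lemma riesz_projection_eq_proj:
  assumes f: "f \<in> fvec V"
  shows "riesz_projection G A f x = proj f x"
proof -
  define \<epsilon> where "\<epsilon> = riesz_radius G A"
  define D where "D = cball (0::complex) \<epsilon>"
  \<comment> \<open>A point outside the disc, so that \<open>\<zeta> \<noteq> c\<close> everywhere
    in it.\<close>
  define c where "c = complex_of_real (\<epsilon> + 1)"
  define b where "b = (\<lambda>x. f x - proj f x)"
  have eps: "\<epsilon> > 0" using riesz_radius(1) by (simp add: \<epsilon>_def)
  have b: "b \<in> fvec V" using f proj_in_fvec[of f] by (simp add: b_def fvec_def)
  have coef_b: "coef R b = 0" if "R \<in> Rs" for R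
    using that by (simp add: b_def coef_diff coef_proj)
  have ne_c: "\<zeta> \<noteq> c" if "\<zeta> \<in> D" for \<zeta>
    using that eps by (auto simp: D_def c_def simp del: of_real_add)
  have bij: "bij_betw (\<lambda>f x. \<zeta> * f x - A f x) (fvec V) (fvec V)" if "\<zeta> \<in> D" "\<zeta> \<noteq> 0" for \<zeta>
    using riesz_radius(2) that by (auto simp: D_def \<epsilon>_def op_spectrum_def ell2_eq_fvec)
  have "\<exists>N. \<forall>f\<in>fvec V. shifted \<zeta> c (matop V N f) = f \<and> matop V N (shifted \<zeta> c f) = f" if z: "\<zeta> \<in> D" for \<zeta>
  proof (rule shifted_inverse[OF ne_c[OF z]])
    fix h assume h: "h \<in> fvec V" "\<And>x. x \<in> V \<Longrightarrow> \<zeta> * h x = A h x" "\<And>R. R \<in> Rs \<Longrightarrow> coef R h = 0"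
    show "\<forall>x. h x = 0"
    proof (cases "\<zeta> = 0")
      case True
      then show ?thesis using kernel_coef_0[of h] h by auto
    next
      case False
      have "(\<lambda>x. \<zeta> * h x - A h x) = (\<lambda>x. \<zeta> * 0 - A (\<lambda>_. 0) x)"
        using h(1,2) A_in_fvec[of h] by (auto simp: fun_eq_iff fvec_def laplacian_def edge_restrict_def)
      from inj_onD[OF bij_betw_imp_inj_on[OF bij[OF z False]] this h(1)]
      show ?thesis by (simp add: fvec_def)
    qed
  qed blast
  then obtain N where N: "\<And>\<zeta> f. \<zeta> \<in> D \<Longrightarrow> f \<in> fvec V \<Longrightarrow> shifted \<zeta> c (matop V (N \<zeta>) f) = f"
    "\<And>\<zeta> f. \<zeta> \<in> D \<Longrightarrow> f \<in> fvec V \<Longrightarrow> matop V (N \<zeta>) (shifted \<zeta> c f) = f"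
    by metis
  define q where "q \<zeta> = matop V (N \<zeta>) b" for \<zeta>
  have q_fvec: "q \<zeta> \<in> fvec V" for \<zeta> by (simp add: q_def)
  have Nq: "shifted \<zeta> c (q \<zeta>) = b" if "\<zeta> \<in> D" for \<zeta>
    using N(1)[OF that b] by (simp add: q_def)
  have coef_q: "coef R (q \<zeta>) = 0" if "\<zeta> \<in> D" "R \<in> Rs" for \<zeta> R
    using coef_shifted[OF that(2), of \<zeta> c "q \<zeta>"] Nq[OF that(1)] coef_b[OF that(2)] ne_c[OF that(1)] by simp
  have q: "\<zeta> * q \<zeta> y - A (q \<zeta>) y = b y" if "\<zeta> \<in> D" "y \<in> V" for \<zeta> y
    using shifted_apply[OF that(2), of \<zeta> c "q \<zeta>"] Nq[OF that(1)] proj_eq_0[OF coef_q[OF that(1)]] by simp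
  have resolvent: "resolvent G A \<zeta> f x = proj f x / \<zeta> + q \<zeta> x" if z: "\<zeta> \<in> D" "\<zeta> \<noteq> 0" for \<zeta>
  proof -
    define g where "g = (\<lambda>x. proj f x / \<zeta> + q \<zeta> x)"
    have g: "g \<in> fvec V" using q_fvec[of \<zeta>] proj_in_fvec[of f] by (simp add: g_def fvec_def)
    have "\<zeta> * g y - A g y = f y" for y
    proof (cases "y \<in> V")
      case True
      have "A g y = A (\<lambda>x. (1 / \<zeta>) * proj f x) y + A (q \<zeta>) y"
        unfolding A_eq g_def by (simp flip: matop_add)
      also have "A (\<lambda>x. (1 / \<zeta>) * proj f x) y = (1 / \<zeta>) * A (proj f) y"
        unfolding A_eq by (rule matop_cmult)
      finally have "A g y = A (q \<zeta>) y" by (simp add: A_proj)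
      moreover have "\<zeta> * g y = proj f y + \<zeta> * q \<zeta> y" using z(2) by (simp add: g_def distrib_left)
      ultimately show ?thesis using q[OF z(1) True] by (simp add: b_def algebra_simps)
    next
      case False
      then show ?thesis using f g A_in_fvec[of g] by (simp add: fvec_def)
    qed
    then have "(\<lambda>f x. \<zeta> * f x - A f x) g = f" by (simp add: fun_eq_iff)
    then have "resolvent G A \<zeta> f = g"
      unfolding resolvent_def ell2_eq_fvec
      using g by (intro inv_into_f_eq bij_betw_imp_inj_on[OF bij[OF z]]) auto
    then show ?thesis by (simp add: g_def)
  qed
  \<comment> \<open>A resolvent identity; it yields both the continuity of \<open>q\<close> and its
    derivative.\<close>
  have q_diff: "q \<zeta> y - q \<zeta>0 y = (\<zeta>0 - \<zeta>) * matop V (N \<zeta>0) (q \<zeta>) y" if z: "\<zeta> \<in> D" "\<zeta>0 \<in> D" for \<zeta> \<zeta>0 y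
  proof -
    have "shifted \<zeta>0 c (q \<zeta>) v = b v + (\<zeta>0 - \<zeta>) * q \<zeta> v" if "v \<in> V" for v
      using fun_cong[OF Nq[OF z(1)], of v] that by (simp add: shifted_apply algebra_simps)
    then have "matop V (N \<zeta>0) (shifted \<zeta>0 c (q \<zeta>)) y = matop V (N \<zeta>0) (\<lambda>v. b v + (\<zeta>0 - \<zeta>) * q \<zeta> v) y"
      using matop_cong[of V "shifted \<zeta>0 c (q \<zeta>)" "\<lambda>v. b v + (\<zeta>0 - \<zeta>) * q \<zeta> v"] by simp
    also have "\<dots> = q \<zeta>0 y + (\<zeta>0 - \<zeta>) * matop V (N \<zeta>0) (q \<zeta>) y"
      by (simp add: matop_add matop_cmult q_def)
    finally show ?thesis using N(2)[OF z(2) q_fvec] by simp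
  qed
  have q_cont: "((\<lambda>\<zeta>. q \<zeta> y) \<longlongrightarrow> q \<zeta>0 y) (at \<zeta>0 within D)" if z0: "\<zeta>0 \<in> D" for \<zeta>0 y
  proof -
    obtain K where K: "K > 0"
      "\<And>f C x. (\<And>y. y \<in> V \<Longrightarrow> norm (f y) \<le> C) \<Longrightarrow> C \<ge> 0 \<Longrightarrow> norm (matop V (N \<zeta>0) f x) \<le> K * C"
      using matop_bound[OF finV] by metis
    obtain C0 where C0: "C0 \<ge> 0" "\<And>y. y \<in> V \<Longrightarrow> norm (q \<zeta>0 y) \<le> C0"
      using finite_imp_bound[OF finV] by metis
    \<comment> \<open>No bound on \<open>q \<zeta>\<close> is known beforehand. Its maximum
      \<open>C\<close> is absorbed: near \<open>\<zeta>0\<close> the resolvent identity gives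
      \<open>C \<le> C0 + C / 2\<close>.\<close>
    have bd: "norm (q \<zeta> y - q \<zeta>0 y) \<le> norm (\<zeta>0 - \<zeta>) * (K * (2 * C0))"
      if z: "\<zeta> \<in> D" "norm (\<zeta>0 - \<zeta>) * K \<le> 1 / 2" for \<zeta>
    proof -
      define C where "C = Max (insert 0 ((\<lambda>y. norm (q \<zeta> y)) ` V))"
      have C: "C \<ge> 0" "\<And>y. y \<in> V \<Longrightarrow> norm (q \<zeta> y) \<le> C" by (simp_all add: C_def)
      have d: "norm (q \<zeta> y - q \<zeta>0 y) \<le> norm (\<zeta>0 - \<zeta>) * (K * C)" for y
        unfolding q_diff[OF z(1) z0] norm_mult by (intro mult_left_mono K(2) C) auto
      have half: "norm (\<zeta>0 - \<zeta>) * (K * C) \<le> 1 / 2 * C"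
        using mult_right_mono[OF z(2) C(1)] by (simp add: mult_ac)
      have "norm (q \<zeta> y) \<le> C0 + C / 2" if "y \<in> V" for y
        using d[of y] half C0(2)[OF that] norm_triangle_sub[of "q \<zeta> y" "q \<zeta>0 y"] by simp
      then have "C \<le> C0 + C / 2"
        unfolding C_def using C0(1) C(1) by (subst Max_le_iff) (auto simp: C_def)
      then have "C \<le> 2 * C0" by simp
      then have "norm (\<zeta>0 - \<zeta>) * (K * C) \<le> norm (\<zeta>0 - \<zeta>) * (K * (2 * C0))"
        using K(1) by (intro mult_left_mono) auto
      with d[of y] show ?thesis by simp
    qed
    have lim: "((\<lambda>\<zeta>. norm (\<zeta>0 - \<zeta>)) \<longlongrightarrow> 0) (at \<zeta>0 within D)"
      by (auto intro!: tendsto_eq_intros)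
    have lim': "((\<lambda>\<zeta>. norm (\<zeta>0 - \<zeta>) * K) \<longlongrightarrow> 0) (at \<zeta>0 within D)"
      using tendsto_mult_left_zero[OF lim] .
    have "\<forall>\<^sub>F \<zeta> in at \<zeta>0 within D. norm (\<zeta>0 - \<zeta>) * K < 1 / 2"
      using order_tendstoD(2)[OF lim', of "1 / 2"] by simp
    moreover have "\<forall>\<^sub>F \<zeta> in at \<zeta>0 within D. \<zeta> \<in> D"
      by (simp add: eventually_at_filter)
    ultimately have "\<forall>\<^sub>F \<zeta> in at \<zeta>0 within D. norm (q \<zeta> y - q \<zeta>0 y) \<le> norm (\<zeta>0 - \<zeta>) * (K * (2 * C0))"
      by eventually_elim (use bd in auto)
    then have "((\<lambda>\<zeta>. q \<zeta> y - q \<zeta>0 y) \<longlongrightarrow> 0) (at \<zeta>0 within D)"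
      using tendsto_mult_left_zero[OF lim] by (rule Lim_null_comparison)
    then show ?thesis by (simp add: LIM_zero_iff)
  qed
  have "(\<lambda>\<zeta>. q \<zeta> x) holomorphic_on D"
    unfolding holomorphic_on_def field_differentiable_def
  proof (intro ballI exI)
    fix \<zeta>0 assume z0: "\<zeta>0 \<in> D"
    show "((\<lambda>\<zeta>. q \<zeta> x) has_field_derivative - matop V (N \<zeta>0) (q \<zeta>0) x) (at \<zeta>0 within D)"
      unfolding has_field_derivative_iff
    proof (rule Lim_transform_eventually)
      show "((\<lambda>\<zeta>. - matop V (N \<zeta>0) (q \<zeta>) x) \<longlongrightarrow> - matop V (N \<zeta>0) (q \<zeta>0) x) (at \<zeta>0 within D)"
        unfolding matop_def by (auto intro!: tendsto_intros q_cont[OF z0])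
      show "\<forall>\<^sub>F \<zeta> in at \<zeta>0 within D. - matop V (N \<zeta>0) (q \<zeta>) x = (q \<zeta> x - q \<zeta>0 x) / (\<zeta> - \<zeta>0)"
        unfolding eventually_at_filter
        by (rule always_eventually) (auto simp: q_diff z0 field_simps)
    qed
  qed
  \<comment> \<open>On the circle the resolvent is this function divided by \<open>\<zeta>\<close>,
    so Cauchy's formula evaluates it at 0, where only \<open>proj f x\<close> is left.\<close>
  then have "(\<lambda>\<zeta>. proj f x + \<zeta> * q \<zeta> x) holomorphic_on cball 0 \<epsilon>"
    unfolding D_def by (intro holomorphic_intros)
  from Cauchy_integral_circlepath_simple[OF this, of 0] eps
  have "((\<lambda>\<zeta>. (proj f x + \<zeta> * q \<zeta> x) / \<zeta>) has_contour_integral 2 * of_real pi * \<i> * proj f x) (circlepath 0 \<epsilon>)"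
    by simp
  moreover have "(proj f x + \<zeta> * q \<zeta> x) / \<zeta> = resolvent G A \<zeta> f x" if "\<zeta> \<in> path_image (circlepath 0 \<epsilon>)" for \<zeta>
  proof -
    have "\<zeta> \<in> D" "\<zeta> \<noteq> 0" using that eps by (auto simp: D_def)
    then show ?thesis by (simp add: resolvent add_divide_distrib)
  qed
  ultimately have "((\<lambda>\<zeta>. resolvent G A \<zeta> f x) has_contour_integral 2 * of_real pi * \<i> * proj f x) (circlepath 0 \<epsilon>)"
    by (rule has_contour_integral_eq)
  then show ?thesis
    by (simp add: riesz_projection_def \<epsilon>_def contour_integral_unique)
qed

text \<open>Coefficients see only exclusive parts, and the indicator of \<open>R\<close> is 1 on
  that of \<open>R\<close> and 0 on all others.\<close>

lemma proj_indicator: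
  assumes R: "R \<in> Rs"
  shows "proj (indicator R) x = \<gamma> R x"
proof -
  have "coef S (indicator R) = (if S = R then 1 else 0)" if S: "S \<in> Rs" for S
    by (rule coef_locally_const[OF S]) (use R in \<open>auto simp: exclusive_part_def indicator_def\<close>)
  then have "proj (indicator R) x = (\<Sum>S\<in>Rs. if S = R then \<gamma> S x else 0)"
    unfolding proj_def by (intro sum.cong) auto
  then show ?thesis using R by simp
qed

text \<open>The reduced mass is the integral of \<open>\<gamma> R\<close> over \<open>R\<close> with
  respect to \<open>m\<close>; the integrand is nonnegative, and it is positive at the root.\<close>

lemma reduced_mass_pos:
  assumes R: "R \<in> Rs"
  shows "reduced_mass G F R > 0"
proof -
  have "indicator R \<in> fvec V" using reach_subset[OF R] by (auto simp: fvec_def indicator_def)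
  then have "riesz_projection G A (indicator R) = \<gamma> R"
    by (simp add: fun_eq_iff riesz_projection_eq_proj proj_indicator[OF R])
  then have "reduced_mass G F R = (\<Sum>x\<in>V. indicator R x * Re (\<gamma> R x) * m x)"
    by (auto simp: reduced_mass_def ell2_inner_def indicator_def intro!: sum.cong)
  also have "\<dots> > 0"
  proof (rule sum_pos2[OF finV])
    show "root R \<in> V" using root R by blast
    then show "0 < indicator R (root R) * Re (\<gamma> R (root R)) * m (root R)"
      using mass_pos[of "root R"] root_in[OF R] R by (simp add: kernel_vector_root)
    show "0 \<le> indicator R i * Re (\<gamma> R i) * m i" if "i \<in> V" for i
      using mass_pos[OF that] kernel_vector_nonneg[OF R, of i] by (simp add: indicator_def)
  qed
  finally show ?thesis .
qed

end

section \<open>The reduced Laplacian\<close>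

context clustered_digraph
begin

abbreviation "B \<equiv> laplacian (edge_restrict G (edges G - F))"
abbreviation "Lr \<equiv> laplacian (reduced_graph G F)"

lemma B_eq: "B = matop V (lap_matrix (edge_restrict G (edges G - F)))"
  using laplacian_eq_matop[of "edge_restrict G (edges G - F)"] by (simp add: edge_restrict_def)

lemma Lr_eq: "Lr = matop Rs (lap_matrix (reduced_graph G F))"
  using laplacian_eq_matop[of "reduced_graph G F"] by (simp add: reduced_graph_def)

lemma weight_split:
  assumes "x \<in> V" "y \<in> V"
  shows "weight (edge_restrict G (edges G - F)) x y + aF x y = a x y"
  using assms weight_nonneg[OF assms] weight_pos_iff[OF assms] F_subset by (auto simp: edge_restrict_def)

lemma B_apply:
  assumes "x \<in> V"
  shows "B f x = (\<Sum>y\<in>V. of_real (weight (edge_restrict G (edges G - F)) x y) * (f x - f y)) / of_real (m x)"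
  using assms by (simp add: laplacian_def in_degree_def edge_restrict_def right_diff_distrib sum_subtractf
      sum_distrib_right diff_divide_distrib)

lemma B_plus_A:
  assumes "x \<in> V"
  shows "B f x + A f x = (\<Sum>y\<in>V. of_real (a x y) * (f x - f y)) / of_real (m x)"
proof -
  have "of_real (a x y) * (f x - f y) = of_real (weight (edge_restrict G (edges G - F)) x y) * (f x - f y) +
      of_real (aF x y) * (f x - f y)" if "y \<in> V" for y
    by (simp only: weight_split[OF assms that, symmetric] of_real_add distrib_right)
  then show ?thesis
    using assms by (simp add: B_apply A_apply sum.distrib add_divide_distrib)
qed

lemma reduced_weight_eq:
  assumes R: "R \<in> Rs" and S: "S \<in> Rs"
  shows "reduced_weight G F R S =
           reduced_mass G F R * (\<Sum>x\<in>V. \<Sum>y\<in>V. \<theta> R x * a x y * Re (\<gamma> S y))"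
proof -
  have "(\<Sum>y\<in>S. \<theta> R x * a x y * Re (\<gamma> S y)) = (\<Sum>y\<in>V. \<theta> R x * a x y * Re (\<gamma> S y))" for x
    using reach_subset[OF S] kernel_vector(3)[OF S] by (intro sum.mono_neutral_left) auto
  moreover have "\<theta> R x = 0" if "x \<notin> R" for x
    using left_kernel_neq_0[OF R, of x] exclusive_subset[of R] that by blast
  then have "(\<Sum>x\<in>R. \<Sum>y\<in>V. \<theta> R x * a x y * Re (\<gamma> S y)) =
      (\<Sum>x\<in>V. \<Sum>y\<in>V. \<theta> R x * a x y * Re (\<gamma> S y))"
    using reach_subset[OF R] by (intro sum.mono_neutral_left) simp_all
  ultimately show ?thesis by (simp add: reduced_weight_def)
qed

lemma reduced_laplacian_eq:
  assumes R: "R \<in> Rs"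
  shows "Lr g R = coef R (B (J_up G F g))"
proof -
  define u where "u = J_up G F g"
  define W where "W S = (\<Sum>x\<in>V. \<Sum>y\<in>V. \<theta> R x * a x y * Re (\<gamma> S y))" for S
  have mu: "reduced_mass G F R \<noteq> 0" using reduced_mass_pos[OF R] by simp
  have "Lr g R = (\<Sum>S\<in>Rs. of_real (reduced_weight G F R S) * (g R - g S)) / of_real (reduced_mass G F R)"
    using R by (simp add: laplacian_def in_degree_def reduced_graph_def right_diff_distrib sum_subtractf
        sum_distrib_right diff_divide_distrib)
  also have "\<dots> = (\<Sum>S\<in>Rs. of_real (reduced_mass G F R) * (of_real (W S) * (g R - g S))) / of_real (reduced_mass G F R)"
    using R by (intro arg_cong2[of _ _ _ _ "(/)"] sum.cong) (auto simp: reduced_weight_eq W_def)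
  also have "\<dots> = (\<Sum>S\<in>Rs. of_real (W S) * (g R - g S))"
    using mu by (simp flip: sum_distrib_left)
  finally have 1: "Lr g R = (\<Sum>S\<in>Rs. of_real (W S) * (g R - g S))" .
  \<comment> \<open>The reduced weights count all edges, whereas \<open>B\<close> has only those
    outside the clusters; adding \<open>A u\<close> is invisible to \<open>coef R\<close>.\<close>
  have "coef R (B u) = coef R (\<lambda>x. (B u x + A u x) - A u x)" by simp
  also have "\<dots> = coef R (\<lambda>x. B u x + A u x)"
    unfolding coef_diff using coef_A[OF R] by simp
  also have "\<dots> = (\<Sum>x\<in>V. of_real (\<theta> R x) * (\<Sum>y\<in>V. of_real (a x y) * (u x - u y)))"
    unfolding coef_def
  proof (intro sum.cong refl)
    fix x assume x: "x \<in> V"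
    show "of_real (\<theta> R x) * (B u x + A u x) * of_real (m x) =
        of_real (\<theta> R x) * (\<Sum>y\<in>V. of_real (a x y) * (u x - u y))"
      using mass_pos[OF x] by (simp add: B_plus_A[OF x])
  qed
  also have "\<dots> = (\<Sum>x\<in>V. \<Sum>y\<in>V. \<Sum>S\<in>Rs. of_real (\<theta> R x * a x y * Re (\<gamma> S y)) * (g R - g S))"
  proof (intro sum.cong refl)
    fix x assume x: "x \<in> V"
    have "of_real (\<theta> R x) * (of_real (a x y) * (u x - u y)) =
        (\<Sum>S\<in>Rs. of_real (\<theta> R x * a x y * Re (\<gamma> S y)) * (g R - g S))" if y: "y \<in> V" for y
    proof (cases "\<theta> R x = 0")
      case False
      then have x': "x \<in> exclusive_part V F R" by (rule left_kernel_neq_0[OF R])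
      \<comment> \<open>On the support of \<open>\<theta> R\<close> only \<open>\<gamma> R\<close>
        is nonzero, so \<open>u x = g R\<close>. Since the kernel vectors sum to 1 at
        \<open>y\<close>, the difference \<open>u x - u y\<close> becomes a combination of the
        \<open>g R - g S\<close>.\<close>
      have "u x = (\<Sum>S\<in>Rs. if S = R then g S else 0)"
        unfolding u_def J_up_def using kernel_vector(4)[OF _ R x'] by (intro sum.cong) auto
      then have "u x = g R * (\<Sum>S\<in>Rs. \<gamma> S y)"
        using R kernel_vector_sum[OF y] by simp
      then have "u x - u y = (\<Sum>S\<in>Rs. (g R - g S) * \<gamma> S y)"
        by (simp add: u_def J_up_def left_diff_distrib sum_subtractf sum_distrib_left)
      then have "of_real (\<theta> R x) * (of_real (a x y) * (u x - u y)) =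
          (\<Sum>S\<in>Rs. of_real (\<theta> R x) * (of_real (a x y) * ((g R - g S) * \<gamma> S y)))"
        by (simp only: sum_distrib_left)
      also have "\<dots> = (\<Sum>S\<in>Rs. of_real (\<theta> R x * a x y * Re (\<gamma> S y)) * (g R - g S))"
        by (intro sum.cong) (auto simp: of_real_Re_kernel_vector)
      finally show ?thesis .
    qed simp
    then show "of_real (\<theta> R x) * (\<Sum>y\<in>V. of_real (a x y) * (u x - u y)) =
        (\<Sum>y\<in>V. \<Sum>S\<in>Rs. of_real (\<theta> R x * a x y * Re (\<gamma> S y)) * (g R - g S))"
      unfolding sum_distrib_left by (intro sum.cong) auto
  qed
  also have "\<dots> = (\<Sum>x\<in>V. \<Sum>S\<in>Rs. \<Sum>y\<in>V. of_real (\<theta> R x * a x y * Re (\<gamma> S y)) * (g R - g S))"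
    by (rule sum.cong[OF refl]) (rule sum.swap)
  also have "\<dots> = (\<Sum>S\<in>Rs. \<Sum>x\<in>V. \<Sum>y\<in>V. of_real (\<theta> R x * a x y * Re (\<gamma> S y)) * (g R - g S))"
    by (rule sum.swap)
  also have "\<dots> = (\<Sum>S\<in>Rs. of_real (W S) * (g R - g S))"
    unfolding W_def of_real_sum sum_distrib_right ..
  finally show ?thesis using 1 by (simp add: u_def)
qed

lemma J_up_J_down: "J_up G F (J_down G F f) x = proj f x"
  by (simp add: J_up_def proj_def J_down_def ell2_inner_def coef_def)

section \<open>The limit of strong coupling\<close>

definition L_matrix :: "real \<Rightarrow> 'a \<Rightarrow> 'a \<Rightarrow> complex" where
  "L_matrix \<beta> x y = lap_matrix (edge_restrict G (edges G - F)) x y +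
     of_real \<beta> * lap_matrix (edge_restrict G F) x y"

abbreviation "L \<beta> \<equiv> matop V (L_matrix \<beta>)"

lemma L_apply: "L \<beta> f x = B f x + of_real \<beta> * A f x"
  unfolding A_eq B_eq matop_def L_matrix_def
  by (simp add: distrib_right sum.distrib sum_distrib_left mult.assoc)

lemma scaled_laplacian_eq: "scaled_laplacian G F \<beta> = L \<beta>"
  by (simp add: fun_eq_iff scaled_laplacian_def L_apply)

text \<open>A common bound for the jump rates of all nodes; the summand 1 keeps it positive for a
  graph without edges.\<close>

definition rate :: real where
  "rate = 1 + (\<Sum>x\<in>V. (\<Sum>y\<in>V. a x y) / m x)"

lemma in_rate_nonneg: "x \<in> V \<Longrightarrow> 0 \<le> (\<Sum>y\<in>V. a x y) / m x"
  using mass_pos by (intro divide_nonneg_pos sum_nonneg weight_nonneg)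

lemma rate_ge: "x \<in> V \<Longrightarrow> (\<Sum>y\<in>V. a x y) / m x \<le> rate"
  unfolding rate_def using member_le_sum[of x V "\<lambda>x. (\<Sum>y\<in>V. a x y) / m x"] in_rate_nonneg by auto

lemma rate_pos: "rate > 0"
  unfolding rate_def using sum_nonneg[of V "\<lambda>x. (\<Sum>y\<in>V. a x y) / m x"] in_rate_nonneg by auto

text \<open>The jump rate \<open>d\<close> of \<open>L \<beta>\<close> at \<open>x\<close> is at
  most \<open>c = rate * (1 + \<beta>)\<close>, so \<open>c f - L \<beta> f\<close> at
  \<open>x\<close> combines values of \<open>f\<close> with nonnegative coefficients
  \<open>c - d\<close> and \<open>w y\<close> of total \<open>c\<close>.\<close>

lemma markov_L:
  assumes "\<beta> \<ge> 0"
  shows "markov_op V (L_matrix \<beta>) (rate * (1 + \<beta>))"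
proof
  show "rate * (1 + \<beta>) > 0" using rate_pos assms by simp
  fix f C x assume f: "sup_bounded V f C" and x: "x \<in> V"
  define w where "w y = (weight (edge_restrict G (edges G - F)) x y + \<beta> * aF x y) / m x" for y
  define d where "d = (\<Sum>y\<in>V. w y)"
  have mx: "m x > 0" by (rule mass_pos[OF x])
  have aB: "0 \<le> weight (edge_restrict G (edges G - F)) x y" if "y \<in> V" for y
    using that x weight_nonneg by (simp add: edge_restrict_def)
  have w: "w y \<ge> 0" if "y \<in> V" for y
    using aB[OF that] aF_nonneg[OF x that] assms mx by (simp add: w_def)
  have "w y \<le> (1 + \<beta>) * (a x y / m x)" if y: "y \<in> V" for y
  proof -
    have "weight (edge_restrict G (edges G - F)) x y + \<beta> * aF x y \<le> (1 + \<beta>) * a x y"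
      using weight_split[OF x y] aB[OF y] aF_nonneg[OF x y] assms
        mult_left_mono[of "aF x y" "a x y" \<beta>] by (simp add: distrib_right)
    then show ?thesis using mx by (simp add: w_def divide_right_mono)
  qed
  then have "d \<le> (\<Sum>y\<in>V. (1 + \<beta>) * (a x y / m x))"
    unfolding d_def by (intro sum_mono)
  also have "\<dots> = (1 + \<beta>) * ((\<Sum>y\<in>V. a x y) / m x)"
    by (simp add: sum_distrib_left sum_divide_distrib)
  also have "\<dots> \<le> (1 + \<beta>) * rate"
    using rate_ge[OF x] assms by (intro mult_left_mono) auto
  finally have d: "d \<le> rate * (1 + \<beta>)" by (simp add: mult.commute)
  have "L \<beta> f x = (\<Sum>y\<in>V. of_real (w y) * (f x - f y))"
    unfolding L_apply A_apply[OF x] B_apply[OF x] w_def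
    by (simp add: sum_divide_distrib sum_distrib_left distrib_right add_divide_distrib sum.distrib mult.assoc)
  also have "\<dots> = of_real d * f x - (\<Sum>y\<in>V. of_real (w y) * f y)"
    by (simp add: right_diff_distrib sum_subtractf sum_distrib_right d_def)
  finally have "of_real (rate * (1 + \<beta>)) * f x - L \<beta> f x =
      of_real (rate * (1 + \<beta>) - d) * f x + (\<Sum>y\<in>V. of_real (w y) * f y)"
    by (simp add: algebra_simps)
  also have "norm \<dots> \<le> norm (of_real (rate * (1 + \<beta>) - d) * f x) + norm (\<Sum>y\<in>V. of_real (w y) * f y)"
    by (rule norm_triangle_ineq)
  also have "norm (of_real (rate * (1 + \<beta>) - d) * f x) \<le> (rate * (1 + \<beta>) - d) * C"
    using d f x unfolding norm_mult norm_of_real sup_bounded_def by (intro mult_mono) auto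
  also have "norm (\<Sum>y\<in>V. of_real (w y) * f y) \<le> (\<Sum>y\<in>V. w y * C)"
    using w f by (intro sum_norm_le) (auto simp: norm_mult sup_bounded_def intro!: mult_mono)
  also have "(\<Sum>y\<in>V. w y * C) = d * C"
    by (simp add: d_def sum_distrib_right)
  finally show "norm (of_real (rate * (1 + \<beta>)) * f x - L \<beta> f x) \<le> rate * (1 + \<beta>) * C"
    by (simp add: left_diff_distrib)
qed (rule finV)

lemma sup_bounded_exists: "\<exists>C. sup_bounded V f C"
  using finite_imp_bound[OF finV, of f] by (metis sup_bounded_def)

lemma op_exp_range_tendsto:
  assumes t: "t > 0" and x: "x \<in> V"
  shows "((\<lambda>\<beta>. op_exp (- t) (L \<beta>) (A h) x) \<longlongrightarrow> 0) at_top"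
proof -
  obtain C where C: "sup_bounded V h C" using sup_bounded_exists by blast
  obtain C' where C': "sup_bounded V (B h) C'" using sup_bounded_exists by blast
  have bound: "norm (op_exp (- t) (L \<beta>) (A h) x) \<le> C * sqrt (rate / t) * (sqrt (1 + \<beta>) / \<beta>) + C' * (1 / \<beta>)"
    if "\<beta> \<ge> 1" for \<beta>
  proof -
    interpret markov_op V "L_matrix \<beta>" "rate * (1 + \<beta>)"
      using that by (intro markov_L) simp
    have "A h = (\<lambda>y. (1 / of_real \<beta>) * (L \<beta> h y - B h y))"
      using that by (simp add: L_apply fun_eq_iff)
    then have "op_exp (- t) (L \<beta>) (A h) x =
        (1 / of_real \<beta>) * (op_exp (- t) (L \<beta>) (L \<beta> h) x - op_exp (- t) (L \<beta>) (B h) x)"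
      by (simp only: op_exp_cmult[OF finV x] op_exp_diff[OF finV x])
    then have "norm (op_exp (- t) (L \<beta>) (A h) x) =
        norm (op_exp (- t) (L \<beta>) (L \<beta> h) x - op_exp (- t) (L \<beta>) (B h) x) / \<beta>"
      using that by (simp add: norm_mult norm_divide)
    also have "\<dots> \<le> (C * sqrt (rate * (1 + \<beta>) / t) + C') / \<beta>"
      using op_exp_smoothing[OF C x t] op_exp_contraction[OF C' x, of t] t that
      by (intro divide_right_mono order_trans[OF norm_triangle_ineq4] add_mono) auto
    also have "\<dots> = C * sqrt (rate / t) * (sqrt (1 + \<beta>) / \<beta>) + C' * (1 / \<beta>)"
    proof -
      have "sqrt (rate * (1 + \<beta>) / t) = sqrt (rate / t) * sqrt (1 + \<beta>)"
        by (simp flip: real_sqrt_mult)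
      then show ?thesis by (simp add: add_divide_distrib)
    qed
    finally show ?thesis .
  qed
  show ?thesis
  proof (rule Lim_null_comparison)
    show "\<forall>\<^sub>F \<beta> in at_top. norm (op_exp (- t) (L \<beta>) (A h) x) \<le>
        C * sqrt (rate / t) * (sqrt (1 + \<beta>) / \<beta>) + C' * (1 / \<beta>)"
      using eventually_ge_at_top[of 1] by eventually_elim (rule bound)
    have "((\<lambda>\<beta>::real. sqrt (1 + \<beta>) / \<beta>) \<longlongrightarrow> 0) at_top" by real_asymp
    moreover have "((\<lambda>\<beta>::real. 1 / \<beta>) \<longlongrightarrow> 0) at_top" by real_asymp
    ultimately show "((\<lambda>\<beta>. C * sqrt (rate / t) * (sqrt (1 + \<beta>) / \<beta>) + C' * (1 / \<beta>)) \<longlongrightarrow> 0) at_top"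
      using tendsto_add[OF tendsto_mult_right_zero tendsto_mult_right_zero] by fastforce
  qed
qed

text \<open>
  The curve \<open>\<Sum>\<^sub>S g\<^sub>S (\<gamma>\<^sub>S - h\<^sub>S / \<beta>)\<close>, where \<open>g\<close> is the reduced evolution and \<open>A h\<^sub>S = (1 - P) B \<gamma>\<^sub>S\<close>,
  solves the full evolution equation up to an error of order \<open>1 / \<beta>\<close>: the corrector \<open>h\<^sub>S\<close> cancels
  the part of \<open>B \<gamma>\<^sub>S\<close> outside the kernel of \<open>A\<close>.
\<close>

lemma op_exp_kernel_tendsto:
  assumes t: "t > 0" and x: "x \<in> V"
  shows "((\<lambda>\<beta>. op_exp (- t) (L \<beta>) (J_up G F g0) x - J_up G F (op_exp (- t) Lr g0) x) \<longlongrightarrow> 0) at_top"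
proof -
  have "\<exists>h. \<forall>y. A h y = B (\<gamma> S) y - proj (B (\<gamma> S)) y" for S
  proof -
    have 1: "(\<lambda>y. B (\<gamma> S) y - proj (B (\<gamma> S)) y) \<in> fvec V"
      using proj_in_fvec[of "B (\<gamma> S)"] matop_in_fvec unfolding B_eq by (simp add: fvec_def)
    have 2: "coef R (\<lambda>y. B (\<gamma> S) y - proj (B (\<gamma> S)) y) = 0" if "R \<in> Rs" for R
      using that by (simp add: coef_diff coef_proj)
    from range_A[OF 1 2] obtain h where "A h = (\<lambda>y. B (\<gamma> S) y - proj (B (\<gamma> S)) y)" by blast
    then show ?thesis by (intro exI[of _ h]) simp
  qed
  then obtain h where h: "\<And>S y. A (h S) y = B (\<gamma> S) y - proj (B (\<gamma> S)) y" by metis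
  define g where "g s S = op_exp (- s) Lr g0 S" for s S
  define l where "l s S = op_exp (- s) Lr (Lr g0) S" for s S
  have g': "((\<lambda>s. g s S) has_vector_derivative - l s S) (at s)" if S: "S \<in> Rs" for s S
  proof -
    have "((\<lambda>s. - s) has_vector_derivative (- 1)) (at s)"
      by (auto intro!: derivative_eq_intros)
    from vector_diff_chain_at[OF this op_exp_has_vector_derivative[OF finite_reaches S]]
    show ?thesis by (simp add: o_def g_def l_def Lr_eq)
  qed
  have Lr_g: "Lr (g s) S = l s S" if "S \<in> Rs" for s S
    unfolding g_def l_def Lr_eq by (rule matop_op_exp[OF finite_reaches that])
  have "\<exists>C\<ge>0. \<forall>s\<in>{0..t}. norm (g s S) \<le> C" if "S \<in> Rs" for S
    unfolding g_def Lr_eq using op_exp_bounded_on_interval[OF finite_reaches that] by metis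
  then obtain Cg where Cg: "\<And>S. S \<in> Rs \<Longrightarrow> Cg S \<ge> 0" "\<And>S s. S \<in> Rs \<Longrightarrow> s \<in> {0..t} \<Longrightarrow> norm (g s S) \<le> Cg S"
    by metis
  have "\<exists>C\<ge>0. \<forall>s\<in>{0..t}. norm (l s S) \<le> C" if "S \<in> Rs" for S
    unfolding l_def Lr_eq using op_exp_bounded_on_interval[OF finite_reaches that] by metis
  then obtain Cl where Cl: "\<And>S. S \<in> Rs \<Longrightarrow> Cl S \<ge> 0" "\<And>S s. S \<in> Rs \<Longrightarrow> s \<in> {0..t} \<Longrightarrow> norm (l s S) \<le> Cl S"
    by metis
  \<comment> \<open>A bound for the residual \<open>e\<close> on the time interval;
    \<open>g\<close>, \<open>l\<close> and \<open>h\<close> do not involve \<open>\<beta>\<close>,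
    so neither does the bound.\<close>
  define d where "d y = (\<Sum>S\<in>Rs. Cg S * norm (B (h S) y) + Cl S * norm (h S y))" for y
  have d_nn: "d y \<ge> 0" for y
    unfolding d_def using Cg(1) Cl(1) by (intro sum_nonneg) auto
  define D where "D = (\<Sum>y\<in>V. d y)"
  have D: "D \<ge> 0" "\<And>y. y \<in> V \<Longrightarrow> d y \<le> D"
    using d_nn by (auto simp: D_def intro: sum_nonneg member_le_sum)
  define e where "e s y = (\<Sum>S\<in>Rs. g s S * B (h S) y - l s S * h S y)" for s y
  have e: "norm (e s y) \<le> D" if "s \<in> {0..t}" "y \<in> V" for s y
  proof -
    have "norm (e s y) \<le> d y"
      unfolding e_def d_def
    proof (rule sum_norm_le)
      fix S assume S: "S \<in> Rs"
      show "norm (g s S * B (h S) y - l s S * h S y) \<le> Cg S * norm (B (h S) y) + Cl S * norm (h S y)"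
        using Cg(2)[OF S that(1)] Cl(2)[OF S that(1)]
        by (intro order_trans[OF norm_triangle_ineq4] add_mono) (simp_all add: norm_mult mult_right_mono)
    qed
    then show ?thesis using D(2)[OF that(2)] by simp
  qed
  define H where "H s y = (\<Sum>S\<in>Rs. g s S * h S y)" for s y
  obtain C3 where C3: "sup_bounded V (H 0) C3" using sup_bounded_exists by blast
  have bound: "norm (op_exp (- t) (L \<beta>) (J_up G F g0) x - J_up G F (op_exp (- t) Lr g0) x) \<le>
      (D * t + norm (H t x) + C3) * (1 / \<beta>)" if beta: "\<beta> \<ge> 1" for \<beta>
  proof -
    interpret markov_op V "L_matrix \<beta>" "rate * (1 + \<beta>)"
      using that by (intro markov_L) simp
    define k where "k s y = (\<Sum>S\<in>Rs. g s S * (\<gamma> S y - (1 / of_real \<beta>) * h S y))" for s y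
    define k' where "k' s y = (\<Sum>S\<in>Rs. - l s S * (\<gamma> S y - (1 / of_real \<beta>) * h S y))" for s y
    have k': "((\<lambda>s. k s y) has_vector_derivative k' s y) (at s)" for s y
      unfolding k_def k'_def
      by (intro has_vector_derivative_sum has_vector_derivative_mult_left g')
    \<comment> \<open>Order \<open>\<beta>\<close> vanishes as \<open>A (\<gamma> S) = 0\<close>.
      Order 1 leaves \<open>B (\<gamma> S) - A (h S)\<close>, the projection of
      \<open>B (\<gamma> S)\<close>; by \<open>reduced_laplacian_eq\<close> its combination is the
      lifted reduced generator, which cancels against \<open>k'\<close>.\<close>
    have err: "L \<beta> (k s) y + k' s y = - (1 / of_real \<beta>) * e s y" if y: "y \<in> V" for s y
    proof -
      have "L \<beta> (k s) y = (\<Sum>S\<in>Rs. g s S * L \<beta> (\<lambda>y. \<gamma> S y - (1 / of_real \<beta>) * h S y) y)"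
        unfolding k_def by (rule matop_sum)
      also have "\<dots> = (\<Sum>S\<in>Rs. g s S * (proj (B (\<gamma> S)) y - (1 / of_real \<beta>) * B (h S) y))"
      proof (intro sum.cong refl)
        fix S assume S: "S \<in> Rs"
        have "L \<beta> (\<lambda>y. \<gamma> S y - (1 / of_real \<beta>) * h S y) y = L \<beta> (\<gamma> S) y - (1 / of_real \<beta>) * L \<beta> (h S) y"
          by (simp only: matop_diff matop_cmult)
        also have "\<dots> = proj (B (\<gamma> S)) y - (1 / of_real \<beta>) * B (h S) y"
          using beta by (simp add: L_apply kernel_vector(2)[OF S] h field_simps)
        finally show "g s S * L \<beta> (\<lambda>y. \<gamma> S y - (1 / of_real \<beta>) * h S y) y =
            g s S * (proj (B (\<gamma> S)) y - (1 / of_real \<beta>) * B (h S) y)" by simp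
      qed
      also have "\<dots> = (\<Sum>S\<in>Rs. g s S * proj (B (\<gamma> S)) y) - (1 / of_real \<beta>) * (\<Sum>S\<in>Rs. g s S * B (h S) y)"
        by (simp only: right_diff_distrib sum_subtractf sum_distrib_left mult.left_commute)
      also have "(\<Sum>S\<in>Rs. g s S * proj (B (\<gamma> S)) y) = (\<Sum>R\<in>Rs. l s R * \<gamma> R y)"
      proof -
        have "(\<Sum>S\<in>Rs. g s S * proj (B (\<gamma> S)) y) = (\<Sum>S\<in>Rs. \<Sum>R\<in>Rs. g s S * coef R (B (\<gamma> S)) * \<gamma> R y)"
          by (simp only: proj_def sum_distrib_left mult.assoc)
        also have "\<dots> = (\<Sum>R\<in>Rs. \<Sum>S\<in>Rs. g s S * coef R (B (\<gamma> S)) * \<gamma> R y)"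
          by (rule sum.swap)
        also have "\<dots> = (\<Sum>R\<in>Rs. l s R * \<gamma> R y)"
        proof (intro sum.cong refl)
          fix R assume R: "R \<in> Rs"
          have "B (J_up G F (g s)) = (\<lambda>y. \<Sum>S\<in>Rs. g s S * B (\<gamma> S) y)"
            unfolding J_up_def B_eq by (intro ext matop_sum)
          then have "l s R = (\<Sum>S\<in>Rs. g s S * coef R (B (\<gamma> S)))"
            using Lr_g[OF R, of s] reduced_laplacian_eq[OF R, of "g s"] by (simp only: coef_sum)
          then show "(\<Sum>S\<in>Rs. g s S * coef R (B (\<gamma> S)) * \<gamma> R y) = l s R * \<gamma> R y"
            by (simp only: sum_distrib_right)
        qed
        finally show ?thesis .
      qed
      finally have "L \<beta> (k s) y = (\<Sum>R\<in>Rs. l s R * \<gamma> R y) - (1 / of_real \<beta>) * (\<Sum>S\<in>Rs. g s S * B (h S) y)" .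
      moreover have "k' s y = (1 / of_real \<beta>) * (\<Sum>S\<in>Rs. l s S * h S y) - (\<Sum>S\<in>Rs. l s S * \<gamma> S y)"
        by (simp add: k'_def right_diff_distrib sum_subtractf sum_distrib_left sum_negf mult.left_commute)
      ultimately show ?thesis by (simp add: e_def sum_subtractf right_diff_distrib)
    qed
    define \<phi> where "\<phi> s = op_exp (s - t) (L \<beta>) (k s) x" for s
    define \<phi>' where "\<phi>' s = op_exp (s - t) (L \<beta>) (\<lambda>y. L \<beta> (k s) y + k' s y) x" for s
    have "norm (\<phi> t - \<phi> 0) \<le> (D / \<beta>) * t"
    proof (rule vector_derivative_bound)
      show "(\<phi> has_vector_derivative \<phi>' s) (at s)" for s
        unfolding \<phi>_def \<phi>'_def by (rule op_exp_duhamel[OF finV x k'])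
      fix s assume s: "s \<in> {0..t}"
      have "sup_bounded V (\<lambda>y. L \<beta> (k s) y + k' s y) (D / \<beta>)"
        using beta e[OF s] D(1) by (simp add: sup_bounded_def err norm_mult norm_divide divide_right_mono)
      from op_exp_contraction[OF this x, of "t - s"] s show "norm (\<phi>' s) \<le> D / \<beta>"
        by (simp add: \<phi>'_def)
    qed (use t in simp)
    moreover have "\<phi> t = J_up G F (op_exp (- t) Lr g0) x - (1 / of_real \<beta>) * H t x"
      by (simp add: \<phi>_def k_def J_up_def g_def H_def right_diff_distrib sum_subtractf sum_distrib_left mult.left_commute)
    moreover have "\<phi> 0 = op_exp (- t) (L \<beta>) (J_up G F g0) x - (1 / of_real \<beta>) * op_exp (- t) (L \<beta>) (H 0) x"
    proof -
      have "k 0 = (\<lambda>y. J_up G F g0 y - (1 / of_real \<beta>) * H 0 y)"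
        by (simp add: fun_eq_iff k_def J_up_def g_def H_def right_diff_distrib sum_subtractf sum_distrib_left mult.left_commute)
      then show ?thesis
        by (simp only: \<phi>_def op_exp_diff[OF finV x] op_exp_cmult[OF finV x]) simp
    qed
    ultimately have 1: "norm ((J_up G F (op_exp (- t) Lr g0) x - (1 / of_real \<beta>) * H t x) -
        (op_exp (- t) (L \<beta>) (J_up G F g0) x - (1 / of_real \<beta>) * op_exp (- t) (L \<beta>) (H 0) x)) \<le> D / \<beta> * t"
      by simp
    have 2: "norm ((1 / of_real \<beta>) * op_exp (- t) (L \<beta>) (H 0) x) \<le> C3 / \<beta>"
      using op_exp_contraction[OF C3 x, of t] t beta by (simp add: norm_mult norm_divide divide_right_mono)
    have 3: "norm ((1 / of_real \<beta>) * H t x) = norm (H t x) / \<beta>"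
      using beta by (simp add: norm_mult norm_divide)
    \<comment> \<open>Here \<open>u\<close> and \<open>v\<close> are the corrector terms from times
      \<open>t\<close> and 0. Both are of order \<open>1 / \<beta>\<close>, the second one by
      contractivity.\<close>
    have tri: "norm (p - q) \<le> norm ((q - u) - (p - v)) + norm u + norm v" for p q u v :: complex
    proof -
      have "p - q = - ((q - u) - (p - v)) - u + v" by simp
      then show ?thesis
        using norm_triangle_ineq[of "- ((q - u) - (p - v)) - u" v]
          norm_triangle_ineq4[of "- ((q - u) - (p - v))" u] by (simp only: norm_minus_cancel)
    qed
    have "norm (op_exp (- t) (L \<beta>) (J_up G F g0) x - J_up G F (op_exp (- t) Lr g0) x) \<le>
        D / \<beta> * t + norm (H t x) / \<beta> + C3 / \<beta>"
      by (rule order_trans[OF tri add_mono[OF add_mono[OF 1 eq_refl[OF 3]] 2]])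
    then show ?thesis by (simp add: add_divide_distrib)
  qed
  show ?thesis
  proof (rule Lim_null_comparison)
    show "\<forall>\<^sub>F \<beta> in at_top. norm (op_exp (- t) (L \<beta>) (J_up G F g0) x - J_up G F (op_exp (- t) Lr g0) x) \<le>
        (D * t + norm (H t x) + C3) * (1 / \<beta>)"
      using eventually_ge_at_top[of 1] by eventually_elim (rule bound)
    have "((\<lambda>\<beta>::real. 1 / \<beta>) \<longlongrightarrow> 0) at_top" by real_asymp
    then show "((\<lambda>\<beta>. (D * t + norm (H t x) + C3) * (1 / \<beta>)) \<longlongrightarrow> 0) at_top"
      by (rule tendsto_mult_right_zero)
  qed
qed

definition defect :: "real \<Rightarrow> real \<Rightarrow> ('a \<Rightarrow> complex) \<Rightarrow> 'a \<Rightarrow> complex" where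
  "defect t \<beta> f x = op_exp (- t) (L \<beta>) f x - J_up G F (op_exp (- t) Lr (J_down G F f)) x"

text \<open>The coefficients of \<open>f - P f\<close> vanish, so it is some \<open>A h\<close>; the
  two preceding limits treat \<open>P f\<close> and \<open>A h\<close>.\<close>

lemma defect_tendsto:
  assumes t: "t > 0" and x: "x \<in> V" and f: "f \<in> fvec V"
  shows "((\<lambda>\<beta>. defect t \<beta> f x) \<longlongrightarrow> 0) at_top"
proof -
  have 1: "(\<lambda>y. f y - proj f y) \<in> fvec V" using f proj_in_fvec[of f] by (simp add: fvec_def)
  have 2: "coef R (\<lambda>y. f y - proj f y) = 0" if "R \<in> Rs" for R
    using that by (simp add: coef_diff coef_proj)
  from range_A[OF 1 2] obtain h where h: "A h = (\<lambda>y. f y - proj f y)" by blast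
  have "f = (\<lambda>y. J_up G F (J_down G F f) y + A h y)"
    by (simp add: h J_up_J_down)
  then have "op_exp (- t) (L \<beta>) f x =
      op_exp (- t) (L \<beta>) (J_up G F (J_down G F f)) x + op_exp (- t) (L \<beta>) (A h) x" for \<beta>
    using op_exp_add[OF finV x, of "- t" "L_matrix \<beta>" "J_up G F (J_down G F f)" "A h"] by simp
  then have "defect t \<beta> f x = (op_exp (- t) (L \<beta>) (J_up G F (J_down G F f)) x -
      J_up G F (op_exp (- t) Lr (J_down G F f)) x) + op_exp (- t) (L \<beta>) (A h) x" for \<beta>
    by (simp add: defect_def)
  then show ?thesis
    using tendsto_add[OF op_exp_kernel_tendsto[OF t x, of "J_down G F f"] op_exp_range_tendsto[OF t x, of h]]
    by simp
qed

lemma defect_expand: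
  assumes x: "x \<in> V" and f: "f \<in> fvec V"
  shows "defect t \<beta> f x = (\<Sum>y\<in>V. f y * defect t \<beta> (unit_vec y) x)"
proof -
  have J: "J_down G F f R = (\<Sum>y\<in>V. f y * J_down G F (unit_vec y) R)" if "R \<in> Rs" for R
  proof -
    have "J_down G F f R = coef R f" using that by (simp add: J_down_def ell2_inner_def coef_def)
    also have "\<dots> = coef R (\<lambda>x. \<Sum>y\<in>V. f y * unit_vec y x)"
      by (rule coef_cong) (simp add: unit_vec_sum)
    also have "\<dots> = (\<Sum>y\<in>V. f y * coef R (unit_vec y))" by (rule coef_sum)
    finally show ?thesis using that by (simp add: J_down_def ell2_inner_def coef_def)
  qed
  have "op_exp (- t) Lr (J_down G F f) R = (\<Sum>y\<in>V. f y * op_exp (- t) Lr (J_down G F (unit_vec y)) R)"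
    if R: "R \<in> Rs" for R
  proof -
    have "op_exp (- t) Lr (J_down G F f) R =
        op_exp (- t) Lr (\<lambda>R. \<Sum>y\<in>V. f y * J_down G F (unit_vec y) R) R"
      unfolding Lr_eq by (rule op_exp_cong[OF J R])
    then show ?thesis unfolding Lr_eq by (simp only: op_exp_sum[OF finite_reaches R])
  qed
  then have "J_up G F (op_exp (- t) Lr (J_down G F f)) x =
      (\<Sum>R\<in>Rs. \<Sum>y\<in>V. f y * op_exp (- t) Lr (J_down G F (unit_vec y)) R * \<gamma> R x)"
    unfolding J_up_def by (intro sum.cong) (auto simp: sum_distrib_right)
  also have "\<dots> = (\<Sum>y\<in>V. f y * J_up G F (op_exp (- t) Lr (J_down G F (unit_vec y))) x)"
    unfolding J_up_def by (subst sum.swap) (simp add: sum_distrib_left mult.assoc)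
  finally show ?thesis
    unfolding defect_def op_exp_expand[OF finV x, of "- t" "L_matrix \<beta>" f]
    by (simp add: right_diff_distrib sum_subtractf)
qed

section \<open>From matrix entries to the operator norm\<close>

lemma ell2_norm_eq: "ell2_norm G f = L2_set (\<lambda>x. norm (f x) * sqrt (m x)) V"
proof -
  have "Re (ell2_inner G f f) = (\<Sum>x\<in>V. (norm (f x) * sqrt (m x))\<^sup>2)"
    unfolding ell2_inner_def Re_sum
  proof (rule sum.cong[OF refl])
    fix x assume "x \<in> V"
    then have "m x > 0" by (rule mass_pos)
    moreover have "cnj (f x) * f x = of_real ((norm (f x))\<^sup>2)"
      by (simp only: complex_norm_square mult.commute)
    ultimately show "Re (cnj (f x) * f x * of_real (m x)) = (norm (f x) * sqrt (m x))\<^sup>2"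
      by (simp add: power_mult_distrib del: of_real_power)
  qed
  then show ?thesis by (simp add: ell2_norm_def L2_set_def)
qed

lemma ell2_norm_pointwise:
  assumes "x \<in> V"
  shows "norm (f x) \<le> ell2_norm G f / sqrt (m x)"
proof -
  have "norm (f x) * sqrt (m x) \<le> ell2_norm G f"
    unfolding ell2_norm_eq by (rule member_le_L2_set[OF finV assms])
  then show ?thesis using mass_pos[OF assms] by (simp add: field_simps)
qed

text \<open>The factor \<open>sqrt (m x) / sqrt (m y)\<close> passes to the orthonormal basis of
  normalized unit vectors, where the sum of the absolute matrix entries bounds the norm. Norm
  convergence thus reduces to finitely many scalar limits.\<close>

lemma op_norm_bound:
  assumes lin: "\<And>f x. f \<in> fvec V \<Longrightarrow> x \<in> V \<Longrightarrow> T f x = (\<Sum>y\<in>V. f y * T (unit_vec y) x)"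
  shows "norm (op_norm G T) \<le> (\<Sum>x\<in>V. \<Sum>y\<in>V. norm (T (unit_vec y) x) * (sqrt (m x) / sqrt (m y)))"
    (is "_ \<le> ?\<Phi>")
proof -
  have le: "ell2_norm G (T f) \<le> ?\<Phi>" if f: "f \<in> fvec V" "ell2_norm G f \<le> 1" for f
  proof -
    have "ell2_norm G (T f) \<le> (\<Sum>x\<in>V. norm (T f x) * sqrt (m x))"
      unfolding ell2_norm_eq using mass_pos by (intro L2_set_le_sum) (simp add: less_imp_le)
    also have "\<dots> \<le> ?\<Phi>"
    proof (rule sum_mono)
      fix x assume x: "x \<in> V"
      have "norm (T f x) \<le> (\<Sum>y\<in>V. (1 / sqrt (m y)) * norm (T (unit_vec y) x))"
        unfolding lin[OF f(1) x]
      proof (rule sum_norm_le)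
        fix y assume y: "y \<in> V"
        have "norm (f y) \<le> 1 / sqrt (m y)"
          using ell2_norm_pointwise[OF y, of f] f(2) mass_pos[OF y]
          by (meson divide_right_mono order_trans less_imp_le real_sqrt_ge_zero)
        then show "norm (f y * T (unit_vec y) x) \<le> 1 / sqrt (m y) * norm (T (unit_vec y) x)"
          unfolding norm_mult by (intro mult_right_mono) auto
      qed
      then have "norm (T f x) * sqrt (m x) \<le> (\<Sum>y\<in>V. (1 / sqrt (m y)) * norm (T (unit_vec y) x)) * sqrt (m x)"
        using mass_pos[OF x] by (intro mult_right_mono) auto
      also have "\<dots> = (\<Sum>y\<in>V. norm (T (unit_vec y) x) * (sqrt (m x) / sqrt (m y)))"
        unfolding sum_distrib_right by (intro sum.cong) simp_all
      finally show "norm (T f x) * sqrt (m x) \<le> (\<Sum>y\<in>V. norm (T (unit_vec y) x) * (sqrt (m x) / sqrt (m y)))" .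
    qed
    finally show ?thesis .
  qed
  \<comment> \<open>A real supremum is meaningful only over a nonempty bounded set; the zero
    function supplies nonemptiness and also the lower bound 0.\<close>
  have zero: "(\<lambda>_. 0) \<in> {f \<in> ell2 G. ell2_norm G f \<le> 1}"
    by (simp add: ell2_def ell2_norm_def ell2_inner_def)
  have bdd: "bdd_above ((\<lambda>f. ell2_norm G (T f)) ` {f \<in> ell2 G. ell2_norm G f \<le> 1})"
    using le by (intro bdd_aboveI[of _ ?\<Phi>]) (auto simp: ell2_eq_fvec)
  have "op_norm G T \<le> ?\<Phi>"
    unfolding op_norm_def using zero le by (intro cSUP_least) (auto simp: ell2_eq_fvec)
  moreover have "0 \<le> op_norm G T"
  proof -
    have "0 \<le> ell2_norm G (T (\<lambda>_. 0))" by (simp add: ell2_norm_eq L2_set_nonneg)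
    also have "\<dots> \<le> op_norm G T" unfolding op_norm_def by (rule cSUP_upper[OF zero bdd])
    finally show ?thesis .
  qed
  ultimately show ?thesis by simp
qed

lemma op_norm_defect_tendsto:
  assumes t: "t > 0"
  shows "((\<lambda>\<beta>. op_norm G (defect t \<beta>)) \<longlongrightarrow> 0) at_top"
proof (rule Lim_null_comparison)
  show "\<forall>\<^sub>F \<beta> in at_top. norm (op_norm G (defect t \<beta>)) \<le>
      (\<Sum>x\<in>V. \<Sum>y\<in>V. norm (defect t \<beta> (unit_vec y) x) * (sqrt (m x) / sqrt (m y)))"
    by (intro always_eventually allI op_norm_bound defect_expand)
  have "((\<lambda>\<beta>. \<Sum>x\<in>V. \<Sum>y\<in>V. norm (defect t \<beta> (unit_vec y) x) * (sqrt (m x) / sqrt (m y)))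
      \<longlongrightarrow> (\<Sum>x\<in>V. \<Sum>y\<in>V. 0)) at_top"
    by (intro tendsto_sum tendsto_mult_left_zero tendsto_norm_zero defect_tendsto[OF t]) auto
  then show "((\<lambda>\<beta>. \<Sum>x\<in>V. \<Sum>y\<in>V. norm (defect t \<beta> (unit_vec y) x) * (sqrt (m x) / sqrt (m y)))
      \<longlongrightarrow> 0) at_top"
    by simp
qed

end

theorem theorem4p14:
  fixes G :: "'a wdigraph" and \<C> :: "('a \<times> 'a) set set" and t :: real
  assumes "finite_wdigraph G"
    and "directed_clusters G \<C>"
    and "t > 0"
  shows "((\<lambda>\<beta>::real. op_norm G (\<lambda>f x.
             op_exp (- t) (scaled_laplacian G (\<Union>\<C>) \<beta>) f x
             - J_up G (\<Union>\<C>) (op_exp (- t) (laplacian (reduced_graph G (\<Union>\<C>)))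
                 (J_down G (\<Union>\<C>) f)) x)) \<longlongrightarrow> 0) at_top"
proof -
  interpret clustered_digraph G "\<Union>\<C>"
    using assms(1,2) by (auto simp: clustered_digraph_def clustered_digraph_axioms_def directed_clusters_def)
  have "(\<lambda>f x. op_exp (- t) (scaled_laplacian G (\<Union>\<C>) \<beta>) f x -
      J_up G (\<Union>\<C>) (op_exp (- t) (laplacian (reduced_graph G (\<Union>\<C>))) (J_down G (\<Union>\<C>) f)) x) = defect t \<beta>" for \<beta>
    by (simp add: fun_eq_iff defect_def scaled_laplacian_eq)
  then show ?thesis using op_norm_defect_tendsto[OF assms(3)] by simp
qed

end
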